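(* Let $G_\Gamma$ be a graph product of finite abelian groups over a finite simplicial graph $\Gamma$. Then $\operatorname{Out}(G_\Gamma)$ has Kazhdan's property (T) if and only if it is finite. Furthermore, if $G_\Gamma$ is given by its standard graph presentation, i.e. $G_\Gamma=G(\Gamma,p)$ for a map $p$ assigning to each vertex of $\Gamma$ a finite prime power, then $\operatorname{Out}(G_\Gamma)$ has property (T) if and only if $\Gamma$ contains no SIL.
   Context: For a simplicial graph $\Gamma$ and groups $G_v$ ($v\in V(\Gamma)$), the graph product is the quotient of the free product $\ast_{v\in V(\Gamma)}G_v$ by the relations that $G_u$ and $G_v$ commute whenever $u,v$ are adjacent. For $p$ assigning to each vertex a prime power (of the form $q^k$, $q$ prime, $k\ge1$), $G(\Gamma,p)=\langle V(\Gamma)\mid v^{p(v)}=1\ (v\in V(\Gamma)),\ [u,v]=1 \text{ whenever } u,v \text{ are adjacent}\rangle$. $\operatorname{Out}(G)=\operatorname{Aut}(G)/\operatorname{Inn}(G)$, regarded as a discrete group. For a vertex $v$, $\operatorname{lk}(v)$ is the set of vertices adjacent to $v$. For a set $S$ of vertices, $\Gamma\setminus S$ denotes the full (induced) subgraph on the vertices not in $S$; components are connected components. SIL: distinct vertices $x_1,x_2,z$ form a SIL, denoted $(x_1,x_2\mid z)$, if $x_1,x_2$ are not adjacent and $\Gamma\setminus(\operatorname{lk}(x_1)\cap\operatorname{lk}(x_2))$ has a component containing $z$ and neither $x_1$ nor $x_2$. *)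

theory Defs
  imports
    Complex_Main
    "HOL-Algebra.Algebra"
    "HOL-Number_Theory.Prime_Powers"
    "Graph_Theory.Digraph_Component"
begin

definition complex_field :: "complex ring"
  where "complex_field = \<lparr>carrier = UNIV, monoid.mult = (*), one = 1, ring.zero = 0, add = (+)\<rparr>"

record 'h hilbert = "(complex, 'h) module" +
  cinner :: "'h \<Rightarrow> 'h \<Rightarrow> complex"

definition hnorm :: "('h, 'm) hilbert_scheme \<Rightarrow> 'h \<Rightarrow> real"
  where "hnorm H x = sqrt (Re (cinner H x x))"

text \<open>
  The multiplicative fields of the record \<open>H\<close> (inherited from \<open>ring\<close>) play no role; an HOL-Algebra
  module only uses its additive structure and \<open>smult\<close>.
\<close>

locale hilbert_space = module complex_field H for H :: "('h, 'm) hilbert_scheme" (structure) +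
  assumes cinner_add_left:
      "\<lbrakk>x \<in> carrier H; y \<in> carrier H; z \<in> carrier H\<rbrakk>
        \<Longrightarrow> cinner H (x \<oplus> y) z = cinner H x z + cinner H y z"
    and cinner_smult_left:
      "\<lbrakk>x \<in> carrier H; y \<in> carrier H\<rbrakk> \<Longrightarrow> cinner H (c \<odot> x) y = c * cinner H x y"
    and cinner_commute:
      "\<lbrakk>x \<in> carrier H; y \<in> carrier H\<rbrakk> \<Longrightarrow> cinner H y x = cnj (cinner H x y)"
    and cinner_nonneg: "x \<in> carrier H \<Longrightarrow> 0 \<le> Re (cinner H x x)"
    and cinner_definite: "\<lbrakk>x \<in> carrier H; cinner H x x = 0\<rbrakk> \<Longrightarrow> x = \<zero>"
    and complete:
      "\<lbrakk>\<And>n::nat. f n \<in> carrier H;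
        \<And>e. e > 0 \<Longrightarrow> \<exists>N. \<forall>m\<ge>N. \<forall>n\<ge>N. hnorm H (f m \<ominus> f n) < e\<rbrakk>
        \<Longrightarrow> \<exists>l\<in>carrier H. (\<lambda>n. hnorm H (f n \<ominus> l)) \<longlonglongrightarrow> 0"

context hilbert_space
begin

lemma complex_field_simps [simp]:
  "carrier complex_field = UNIV" "a \<otimes>\<^bsub>complex_field\<^esub> b = a * b" "\<one>\<^bsub>complex_field\<^esub> = 1"
  "\<zero>\<^bsub>complex_field\<^esub> = 0" "a \<oplus>\<^bsub>complex_field\<^esub> b = a + b"
  by (simp_all add: complex_field_def)

lemma minus_eq_smult: "x \<in> carrier H \<Longrightarrow> \<ominus> x = (-1) \<odot> x"
proof -
  assume x: "x \<in> carrier H"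
  have "(-1) \<odot> x \<oplus> x = (-1) \<odot> x \<oplus> 1 \<odot> x" using smult_one[OF x] by simp
  also have "\<dots> = (-1 + 1) \<odot> x" using smult_l_distr[of "-1" 1 x] x by simp
  also have "\<dots> = \<zero>" using smult_l_null[OF x] by simp
  finally have "(-1) \<odot> x \<oplus> x = \<zero>" .
  then show ?thesis using x smult_closed[of "-1" x] M.minus_equality by force
qed

lemma smult_cl: "x \<in> carrier H \<Longrightarrow> c \<odot> x \<in> carrier H"
  using smult_closed[of c x] by simp

lemma cinner_add_right:
  assumes "x \<in> carrier H" "y \<in> carrier H" "z \<in> carrier H"
  shows "cinner H x (y \<oplus> z) = cinner H x y + cinner H x z"
  using assms cinner_commute[of "y \<oplus> z" x] cinner_commute[of y x] cinner_commute[of z x]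
  by (simp add: cinner_add_left)

lemma cinner_smult_right:
  assumes "x \<in> carrier H" "y \<in> carrier H"
  shows "cinner H x (c \<odot> y) = cnj c * cinner H x y"
  using assms cinner_commute[of "c \<odot> y" x] cinner_commute[of y x]
  by (simp add: cinner_smult_left smult_cl)

lemma cinner_minus_left:
  assumes "x \<in> carrier H" "y \<in> carrier H" "z \<in> carrier H"
  shows "cinner H (x \<ominus> y) z = cinner H x z - cinner H y z"
  using assms by (simp add: a_minus_def minus_eq_smult cinner_add_left cinner_smult_left smult_cl)

lemma cinner_minus_right:
  assumes "x \<in> carrier H" "y \<in> carrier H" "z \<in> carrier H"
  shows "cinner H z (x \<ominus> y) = cinner H z x - cinner H z y"
  using assms by (simp add: a_minus_def minus_eq_smult cinner_add_right cinner_smult_right smult_cl)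

lemma cinner_zero_left: "x \<in> carrier H \<Longrightarrow> cinner H \<zero> x = 0"
  using cinner_smult_left[of \<zero> x 0] smult_l_null[of "\<zero>"] by simp

lemma cinner_zero_right: "x \<in> carrier H \<Longrightarrow> cinner H x \<zero> = 0"
  using cinner_zero_left[of x] cinner_commute[of \<zero> x] by simp

lemma cinner_self: "x \<in> carrier H \<Longrightarrow> cinner H x x = of_real ((hnorm H x)\<^sup>2)"
  using cinner_commute[of x x] cinner_nonneg[of x]
  by (auto simp: hnorm_def complex_eq_iff)

lemma hnorm_nonneg: "x \<in> carrier H \<Longrightarrow> 0 \<le> hnorm H x"
  by (simp add: hnorm_def cinner_nonneg)

lemma cauchy_schwarz:
  assumes x: "x \<in> carrier H" and y: "y \<in> carrier H"
  shows "cmod (cinner H x y) \<le> hnorm H x * hnorm H y"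
proof (cases "y = \<zero>")
  case True
  then show ?thesis using x y by (simp add: cinner_zero_right hnorm_nonneg)
next
  case False
  define n where "n = (hnorm H y)\<^sup>2"
  have "hnorm H y \<noteq> 0" using False cinner_self[OF y] cinner_definite[OF y] by auto
  then have n: "n > 0" by (simp add: n_def)
  define a where "a = cinner H x y"
  define c where "c = a / of_real n"
  have yx: "cinner H y x = cnj a" using cinner_commute[OF x y] by (simp add: a_def)
  have yy: "cinner H y y = of_real n" using cinner_self[OF y] by (simp add: n_def)
  have "cinner H (x \<ominus> c \<odot> y) (x \<ominus> c \<odot> y)
      = cinner H x x - cnj c * a - (c * cnj a - c * (cnj c * of_real n))"
    using x y by (simp add: cinner_minus_left cinner_minus_right smult_cl M.minus_closed
        cinner_smult_left cinner_smult_right yx yy flip: a_def)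
      (simp add: algebra_simps)
  also have "\<dots> = cinner H x x - (a * cnj a) / of_real n"
    using n by (simp add: c_def field_simps)
  also have "\<dots> = of_real ((hnorm H x)\<^sup>2 - (cmod a)\<^sup>2 / n)"
    using cinner_self[OF x] by (simp add: complex_norm_square[symmetric])
  finally have "0 \<le> (hnorm H x)\<^sup>2 - (cmod a)\<^sup>2 / n"
    using cinner_nonneg[of "x \<ominus> c \<odot> y"] x y by (simp add: smult_cl M.minus_closed del: of_real_diff)
  then have "(cmod a)\<^sup>2 \<le> (hnorm H x * hnorm H y)\<^sup>2"
    using n by (simp add: field_simps n_def power_mult_distrib)
  then show ?thesis
    unfolding a_def by (rule power2_le_imp_le) (use x y in \<open>simp add: hnorm_nonneg\<close>)
qed

lemma pullback:
  fixes K :: "('k, 'm) hilbert_scheme"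
  assumes car: "\<And>a. a \<in> carrier K \<Longrightarrow> \<psi> a \<in> carrier H"
    and inj: "inj_on \<psi> (carrier K)"
    and add_cl: "\<And>a b. \<lbrakk>a \<in> carrier K; b \<in> carrier K\<rbrakk> \<Longrightarrow> a \<oplus>\<^bsub>K\<^esub> b \<in> carrier K"
    and zero_cl: "\<zero>\<^bsub>K\<^esub> \<in> carrier K"
    and smult_cl: "\<And>c a. a \<in> carrier K \<Longrightarrow> c \<odot>\<^bsub>K\<^esub> a \<in> carrier K"
    and add: "\<And>a b. \<lbrakk>a \<in> carrier K; b \<in> carrier K\<rbrakk> \<Longrightarrow> \<psi> (a \<oplus>\<^bsub>K\<^esub> b) = \<psi> a \<oplus> \<psi> b"
    and zero: "\<psi> \<zero>\<^bsub>K\<^esub> = \<zero>"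
    and smult: "\<And>c a. a \<in> carrier K \<Longrightarrow> \<psi> (c \<odot>\<^bsub>K\<^esub> a) = c \<odot> \<psi> a"
    and cin: "\<And>a b. \<lbrakk>a \<in> carrier K; b \<in> carrier K\<rbrakk> \<Longrightarrow> cinner K a b = cinner H (\<psi> a) (\<psi> b)"
    and closed: "\<And>f l. \<lbrakk>\<And>n::nat. f n \<in> carrier K; l \<in> carrier H;
        (\<lambda>n. hnorm H (\<psi> (f n) \<ominus> l)) \<longlonglongrightarrow> 0\<rbrakk> \<Longrightarrow> \<exists>k\<in>carrier K. \<psi> k = l"
  shows "hilbert_space K \<and>
    (\<forall>a\<in>carrier K. \<forall>b\<in>carrier K. hnorm K (a \<ominus>\<^bsub>K\<^esub> b) = hnorm H (\<psi> a \<ominus> \<psi> b))"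
proof -
  have eqI: "a = b" if "\<psi> a = \<psi> b" "a \<in> carrier K" "b \<in> carrier K" for a b
    using inj that by (auto dest: inj_onD)
  have ag: "abelian_group K"
  proof (rule abelian_groupI)
    fix x y z assume x: "x \<in> carrier K" and y: "y \<in> carrier K" and z: "z \<in> carrier K"
    show "x \<oplus>\<^bsub>K\<^esub> y \<oplus>\<^bsub>K\<^esub> z = x \<oplus>\<^bsub>K\<^esub> (y \<oplus>\<^bsub>K\<^esub> z)"
      by (rule eqI) (use x y z in \<open>auto simp: add add_cl car M.a_assoc\<close>)
  next
    fix x y assume x: "x \<in> carrier K" and y: "y \<in> carrier K"
    show "x \<oplus>\<^bsub>K\<^esub> y = y \<oplus>\<^bsub>K\<^esub> x"
      by (rule eqI) (use x y in \<open>auto simp: add add_cl car M.a_comm\<close>)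
  next
    fix x assume x: "x \<in> carrier K"
    show "\<zero>\<^bsub>K\<^esub> \<oplus>\<^bsub>K\<^esub> x = x"
      by (rule eqI) (use x zero_cl in \<open>auto simp: add zero add_cl car\<close>)
    have "\<psi> ((-1) \<odot>\<^bsub>K\<^esub> x \<oplus>\<^bsub>K\<^esub> x) = \<zero>"
      using x by (simp add: add smult smult_cl car M.l_neg flip: minus_eq_smult)
    then have "(-1) \<odot>\<^bsub>K\<^esub> x \<oplus>\<^bsub>K\<^esub> x = \<zero>\<^bsub>K\<^esub>"
      by (intro eqI) (use x zero_cl in \<open>auto simp: zero add_cl smult_cl\<close>)
    then show "\<exists>y\<in>carrier K. y \<oplus>\<^bsub>K\<^esub> x = \<zero>\<^bsub>K\<^esub>" using smult_cl[OF x] by blast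
  qed (use add_cl zero_cl in auto)
  have mod: "module complex_field K"
  proof (rule moduleI)
    show "cring complex_field" by (rule R.is_cring)
    show "abelian_group K" by (rule ag)
    fix a b x y assume x: "x \<in> carrier K" and y: "y \<in> carrier K"
    show "(a \<oplus>\<^bsub>complex_field\<^esub> b) \<odot>\<^bsub>K\<^esub> x = a \<odot>\<^bsub>K\<^esub> x \<oplus>\<^bsub>K\<^esub> b \<odot>\<^bsub>K\<^esub> x"
      by (rule eqI) (use x smult_l_distr[of a b "\<psi> x"] in \<open>auto simp: add smult smult_cl add_cl car\<close>)
    show "a \<odot>\<^bsub>K\<^esub> (x \<oplus>\<^bsub>K\<^esub> y) = a \<odot>\<^bsub>K\<^esub> x \<oplus>\<^bsub>K\<^esub> a \<odot>\<^bsub>K\<^esub> y"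
      by (rule eqI) (use x y smult_r_distr[of a "\<psi> x" "\<psi> y"] in \<open>auto simp: add smult smult_cl add_cl car\<close>)
    show "(a \<otimes>\<^bsub>complex_field\<^esub> b) \<odot>\<^bsub>K\<^esub> x = a \<odot>\<^bsub>K\<^esub> (b \<odot>\<^bsub>K\<^esub> x)"
      by (rule eqI) (use x smult_assoc1[of a b "\<psi> x"] in \<open>auto simp: add smult smult_cl add_cl car\<close>)
    show "\<one>\<^bsub>complex_field\<^esub> \<odot>\<^bsub>K\<^esub> x = x"
      by (rule eqI) (use x smult_one[of "\<psi> x"] in \<open>auto simp: add smult smult_cl add_cl car\<close>)
  qed (use smult_cl in auto)
  interpret K: abelian_group K by (rule ag)
  have min: "\<psi> (a \<ominus>\<^bsub>K\<^esub> b) = \<psi> a \<ominus> \<psi> b" if a: "a \<in> carrier K" and b: "b \<in> carrier K" for a b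
  proof -
    have "\<psi> (\<ominus>\<^bsub>K\<^esub> b) \<oplus> \<psi> b = \<zero>" using b add[of "\<ominus>\<^bsub>K\<^esub> b" b] zero by (simp add: K.l_neg)
    then have "\<psi> (\<ominus>\<^bsub>K\<^esub> b) = \<ominus> \<psi> b" using b car M.minus_equality by force
    then show ?thesis using a b by (simp add: a_minus_def add)
  qed
  have nrm: "hnorm K (a \<ominus>\<^bsub>K\<^esub> b) = hnorm H (\<psi> a \<ominus> \<psi> b)"
    if "a \<in> carrier K" "b \<in> carrier K" for a b
    using that by (simp add: hnorm_def cin min K.minus_closed)
  have "hilbert_space_axioms K"
  proof
    fix x y z assume "x \<in> carrier K" "y \<in> carrier K" "z \<in> carrier K"
    then show "cinner K (x \<oplus>\<^bsub>K\<^esub> y) z = cinner K x z + cinner K y z"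
      by (simp add: cin add add_cl car cinner_add_left)
  next
    fix c x y assume "x \<in> carrier K" "y \<in> carrier K"
    then show "cinner K (c \<odot>\<^bsub>K\<^esub> x) y = c * cinner K x y"
      by (simp add: cin smult smult_cl car cinner_smult_left)
  next
    fix x y assume "x \<in> carrier K" "y \<in> carrier K"
    then show "cinner K y x = cnj (cinner K x y)"
      using cinner_commute[of "\<psi> x" "\<psi> y"] by (simp add: cin car)
  next
    fix x assume "x \<in> carrier K"
    then show "0 \<le> Re (cinner K x x)" by (simp add: cin car cinner_nonneg)
  next
    fix x assume "x \<in> carrier K" "cinner K x x = 0"
    then show "x = \<zero>\<^bsub>K\<^esub>"
      using cinner_definite[of "\<psi> x"] zero zero_cl by (intro eqI) (auto simp: cin car)
  next
    fix f :: "nat \<Rightarrow> 'k"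
    assume f: "\<And>n. f n \<in> carrier K"
      and cau: "\<And>e. e > 0 \<Longrightarrow> \<exists>N. \<forall>m\<ge>N. \<forall>n\<ge>N. hnorm K (f m \<ominus>\<^bsub>K\<^esub> f n) < e"
    have "\<exists>l\<in>carrier H. (\<lambda>n. hnorm H (\<psi> (f n) \<ominus> l)) \<longlonglongrightarrow> 0"
      by (rule complete) (use f cau in \<open>simp_all add: car nrm\<close>)
    then obtain l where l: "l \<in> carrier H" "(\<lambda>n. hnorm H (\<psi> (f n) \<ominus> l)) \<longlonglongrightarrow> 0" by blast
    then obtain k where "k \<in> carrier K" "\<psi> k = l" using closed[OF f l] by blast
    with l show "\<exists>l\<in>carrier K. (\<lambda>n. hnorm K (f n \<ominus>\<^bsub>K\<^esub> l)) \<longlonglongrightarrow> 0"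
      using f by (intro bexI[of _ k]) (simp_all add: nrm)
  qed
  then show ?thesis using mod nrm by (auto simp: hilbert_space_def)
qed

end

definition unitary_operators :: "('h, 'm) hilbert_scheme \<Rightarrow> ('h \<Rightarrow> 'h) set"
  where "unitary_operators H = {U \<in> Bij (carrier H).
    (\<forall>x\<in>carrier H. \<forall>y\<in>carrier H. U (x \<oplus>\<^bsub>H\<^esub> y) = U x \<oplus>\<^bsub>H\<^esub> U y) \<and>
    (\<forall>c. \<forall>x\<in>carrier H. U (c \<odot>\<^bsub>H\<^esub> x) = c \<odot>\<^bsub>H\<^esub> U x) \<and>
    (\<forall>x\<in>carrier H. \<forall>y\<in>carrier H. cinner H (U x) (U y) = cinner H x y)}"

definition unitary_group :: "('h, 'm) hilbert_scheme \<Rightarrow> ('h \<Rightarrow> 'h) monoid"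
  where "unitary_group H = BijGroup (carrier H) \<lparr>carrier := unitary_operators H\<rparr>"

definition kazhdan_pair ::
    "'h itself \<Rightarrow> ('g, 'm) monoid_scheme \<Rightarrow> 'g set \<Rightarrow> real \<Rightarrow> bool"
  where "kazhdan_pair TYPE('h) G Q \<epsilon> \<longleftrightarrow>
    (\<forall>(H :: 'h hilbert) \<pi>. hilbert_space H \<longrightarrow> \<pi> \<in> hom G (unitary_group H) \<longrightarrow>
      (\<exists>\<xi>\<in>carrier H. \<xi> \<noteq> \<zero>\<^bsub>H\<^esub> \<and> (\<forall>q\<in>Q. hnorm H (\<pi> q \<xi> \<ominus>\<^bsub>H\<^esub> \<xi>) < \<epsilon> * hnorm H \<xi>)) \<longrightarrow>
      (\<exists>\<eta>\<in>carrier H. \<eta> \<noteq> \<zero>\<^bsub>H\<^esub> \<and> (\<forall>g\<in>carrier G. \<pi> g \<eta> = \<eta>)))"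

text \<open>
  In a discrete group the compact subsets are the finite ones, and every homomorphism to a unitary
  group is continuous. HOL cannot quantify over the type of a Hilbert space within a definition,
  so the spaces are taken on the type \<open>'g \<Rightarrow> complex\<close>. This loses nothing: by the lemma
  \<open>kazhdan_pair_any_type\<close> below, \<open>(Q, \<epsilon>)\<close> is then a Kazhdan pair for representations on Hilbert
  spaces over every type.
\<close>

definition property_T :: "('g, 'm) monoid_scheme \<Rightarrow> bool"
  where "property_T G \<longleftrightarrow>
    (\<exists>Q \<epsilon>. finite Q \<and> Q \<subseteq> carrier G \<and> \<epsilon> > 0 \<and> kazhdan_pair TYPE('g \<Rightarrow> complex) G Q \<epsilon>)"

lemma kazhdan_pair_any_type:
  fixes G :: "('g, 'm) monoid_scheme"
  assumes G: "group G" and Q: "Q \<subseteq> carrier G" and T: "kazhdan_pair TYPE('g \<Rightarrow> complex) G Q \<epsilon>"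
  shows "kazhdan_pair TYPE('h) G Q \<epsilon>"
  unfolding kazhdan_pair_def
proof (intro allI impI)
  fix H :: "'h hilbert" and \<pi>
  assume "hilbert_space H" and hom: "\<pi> \<in> hom G (unitary_group H)"
    and "\<exists>\<xi>\<in>carrier H. \<xi> \<noteq> \<zero>\<^bsub>H\<^esub> \<and> (\<forall>q\<in>Q. hnorm H (\<pi> q \<xi> \<ominus>\<^bsub>H\<^esub> \<xi>) < \<epsilon> * hnorm H \<xi>)"
  interpret G: group G by (rule G)
  interpret hilbert_space H by fact
  obtain \<xi> where \<xi>: "\<xi> \<in> carrier H" "\<xi> \<noteq> \<zero>\<^bsub>H\<^esub>"
    and inv: "\<And>q. q \<in> Q \<Longrightarrow> hnorm H (\<pi> q \<xi> \<ominus>\<^bsub>H\<^esub> \<xi>) < \<epsilon> * hnorm H \<xi>"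
    using \<open>\<exists>\<xi>\<in>_. _\<close> by blast
  have U: "\<pi> g \<in> unitary_operators H" if "g \<in> carrier G" for g
    using hom that by (auto simp: hom_def unitary_group_def)
  have B: "\<pi> g \<in> Bij (carrier H)" if "g \<in> carrier G" for g
    using U[OF that] by (simp add: unitary_operators_def)
  have cl: "\<pi> g x \<in> carrier H" if "g \<in> carrier G" "x \<in> carrier H" for g x
    using Bij_imp_funcset[OF B[OF that(1)]] that(2) by auto
  have mul: "\<pi> (g \<otimes>\<^bsub>G\<^esub> h) x = \<pi> g (\<pi> h x)"
    if "g \<in> carrier G" "h \<in> carrier G" "x \<in> carrier H" for g h x
    using hom_mult[OF hom that(1,2)] that B
    by (simp add: unitary_group_def BijGroup_def compose_def)
  have p1: "\<pi> \<one>\<^bsub>G\<^esub> x = x" if x: "x \<in> carrier H" for x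
  proof -
    have "\<pi> \<one>\<^bsub>G\<^esub> (\<pi> \<one>\<^bsub>G\<^esub> x) = \<pi> \<one>\<^bsub>G\<^esub> x" using mul[of "\<one>\<^bsub>G\<^esub>" "\<one>\<^bsub>G\<^esub>" x] x by simp
    moreover have "inj_on (\<pi> \<one>\<^bsub>G\<^esub>) (carrier H)" using B[of "\<one>\<^bsub>G\<^esub>"] by (auto simp: Bij_def bij_betw_def)
    ultimately show ?thesis using cl x by (auto dest: inj_onD)
  qed
  have Uadd: "\<pi> g (x \<oplus>\<^bsub>H\<^esub> y) = \<pi> g x \<oplus>\<^bsub>H\<^esub> \<pi> g y"
    if "g \<in> carrier G" "x \<in> carrier H" "y \<in> carrier H" for g x y
    using U[OF that(1)] that by (simp add: unitary_operators_def)
  have Usm: "\<pi> g (c \<odot>\<^bsub>H\<^esub> x) = c \<odot>\<^bsub>H\<^esub> \<pi> g x"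
    if "g \<in> carrier G" "x \<in> carrier H" for g x c
    using U[OF that(1)] that by (simp add: unitary_operators_def)
  have Uin: "cinner H (\<pi> g x) (\<pi> g y) = cinner H x y"
    if "g \<in> carrier G" "x \<in> carrier H" "y \<in> carrier H" for g x y
    using U[OF that(1)] that by (simp add: unitary_operators_def)
  have Uadj: "cinner H (\<pi> g x) y = cinner H x (\<pi> (inv\<^bsub>G\<^esub> g) y)"
    if "g \<in> carrier G" "x \<in> carrier H" "y \<in> carrier H" for g x y
  proof -
    have "cinner H (\<pi> g x) y = cinner H (\<pi> (inv\<^bsub>G\<^esub> g) (\<pi> g x)) (\<pi> (inv\<^bsub>G\<^esub> g) y)"
      using that Uin cl by simp
    also have "\<pi> (inv\<^bsub>G\<^esub> g) (\<pi> g x) = x" using that mul[of "inv\<^bsub>G\<^esub> g" g x] p1 by simp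
    finally show ?thesis .
  qed
  define P where "P = {\<zeta> \<in> carrier H. \<forall>g\<in>carrier G. cinner H \<zeta> (\<pi> g \<xi>) = 0}"
  define K where "K = {\<eta> \<in> carrier H. \<forall>\<zeta>\<in>P. cinner H \<eta> \<zeta> = 0}"
  define \<Phi> where "\<Phi> \<eta> = (\<lambda>g. cinner H \<eta> (\<pi> g \<xi>))" for \<eta>
  define \<Psi> where "\<Psi> = inv_into K \<Phi>"
  have PH: "\<zeta> \<in> carrier H" if "\<zeta> \<in> P" for \<zeta> using that by (simp add: P_def)
  have KH: "\<eta> \<in> carrier H" if "\<eta> \<in> K" for \<eta> using that by (simp add: K_def)
  have Kadd: "x \<oplus>\<^bsub>H\<^esub> y \<in> K" if "x \<in> K" "y \<in> K" for x y
    using that by (auto simp: K_def cinner_add_left PH)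
  have Kz: "\<zero>\<^bsub>H\<^esub> \<in> K" by (auto simp: K_def cinner_zero_left PH)
  have Ksm: "c \<odot>\<^bsub>H\<^esub> x \<in> K" if "x \<in> K" for x c
    using that by (auto simp: K_def cinner_smult_left PH smult_cl)
  have K\<xi>: "\<xi> \<in> K"
  proof -
    have "cinner H \<xi> \<zeta> = 0" if "\<zeta> \<in> P" for \<zeta>
    proof -
      have "cinner H \<zeta> (\<pi> \<one>\<^bsub>G\<^esub> \<xi>) = 0" using that by (simp add: P_def)
      then show ?thesis using p1[OF \<xi>(1)] cinner_commute[OF PH[OF that] \<xi>(1)] by simp
    qed
    then show ?thesis using \<xi> by (simp add: K_def)
  qed
  have Pinv: "\<pi> g \<zeta> \<in> P" if g: "g \<in> carrier G" and z: "\<zeta> \<in> P" for g \<zeta>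
  proof -
    have "cinner H (\<pi> g \<zeta>) (\<pi> h \<xi>) = 0" if h: "h \<in> carrier G" for h
    proof -
      have "cinner H (\<pi> g \<zeta>) (\<pi> h \<xi>) = cinner H \<zeta> (\<pi> (inv\<^bsub>G\<^esub> g) (\<pi> h \<xi>))"
        using Uadj[OF g PH[OF z] cl[OF h \<xi>(1)]] .
      also have "\<dots> = cinner H \<zeta> (\<pi> (inv\<^bsub>G\<^esub> g \<otimes>\<^bsub>G\<^esub> h) \<xi>)" using mul g h \<xi>(1) by simp
      also have "\<dots> = 0" using z g h by (simp add: P_def)
      finally show ?thesis .
    qed
    then show ?thesis using cl[OF g PH[OF z]] by (simp add: P_def)
  qed
  have Kinv: "\<pi> g \<eta> \<in> K" if g: "g \<in> carrier G" and e: "\<eta> \<in> K" for g \<eta>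
  proof -
    have "cinner H (\<pi> g \<eta>) \<zeta> = 0" if z: "\<zeta> \<in> P" for \<zeta>
      using Uadj[OF g KH[OF e] PH[OF z]] Pinv[OF G.inv_closed[OF g] z] e by (simp add: K_def)
    then show ?thesis using cl[OF g KH[OF e]] by (simp add: K_def)
  qed
  have injP: "inj_on \<Phi> K"
  proof (rule inj_onI)
    fix x y assume x: "x \<in> K" and y: "y \<in> K" and eq: "\<Phi> x = \<Phi> y"
    have xy: "x \<ominus>\<^bsub>H\<^esub> y \<in> carrier H" using x y KH by simp
    have "cinner H (x \<ominus>\<^bsub>H\<^esub> y) (\<pi> g \<xi>) = 0" if "g \<in> carrier G" for g
      using fun_cong[OF eq, of g] that x y KH cl \<xi>(1) by (simp add: \<Phi>_def cinner_minus_left)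
    then have "x \<ominus>\<^bsub>H\<^esub> y \<in> P" using xy by (simp add: P_def)
    moreover have "x \<ominus>\<^bsub>H\<^esub> y \<in> K"
      using x y by (simp add: a_minus_def minus_eq_smult KH Kadd Ksm)
    ultimately have "cinner H (x \<ominus>\<^bsub>H\<^esub> y) (x \<ominus>\<^bsub>H\<^esub> y) = 0" by (simp add: K_def)
    then have "x \<ominus>\<^bsub>H\<^esub> y = \<zero>\<^bsub>H\<^esub>" using xy cinner_definite by blast
    then have "\<ominus>\<^bsub>H\<^esub> (\<ominus>\<^bsub>H\<^esub> y) = x"
      using M.minus_equality[of x "\<ominus>\<^bsub>H\<^esub> y"] x y KH by (simp add: a_minus_def)
    then show "x = y" using y KH by simp
  qed
  have Psi: "\<Psi> a \<in> K" if "a \<in> \<Phi> ` K" for a using that by (simp add: \<Psi>_def inv_into_into)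
  have PsiPhi: "\<Psi> (\<Phi> x) = x" if "x \<in> K" for x using that injP by (simp add: \<Psi>_def)
  have PhiPsi: "\<Phi> (\<Psi> a) = a" if "a \<in> \<Phi> ` K" for a using that by (simp add: \<Psi>_def f_inv_into_f)
  define K' :: "('g \<Rightarrow> complex) hilbert" where "K' = \<lparr>carrier = \<Phi> ` K, monoid.mult = undefined, one = undefined,
    ring.zero = \<Phi> \<zero>\<^bsub>H\<^esub>, add = (\<lambda>a b. \<Phi> (\<Psi> a \<oplus>\<^bsub>H\<^esub> \<Psi> b)), smult = (\<lambda>c a. \<Phi> (c \<odot>\<^bsub>H\<^esub> \<Psi> a)),
    cinner = (\<lambda>a b. cinner H (\<Psi> a) (\<Psi> b))\<rparr>"
  have K's [simp]: "carrier K' = \<Phi> ` K" "\<zero>\<^bsub>K'\<^esub> = \<Phi> \<zero>\<^bsub>H\<^esub>"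
    "a \<oplus>\<^bsub>K'\<^esub> b = \<Phi> (\<Psi> a \<oplus>\<^bsub>H\<^esub> \<Psi> b)" "c \<odot>\<^bsub>K'\<^esub> a = \<Phi> (c \<odot>\<^bsub>H\<^esub> \<Psi> a)"
    "cinner K' a b = cinner H (\<Psi> a) (\<Psi> b)" for a b c
    by (simp_all add: K'_def)
  have HK: "hilbert_space K' \<and>
    (\<forall>a\<in>carrier K'. \<forall>b\<in>carrier K'. hnorm K' (a \<ominus>\<^bsub>K'\<^esub> b) = hnorm H (\<Psi> a \<ominus>\<^bsub>H\<^esub> \<Psi> b))"
  proof (rule pullback[where \<psi> = \<Psi>])
    show "inj_on \<Psi> (carrier K')" by (rule inj_on_inverseI[of _ \<Phi>]) (simp add: PhiPsi)
    fix f l assume f: "\<And>n::nat. f n \<in> carrier K'" and l: "l \<in> carrier H"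
      and lim: "(\<lambda>n. hnorm H (\<Psi> (f n) \<ominus>\<^bsub>H\<^esub> l)) \<longlonglongrightarrow> 0"
    have "cinner H l \<zeta> = 0" if z: "\<zeta> \<in> P" for \<zeta>
    proof -
      have "cmod (cinner H l \<zeta>) \<le> hnorm H (\<Psi> (f n) \<ominus>\<^bsub>H\<^esub> l) * hnorm H \<zeta>" for n
      proof -
        have fK: "\<Psi> (f n) \<in> K" using f Psi by simp
        then have "cinner H (\<Psi> (f n) \<ominus>\<^bsub>H\<^esub> l) \<zeta> = - cinner H l \<zeta>"
          using z l by (simp add: cinner_minus_left KH PH) (simp add: K_def)
        then show ?thesis
          using cauchy_schwarz[of "\<Psi> (f n) \<ominus>\<^bsub>H\<^esub> l" \<zeta>] fK z l KH PH by simp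
      qed
      moreover have "(\<lambda>n. hnorm H (\<Psi> (f n) \<ominus>\<^bsub>H\<^esub> l) * hnorm H \<zeta>) \<longlonglongrightarrow> 0"
        using tendsto_mult_right[OF lim, of "hnorm H \<zeta>"] by simp
      ultimately have "cmod (cinner H l \<zeta>) \<le> 0"
        by (intro LIMSEQ_le_const) auto
      then show ?thesis by simp
    qed
    then have "l \<in> K" using l by (simp add: K_def)
    then show "\<exists>k\<in>carrier K'. \<Psi> k = l" by (auto simp: PsiPhi)
  qed (auto simp: PsiPhi Psi KH Kadd Kz Ksm)
  define \<rho> where "\<rho> g = (\<lambda>a\<in>carrier K'. \<Phi> (\<pi> g (\<Psi> a)))" for g
  have rho: "\<rho> g a = \<Phi> (\<pi> g (\<Psi> a))" if "a \<in> \<Phi> ` K" for g a using that by (simp add: \<rho>_def)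
  have rcl: "\<rho> g a \<in> \<Phi> ` K" if "g \<in> carrier G" "a \<in> \<Phi> ` K" for g a
    using that by (simp add: rho Kinv Psi)
  have rmul: "\<rho> (g \<otimes>\<^bsub>G\<^esub> h) a = \<rho> g (\<rho> h a)"
    if "g \<in> carrier G" "h \<in> carrier G" "a \<in> \<Phi> ` K" for g h a
    using that by (simp add: rcl) (simp add: rho mul KH Psi PsiPhi Kinv)
  have rone: "\<rho> \<one>\<^bsub>G\<^esub> a = a" if "a \<in> \<Phi> ` K" for a
    using that by (simp add: rho p1 KH Psi PhiPsi)
  have rB: "\<rho> g \<in> Bij (carrier K')" if g: "g \<in> carrier G" for g
  proof -
    have "bij_betw (\<rho> g) (carrier K') (carrier K')"
    proof (rule bij_betwI[of _ _ _ "\<rho> (inv\<^bsub>G\<^esub> g)"])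
      fix a assume a: "a \<in> carrier K'"
      show "\<rho> (inv\<^bsub>G\<^esub> g) (\<rho> g a) = a"
        using rmul[of "inv\<^bsub>G\<^esub> g" g a] a g by (simp add: rone)
      show "\<rho> g (\<rho> (inv\<^bsub>G\<^esub> g) a) = a"
        using rmul[of g "inv\<^bsub>G\<^esub> g" a] a g by (simp add: rone)
    qed (use rcl g in auto)
    then show ?thesis by (auto simp: Bij_def \<rho>_def)
  qed
  have rU: "\<rho> g \<in> unitary_operators K'" if g: "g \<in> carrier G" for g
    using rB[OF g] g
    by (auto simp: unitary_operators_def rho Psi Kadd Ksm PsiPhi Uadd Usm Uin KH Kinv)
  have "\<rho> \<in> hom G (unitary_group K')"
  proof (rule homI)
    fix g assume "g \<in> carrier G"
    then show "\<rho> g \<in> carrier (unitary_group K')" using rU by (simp add: unitary_group_def)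
  next
    fix g h assume g: "g \<in> carrier G" and h: "h \<in> carrier G"
    have "\<rho> (g \<otimes>\<^bsub>G\<^esub> h) a = compose (carrier K') (\<rho> g) (\<rho> h) a" for a
      using rmul[OF g h, of a] by (auto simp: compose_def) (simp add: \<rho>_def)
    then show "\<rho> (g \<otimes>\<^bsub>G\<^esub> h) = \<rho> g \<otimes>\<^bsub>unitary_group K'\<^esub> \<rho> h"
      using rB g h by (auto simp: unitary_group_def BijGroup_def)
  qed
  moreover have "\<exists>\<xi>\<in>carrier K'. \<xi> \<noteq> \<zero>\<^bsub>K'\<^esub> \<and>
      (\<forall>q\<in>Q. hnorm K' (\<rho> q \<xi> \<ominus>\<^bsub>K'\<^esub> \<xi>) < \<epsilon> * hnorm K' \<xi>)"
  proof (intro bexI conjI ballI)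
    show "\<Phi> \<xi> \<in> carrier K'" using K\<xi> by simp
    show "\<Phi> \<xi> \<noteq> \<zero>\<^bsub>K'\<^esub>" using inj_onD[OF injP] K\<xi> Kz \<xi>(2) by auto
    fix q assume q: "q \<in> Q"
    with Q have qG: "q \<in> carrier G" by auto
    have "hnorm K' (\<rho> q (\<Phi> \<xi>) \<ominus>\<^bsub>K'\<^esub> \<Phi> \<xi>) = hnorm H (\<Psi> (\<rho> q (\<Phi> \<xi>)) \<ominus>\<^bsub>H\<^esub> \<Psi> (\<Phi> \<xi>))"
      using HK K\<xi> rcl[OF qG, of "\<Phi> \<xi>"] K's(1) by blast
    also have "\<dots> = hnorm H (\<pi> q \<xi> \<ominus>\<^bsub>H\<^esub> \<xi>)"
      using K\<xi> qG by (simp add: rho PsiPhi Kinv)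
    also have "\<dots> < \<epsilon> * hnorm H \<xi>" by (rule inv[OF q])
    also have "hnorm H \<xi> = hnorm K' (\<Phi> \<xi>)" using K\<xi> by (simp add: hnorm_def PsiPhi)
    finally show "hnorm K' (\<rho> q (\<Phi> \<xi>) \<ominus>\<^bsub>K'\<^esub> \<Phi> \<xi>) < \<epsilon> * hnorm K' (\<Phi> \<xi>)" .
  qed
  ultimately obtain \<eta> where e: "\<eta> \<in> carrier K'" "\<eta> \<noteq> \<zero>\<^bsub>K'\<^esub>"
    and fixed: "\<And>g. g \<in> carrier G \<Longrightarrow> \<rho> g \<eta> = \<eta>"
    using T[unfolded kazhdan_pair_def, rule_format, of K' \<rho>] HK by blast
  have eK: "\<Psi> \<eta> \<in> K" using e Psi by simp
  have "\<Psi> \<eta> \<noteq> \<zero>\<^bsub>H\<^esub>" using e PhiPsi[of \<eta>] by auto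
  moreover have "\<pi> g (\<Psi> \<eta>) = \<Psi> \<eta>" if g: "g \<in> carrier G" for g
    using arg_cong[OF fixed[OF g], of \<Psi>] e eK g by (simp add: rho PsiPhi Kinv)
  ultimately show "\<exists>\<eta>\<in>carrier H. \<eta> \<noteq> \<zero>\<^bsub>H\<^esub> \<and> (\<forall>g\<in>carrier G. \<pi> g \<eta> = \<eta>)"
    using KH[OF eK] by blast
qed

definition Inn :: "('a, 'm) monoid_scheme \<Rightarrow> ('a \<Rightarrow> 'a) set"
  where "Inn G = (\<lambda>g. \<lambda>x\<in>carrier G. g \<otimes>\<^bsub>G\<^esub> x \<otimes>\<^bsub>G\<^esub> inv\<^bsub>G\<^esub> g) ` carrier G"

definition Out :: "('a, 'm) monoid_scheme \<Rightarrow> ('a \<Rightarrow> 'a) set monoid"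
  where "Out G = AutoGroup G Mod Inn G"

lemma Inn_normal:
  fixes G (structure)
  assumes "group G"
  shows "Inn G \<lhd> AutoGroup G"
proof -
  interpret G: group G by fact
  interpret A: group "AutoGroup G" by (rule G.AutoGroup)
  define c where "c g = (\<lambda>x\<in>carrier G. g \<otimes> x \<otimes> inv g)" for g
  have c_app: "c g x = g \<otimes> x \<otimes> inv g" if "x \<in> carrier G" for g x using that by (simp add: c_def)
  have Inn_c: "Inn G = c ` carrier G" by (simp add: Inn_def c_def)
  have carA: "carrier (AutoGroup G) = auto G" by (simp add: AutoGroup_def)
  have multA: "f \<otimes>\<^bsub>AutoGroup G\<^esub> h = compose (carrier G) f h" if "f \<in> auto G" "h \<in> auto G" for f h
    using that by (simp add: AutoGroup_def BijGroup_def auto_def)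
  have c_comp: "compose (carrier G) (c g) (c h) = c (g \<otimes> h)"
    if g: "g \<in> carrier G" and h: "h \<in> carrier G" for g h
    using g h by (auto simp: compose_def c_def G.m_assoc G.inv_mult_group intro!: restrict_ext)
  have c_one: "c \<one> = (\<lambda>x\<in>carrier G. x)" by (auto simp: c_def intro!: restrict_ext)
  have oneA: "\<one>\<^bsub>AutoGroup G\<^esub> = c \<one>" by (simp add: c_one AutoGroup_def BijGroup_def)
  have c_cl: "c g x \<in> carrier G" if "g \<in> carrier G" "x \<in> carrier G" for g x
    using that by (simp add: c_app)
  have c_inv: "c (inv g) (c g x) = x" if "g \<in> carrier G" "x \<in> carrier G" for g x
    using fun_cong[OF c_comp[of "inv g" g], of x] that c_one by (simp add: compose_def)
  have c_auto: "c g \<in> auto G" if g: "g \<in> carrier G" for g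
  proof -
    have "bij_betw (c g) (carrier G) (carrier G)"
      by (rule bij_betwI[of _ _ _ "c (inv g)"])
        (use g c_cl c_inv c_inv[of "inv g"] in auto)
    moreover have "c g \<in> hom G G"
    proof (rule homI)
      fix x y assume x: "x \<in> carrier G" and y: "y \<in> carrier G"
      have "inv g \<otimes> (g \<otimes> z) = z" if "z \<in> carrier G" for z
        using g that by (simp flip: G.m_assoc)
      then show "c g (x \<otimes> y) = c g x \<otimes> c g y" using g x y by (simp add: c_app G.m_assoc)
    qed (use g c_cl in auto)
    ultimately show ?thesis by (auto simp: auto_def Bij_def c_def)
  qed
  have c_mult: "c g \<otimes>\<^bsub>AutoGroup G\<^esub> c h = c (g \<otimes> h)"
    if "g \<in> carrier G" "h \<in> carrier G" for g h
    using that by (simp add: multA c_auto c_comp)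
  have invA: "inv\<^bsub>AutoGroup G\<^esub> (c g) = c (inv g)" if g: "g \<in> carrier G" for g
    by (rule A.inv_equality) (use g in \<open>auto simp: c_mult c_auto carA oneA\<close>)
  have "subgroup (Inn G) (AutoGroup G)"
  proof (rule subgroup.intro)
    show "Inn G \<subseteq> carrier (AutoGroup G)" using c_auto by (auto simp: Inn_c carA)
    show "\<one>\<^bsub>AutoGroup G\<^esub> \<in> Inn G" by (auto simp: Inn_c oneA)
  qed (auto simp: Inn_c c_mult invA)
  then show ?thesis
  proof (rule A.normal_invI)
    fix f h assume f: "f \<in> carrier (AutoGroup G)" and "h \<in> Inn G"
    then obtain g where g: "g \<in> carrier G" and h: "h = c g" by (auto simp: Inn_c)
    have fa: "f \<in> auto G" using f carA by simp
    then have fcl: "f x \<in> carrier G" if "x \<in> carrier G" for x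
      using that by (auto simp: auto_def hom_def)
    have fh: "group_hom G G f"
      using fa by (simp add: group_hom_def group_hom_axioms_def auto_def assms)
    have "f \<otimes>\<^bsub>AutoGroup G\<^esub> h = c (f g) \<otimes>\<^bsub>AutoGroup G\<^esub> f"
    proof -
      have "f (c g x) = c (f g) (f x)" if x: "x \<in> carrier G" for x
        using g x fcl by (simp add: c_app group_hom.hom_mult[OF fh] group_hom.hom_inv[OF fh])
      then show ?thesis
        using fa g h c_auto fcl by (auto simp: multA compose_def intro!: restrict_ext)
    qed
    then have "f \<otimes>\<^bsub>AutoGroup G\<^esub> h \<otimes>\<^bsub>AutoGroup G\<^esub> inv\<^bsub>AutoGroup G\<^esub> f
        = c (f g) \<otimes>\<^bsub>AutoGroup G\<^esub> f \<otimes>\<^bsub>AutoGroup G\<^esub> inv\<^bsub>AutoGroup G\<^esub> f" by simp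
    also have "\<dots> = c (f g)"
      using f c_auto[OF fcl[OF g], folded carA] by (simp add: A.m_assoc)
    finally show "f \<otimes>\<^bsub>AutoGroup G\<^esub> h \<otimes>\<^bsub>AutoGroup G\<^esub> inv\<^bsub>AutoGroup G\<^esub> f \<in> Inn G"
      using fcl[OF g] by (simp add: Inn_c)
  qed
qed

lemma group_Out: "group G \<Longrightarrow> group (Out G)"
  by (simp add: Out_def normal.factorgroup_is_group Inn_normal)

definition fp_words :: "'v set \<Rightarrow> ('v \<Rightarrow> ('a, 'm) monoid_scheme) \<Rightarrow> ('v \<times> 'a) list set"
  where "fp_words V G = lists (SIGMA v:V. carrier (G v))"

inductive_set fp_rel ::
    "'v set \<Rightarrow> ('v \<Rightarrow> ('a, 'm) monoid_scheme) \<Rightarrow> (('v \<times> 'a) list \<times> ('v \<times> 'a) list) set"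
  for V G where
    refl: "w \<in> fp_words V G \<Longrightarrow> (w, w) \<in> fp_rel V G"
  | sym: "(u, w) \<in> fp_rel V G \<Longrightarrow> (w, u) \<in> fp_rel V G"
  | trans: "\<lbrakk>(u, w) \<in> fp_rel V G; (w, x) \<in> fp_rel V G\<rbrakk> \<Longrightarrow> (u, x) \<in> fp_rel V G"
  | cong: "\<lbrakk>(u, w) \<in> fp_rel V G; p \<in> fp_words V G; q \<in> fp_words V G\<rbrakk>
      \<Longrightarrow> (p @ u @ q, p @ w @ q) \<in> fp_rel V G"
  | one: "v \<in> V \<Longrightarrow> ([(v, \<one>\<^bsub>G v\<^esub>)], []) \<in> fp_rel V G"
  | mult: "\<lbrakk>v \<in> V; g \<in> carrier (G v); h \<in> carrier (G v)\<rbrakk>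
      \<Longrightarrow> ([(v, g), (v, h)], [(v, g \<otimes>\<^bsub>G v\<^esub> h)]) \<in> fp_rel V G"

definition free_product ::
    "'v set \<Rightarrow> ('v \<Rightarrow> ('a, 'm) monoid_scheme) \<Rightarrow> ('v \<times> 'a) list set monoid"
  where "free_product V G =
    \<lparr>carrier = fp_words V G // fp_rel V G,
     monoid.mult = (\<lambda>A B. \<Union>a\<in>A. \<Union>b\<in>B. fp_rel V G `` {a @ b}),
     one = fp_rel V G `` {[]}\<rparr>"

lemma fp_words_append [simp]: "u @ w \<in> fp_words V G \<longleftrightarrow> u \<in> fp_words V G \<and> w \<in> fp_words V G"
  by (auto simp: fp_words_def)

lemma fp_words_Nil [simp]: "[] \<in> fp_words V G"
  by (simp add: fp_words_def)

lemma fp_words_Cons [simp]: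
  "(v, g) # w \<in> fp_words V G \<longleftrightarrow> v \<in> V \<and> g \<in> carrier (G v) \<and> w \<in> fp_words V G"
  by (auto simp: fp_words_def)

lemma fp_rel_words:
  assumes "\<And>v. v \<in> V \<Longrightarrow> group (G v)" "(u, w) \<in> fp_rel V G"
  shows "u \<in> fp_words V G \<and> w \<in> fp_words V G"
  using assms(2)
  by induction (auto simp: assms(1) monoid.m_closed[OF group.is_monoid]
      monoid.one_closed[OF group.is_monoid])

lemma equiv_fp_rel:
  assumes "\<And>v. v \<in> V \<Longrightarrow> group (G v)"
  shows "equiv (fp_words V G) (fp_rel V G)"
proof (rule equivI)
  show "fp_rel V G \<subseteq> fp_words V G \<times> fp_words V G" by (rule subrelI) (use fp_rel_words[of V G] assms in blast)
  show "refl_on (fp_words V G) (fp_rel V G)" by (auto intro: refl_onI fp_rel.refl)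
  show "sym (fp_rel V G)" by (auto intro: symI fp_rel.sym)
  show "trans (fp_rel V G)" by (auto intro: transI fp_rel.trans)
qed

lemma free_product_mult_class:
  assumes G: "\<And>v. v \<in> V \<Longrightarrow> group (G v)" and u: "u \<in> fp_words V G" and w: "w \<in> fp_words V G"
  shows "fp_rel V G `` {u} \<otimes>\<^bsub>free_product V G\<^esub> fp_rel V G `` {w} = fp_rel V G `` {u @ w}"
proof -
  have "(a @ b, u @ w) \<in> fp_rel V G" if a: "(u, a) \<in> fp_rel V G" and b: "(w, b) \<in> fp_rel V G" for a b
  proof -
    have "(u @ w, a @ w) \<in> fp_rel V G" using fp_rel.cong[OF a, of "[]" w] w by simp
    moreover have "(a @ w, a @ b) \<in> fp_rel V G"
      using fp_rel.cong[OF b, of a "[]"] fp_rel_words[of V G, OF G a] by simp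
    ultimately show ?thesis by (blast intro: fp_rel.sym fp_rel.trans)
  qed
  then have cls: "fp_rel V G `` {a @ b} = fp_rel V G `` {u @ w}"
    if "(u, a) \<in> fp_rel V G" "(w, b) \<in> fp_rel V G" for a b
    using equiv_class_eq[OF equiv_fp_rel[of V G, OF G]] that by blast
  have "(\<Union>a\<in>fp_rel V G `` {u}. \<Union>b\<in>fp_rel V G `` {w}. fp_rel V G `` {a @ b})
      = (\<Union>a\<in>fp_rel V G `` {u}. \<Union>b\<in>fp_rel V G `` {w}. fp_rel V G `` {u @ w})"
    by (intro SUP_cong refl cls) simp_all
  also have "\<dots> = fp_rel V G `` {u @ w}"
    using fp_rel.refl[OF u] fp_rel.refl[OF w] by blast
  finally show ?thesis by (simp add: free_product_def)
qed

lemma group_free_product: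
  assumes G: "\<And>v. v \<in> V \<Longrightarrow> group (G v)"
  shows "group (free_product V G)"
proof -
  let ?F = "free_product V G" and ?c = "\<lambda>w. fp_rel V G `` {w}"
  have car: "carrier ?F = ?c ` fp_words V G" by (auto simp: free_product_def quotient_def)
  have one: "\<one>\<^bsub>?F\<^esub> = ?c []" by (simp add: free_product_def)
  note mult = free_product_mult_class[of V G, OF G]
  have inv: "\<exists>u\<in>fp_words V G. (u @ w, []) \<in> fp_rel V G" if "w \<in> fp_words V G" for w
    using that
  proof (induction w)
    case Nil
    then show ?case by (auto intro!: bexI[of _ "[]"] fp_rel.refl)
  next
    case (Cons x w)
    obtain v g where x: "x = (v, g)" by (cases x)
    with Cons obtain u where u: "u \<in> fp_words V G" "(u @ w, []) \<in> fp_rel V G" by auto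
    have v: "v \<in> V" and g: "g \<in> carrier (G v)" and w: "w \<in> fp_words V G"
      using Cons.prems by (auto simp: x)
    interpret Gv: group "G v" using v by (rule G)
    let ?i = "inv\<^bsub>G v\<^esub> g"
    have "([(v, ?i), (v, g)], [(v, \<one>\<^bsub>G v\<^esub>)]) \<in> fp_rel V G"
      using fp_rel.mult[of v V ?i G g] v g by simp
    then have "([(v, ?i), (v, g)], []) \<in> fp_rel V G" using fp_rel.one[OF v] by (rule fp_rel.trans)
    from fp_rel.cong[OF this u(1) w] have "((u @ [(v, ?i)]) @ x # w, u @ w) \<in> fp_rel V G"
      by (simp add: x)
    then have "((u @ [(v, ?i)]) @ x # w, []) \<in> fp_rel V G" using u(2) by (rule fp_rel.trans)
    then show ?case using u(1) v g by (intro bexI[of _ "u @ [(v, ?i)]"]) auto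
  qed
  show ?thesis
  proof (rule groupI)
    fix A assume "A \<in> carrier ?F"
    then obtain w where w: "A = ?c w" "w \<in> fp_words V G" by (auto simp: car)
    then obtain u where u: "u \<in> fp_words V G" "(u @ w, []) \<in> fp_rel V G" using inv by blast
    have "?c u \<otimes>\<^bsub>?F\<^esub> A = \<one>\<^bsub>?F\<^esub>"
      using equiv_class_eq[OF equiv_fp_rel[of V G, OF G] u(2)] u(1) w by (simp add: mult one)
    then show "\<exists>B\<in>carrier ?F. B \<otimes>\<^bsub>?F\<^esub> A = \<one>\<^bsub>?F\<^esub>" using u(1) by (auto simp: car)
  qed (auto simp: car one mult simp flip: append_assoc)
qed

definition fp_incl ::
    "'v set \<Rightarrow> ('v \<Rightarrow> ('a, 'm) monoid_scheme) \<Rightarrow> 'v \<Rightarrow> 'a \<Rightarrow> ('v \<times> 'a) list set"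
  where "fp_incl V G v g = fp_rel V G `` {[(v, g)]}"

lemma fp_incl_closed:
  "\<lbrakk>v \<in> V; g \<in> carrier (G v)\<rbrakk> \<Longrightarrow> fp_incl V G v g \<in> carrier (free_product V G)"
  by (auto simp: fp_incl_def free_product_def intro!: quotientI)

definition commutator :: "('a, 'm) monoid_scheme \<Rightarrow> 'a \<Rightarrow> 'a \<Rightarrow> 'a"
  where "commutator G x y = x \<otimes>\<^bsub>G\<^esub> y \<otimes>\<^bsub>G\<^esub> inv\<^bsub>G\<^esub> x \<otimes>\<^bsub>G\<^esub> inv\<^bsub>G\<^esub> y"

lemma commutator_closed:
  "\<lbrakk>group G; x \<in> carrier G; y \<in> carrier G\<rbrakk> \<Longrightarrow> commutator G x y \<in> carrier G"
  by (simp add: commutator_def group.inv_closed monoid.m_closed group.is_monoid)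

definition normal_closure :: "('a, 'm) monoid_scheme \<Rightarrow> 'a set \<Rightarrow> 'a set"
  where "normal_closure G S =
    generate G {g \<otimes>\<^bsub>G\<^esub> s \<otimes>\<^bsub>G\<^esub> inv\<^bsub>G\<^esub> g | g s. g \<in> carrier G \<and> s \<in> S}"

lemma normal_normal_closure:
  assumes "group G" "S \<subseteq> carrier G"
  shows "normal_closure G S \<lhd> G"
proof -
  interpret group G by fact
  show ?thesis
    unfolding normal_closure_def
  proof (rule normal_generateI)
    fix h k
    assume "h \<in> {g \<otimes>\<^bsub>G\<^esub> s \<otimes>\<^bsub>G\<^esub> inv\<^bsub>G\<^esub> g | g s. g \<in> carrier G \<and> s \<in> S}" and k: "k \<in> carrier G"
    then obtain g s where h: "h = g \<otimes>\<^bsub>G\<^esub> s \<otimes>\<^bsub>G\<^esub> inv\<^bsub>G\<^esub> g" and g: "g \<in> carrier G" and s: "s \<in> S" by blast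
    have "k \<otimes>\<^bsub>G\<^esub> h \<otimes>\<^bsub>G\<^esub> inv\<^bsub>G\<^esub> k = (k \<otimes>\<^bsub>G\<^esub> g) \<otimes>\<^bsub>G\<^esub> s \<otimes>\<^bsub>G\<^esub> inv\<^bsub>G\<^esub> (k \<otimes>\<^bsub>G\<^esub> g)"
      using g k s assms(2) by (auto simp: h m_assoc inv_mult_group subset_iff)
    then show "k \<otimes>\<^bsub>G\<^esub> h \<otimes>\<^bsub>G\<^esub> inv\<^bsub>G\<^esub> k \<in> {g \<otimes>\<^bsub>G\<^esub> s \<otimes>\<^bsub>G\<^esub> inv\<^bsub>G\<^esub> g | g s. g \<in> carrier G \<and> s \<in> S}"
      using g k s by (intro CollectI exI[of _ "k \<otimes>\<^bsub>G\<^esub> g"] exI[of _ s]) auto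
  qed (use assms(2) in auto)
qed

definition graph_product ::
    "'v pair_pre_digraph \<Rightarrow> ('v \<Rightarrow> ('a, 'm) monoid_scheme) \<Rightarrow> ('v \<times> 'a) list set set monoid"
  where "graph_product \<Gamma> G =
    (let F = free_product (pverts \<Gamma>) G; \<iota> = fp_incl (pverts \<Gamma>) G in
      F Mod normal_closure F
        {commutator F (\<iota> u g) (\<iota> v h) | u v g h.
          u \<rightarrow>\<^bsub>\<Gamma>\<^esub> v \<and> g \<in> carrier (G u) \<and> h \<in> carrier (G v)})"

lemma group_graph_product:
  assumes "pair_graph \<Gamma>" and G: "\<And>v. v \<in> pverts \<Gamma> \<Longrightarrow> group (G v)"
  shows "group (graph_product \<Gamma> G)"
proof -
  interpret pair_graph \<Gamma> by fact
  have F: "group (free_product (pverts \<Gamma>) G)" using G by (rule group_free_product)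
  show ?thesis
    unfolding graph_product_def Let_def
    by (rule normal.factorgroup_is_group, rule normal_normal_closure[OF F])
      (auto intro!: commutator_closed[OF F] fp_incl_closed dest: in_arcsD1 in_arcsD2)
qed

definition free_group_on :: "'v set \<Rightarrow> ('v \<times> int) list set monoid"
  where "free_group_on V = free_product V (\<lambda>_. integer_group)"

definition free_gen :: "'v set \<Rightarrow> 'v \<Rightarrow> ('v \<times> int) list set"
  where "free_gen V v = fp_incl V (\<lambda>_. integer_group) v 1"

definition presented_group ::
    "'v set \<Rightarrow> ('v \<times> int) list set set \<Rightarrow> ('v \<times> int) list set set monoid"
  where "presented_group V R = free_group_on V Mod normal_closure (free_group_on V) R"

definition standard_graph_group ::
    "'v pair_pre_digraph \<Rightarrow> ('v \<Rightarrow> nat) \<Rightarrow> ('v \<times> int) list set set monoid"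
  where "standard_graph_group \<Gamma> p =
    (let F = free_group_on (pverts \<Gamma>); x = free_gen (pverts \<Gamma>) in
      presented_group (pverts \<Gamma>)
        ({x v [^]\<^bsub>F\<^esub> p v | v. v \<in> pverts \<Gamma>} \<union> {commutator F (x u) (x v) | u v. u \<rightarrow>\<^bsub>\<Gamma>\<^esub> v}))"

lemma group_standard_graph_group:
  assumes "pair_graph \<Gamma>"
  shows "group (standard_graph_group \<Gamma> p)"
proof -
  interpret pair_graph \<Gamma> by fact
  have F: "group (free_group_on (pverts \<Gamma>))"
    unfolding free_group_on_def by (rule group_free_product) simp
  have x: "free_gen (pverts \<Gamma>) v \<in> carrier (free_group_on (pverts \<Gamma>))" if "v \<in> pverts \<Gamma>" for v
    using that fp_incl_closed[of v "pverts \<Gamma>" 1 "\<lambda>_. integer_group"]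
    by (simp add: free_gen_def free_group_on_def)
  show ?thesis
    unfolding standard_graph_group_def presented_group_def Let_def
    by (rule normal.factorgroup_is_group, rule normal_normal_closure[OF F])
      (auto intro!: commutator_closed[OF F] x monoid.nat_pow_closed[OF group.is_monoid[OF F]]
        dest: in_arcsD1 in_arcsD2)
qed

text \<open>
  Finite simplicial graphs are rendered by \<open>pair_graph\<close>: finite, loop-free, symmetric digraphs whose
  arcs are pairs of vertices. In a symmetric digraph the strongly connected components are the
  connected components.
\<close>

definition lk :: "'v pair_pre_digraph \<Rightarrow> 'v \<Rightarrow> 'v set"
  where "lk \<Gamma> v = {u. v \<rightarrow>\<^bsub>\<Gamma>\<^esub> u}"

definition SIL :: "'v pair_pre_digraph \<Rightarrow> 'v \<Rightarrow> 'v \<Rightarrow> 'v \<Rightarrow> bool"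
  where "SIL \<Gamma> x1 x2 z \<longleftrightarrow>
    x1 \<in> pverts \<Gamma> \<and> x2 \<in> pverts \<Gamma> \<and> z \<in> pverts \<Gamma> \<and>
    x1 \<noteq> x2 \<and> x1 \<noteq> z \<and> x2 \<noteq> z \<and> \<not> x1 \<rightarrow>\<^bsub>\<Gamma>\<^esub> x2 \<and>
    (\<exists>C \<in> pre_digraph.sccs_verts (with_proj \<Gamma> \<restriction> (pverts \<Gamma> - (lk \<Gamma> x1 \<inter> lk \<Gamma> x2))).
      z \<in> C \<and> x1 \<notin> C \<and> x2 \<notin> C)"

end

theory Submission
  imports Defs
begin

text \<open>
  Only finitely many conjugacy classes of torsion elements exist, so up to finite index every
  automorphism \<open>\<phi>\<close> conjugates each vertex group, \<open>\<phi> g = h\<^sub>v g h\<^sub>v\<inverse>\<close> for \<open>g\<close> in \<open>G\<^sub>v\<close>. The group acts on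
  itself, viewed as the chambers of a right-angled building; the coset \<open>h\<^sub>v G\<^bsub>st v\<^esub>\<close> is a wall whose
  complementary wings are permuted simply transitively by \<open>\<phi> G\<^sub>v\<close>. If for every \<open>u\<close> the walls of all non-neighbours lie
  in the same wing of the wall of \<open>u\<close>, then the intersection of these wings is a fundamental domain by
  a ping-pong argument, hence a single chamber, and \<open>\<phi>\<close> is inner.

  The wing of the wall of \<open>u\<close> that contains the wall of \<open>v\<close> depends only on the component of \<open>v\<close> in
  \<open>\<Gamma> \ st u\<close>, so it can be adjusted by a partial conjugation by elements of \<open>G\<^sub>u\<close>. Without a SIL this
  does not disturb the wings of the other walls, and finitely many products of partial conjugations
  represent the outer automorphism group up to finite index.

  For a SIL \<open>(x\<^sub>1, x\<^sub>2 | z)\<close>, the retraction \<open>r\<close> onto \<open>G\<^bsub>x\<^sub>1\<^esub> * G\<^bsub>x\<^sub>2\<^esub>\<close> turns \<open>\<phi>\<close> into conjugation by some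
  \<open>y\<close>, and \<open>\<phi> \<mapsto> r(h\<^sub>z)\<inverse> y\<close> is a homomorphism to the virtually free group \<open>G\<^bsub>x\<^sub>1\<^esub> * G\<^bsub>x\<^sub>2\<^esub>\<close> that kills inner
  automorphisms and does not kill the commutator of two partial conjugations. A finite-index
  subgroup therefore maps nontrivially to \<open>\<int>\<close>; inducing the characters \<open>exp (i \<theta> \<tau>)\<close> with small
  \<open>\<theta>\<close> contradicts property (T).
\<close>

section \<open>Reduced words\<close>

text \<open>One dichotomy gives both claims: if the vertices with nontrivial group admit no SIL,
  then Out is finite, and finite groups have (T); if they admit one, then Out lacks (T).

  No building is constructed. A gallery is a word multiplied on the right, and the wing of a wall is
  read off from the left syllable \<open>\<delta>\<close>. The geometry rests on
  \<open>delta_right\<close>: a letter multiplied on the right changes the left syllable at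
  \<open>u\<close> only inside the star subgroup of \<open>u\<close>. The same fact computes
  centralizers.

  The free product of \<open>G x1\<close> and \<open>G x2\<close> is generated by elements of finite
  order, so it has no nonzero homomorphism to the integers. This forces the passage to the kernel
  \<open>Ker\<close> of a map to the finite group \<open>G x1 \<times> G x2\<close>, on which a
  translation number exists, and then the induction of characters to the whole group.\<close>

inductive_set gp_rel ::
    "'v set \<Rightarrow> ('v \<Rightarrow> 'v \<Rightarrow> bool) \<Rightarrow> ('v \<Rightarrow> ('a, 'm) monoid_scheme) \<Rightarrow> (('v \<times> 'a) list \<times> ('v \<times> 'a) list) set"
  for V adj G where
    refl: "w \<in> fp_words V G \<Longrightarrow> (w, w) \<in> gp_rel V adj G"
  | sym: "(u, w) \<in> gp_rel V adj G \<Longrightarrow> (w, u) \<in> gp_rel V adj G"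
  | trans: "\<lbrakk>(u, w) \<in> gp_rel V adj G; (w, x) \<in> gp_rel V adj G\<rbrakk> \<Longrightarrow> (u, x) \<in> gp_rel V adj G"
  | cong: "\<lbrakk>(u, w) \<in> gp_rel V adj G; p \<in> fp_words V G; q \<in> fp_words V G\<rbrakk>
      \<Longrightarrow> (p @ u @ q, p @ w @ q) \<in> gp_rel V adj G"
  | one: "v \<in> V \<Longrightarrow> ([(v, \<one>\<^bsub>G v\<^esub>)], []) \<in> gp_rel V adj G"
  | mult: "\<lbrakk>v \<in> V; g \<in> carrier (G v); h \<in> carrier (G v)\<rbrakk>
      \<Longrightarrow> ([(v, g), (v, h)], [(v, g \<otimes>\<^bsub>G v\<^esub> h)]) \<in> gp_rel V adj G"
  | comm: "\<lbrakk>u \<in> V; v \<in> V; adj u v; g \<in> carrier (G u); h \<in> carrier (G v)\<rbrakk>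
      \<Longrightarrow> ([(u, g), (v, h)], [(v, h), (u, g)]) \<in> gp_rel V adj G"

locale vertex_groups =
  fixes V :: "'v set" and adj :: "'v \<Rightarrow> 'v \<Rightarrow> bool" and G :: "'v \<Rightarrow> ('a, 'm) monoid_scheme"
  assumes group_G: "v \<in> V \<Longrightarrow> group (G v)"
    and adj_sym: "adj u v \<Longrightarrow> adj v u"
    and adj_irrefl: "\<not> adj v v"
begin

lemma G_closed [simp]:
  "\<lbrakk>v \<in> V; g \<in> carrier (G v); h \<in> carrier (G v)\<rbrakk> \<Longrightarrow> g \<otimes>\<^bsub>G v\<^esub> h \<in> carrier (G v)"
  "v \<in> V \<Longrightarrow> \<one>\<^bsub>G v\<^esub> \<in> carrier (G v)"
  "\<lbrakk>v \<in> V; g \<in> carrier (G v)\<rbrakk> \<Longrightarrow> inv\<^bsub>G v\<^esub> g \<in> carrier (G v)"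
  using group_G by (auto simp: group.inv_closed monoid.m_closed group.is_monoid monoid.one_closed)

lemma G_simps [simp]:
  "\<lbrakk>v \<in> V; g \<in> carrier (G v)\<rbrakk> \<Longrightarrow> g \<otimes>\<^bsub>G v\<^esub> \<one>\<^bsub>G v\<^esub> = g"
  "\<lbrakk>v \<in> V; g \<in> carrier (G v)\<rbrakk> \<Longrightarrow> \<one>\<^bsub>G v\<^esub> \<otimes>\<^bsub>G v\<^esub> g = g"
  "\<lbrakk>v \<in> V; g \<in> carrier (G v)\<rbrakk> \<Longrightarrow> g \<otimes>\<^bsub>G v\<^esub> inv\<^bsub>G v\<^esub> g = \<one>\<^bsub>G v\<^esub>"
  "\<lbrakk>v \<in> V; g \<in> carrier (G v)\<rbrakk> \<Longrightarrow> inv\<^bsub>G v\<^esub> g \<otimes>\<^bsub>G v\<^esub> g = \<one>\<^bsub>G v\<^esub>"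
  "v \<in> V \<Longrightarrow> inv\<^bsub>G v\<^esub> \<one>\<^bsub>G v\<^esub> = \<one>\<^bsub>G v\<^esub>"
  "\<lbrakk>v \<in> V; g \<in> carrier (G v)\<rbrakk> \<Longrightarrow> inv\<^bsub>G v\<^esub> (inv\<^bsub>G v\<^esub> g) = g"
  using group_G by (auto simp: group.r_inv group.l_inv monoid.r_one monoid.l_one group.is_monoid monoid.inv_one group.inv_inv)

lemma G_assoc:
  "\<lbrakk>v \<in> V; g \<in> carrier (G v); h \<in> carrier (G v); k \<in> carrier (G v)\<rbrakk>
    \<Longrightarrow> g \<otimes>\<^bsub>G v\<^esub> h \<otimes>\<^bsub>G v\<^esub> k = g \<otimes>\<^bsub>G v\<^esub> (h \<otimes>\<^bsub>G v\<^esub> k)"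
  using group_G by (auto simp: monoid.m_assoc group.is_monoid)

text \<open>The syllable at \<open>v\<close> that can be shuffled to the front, or
  \<open>\<one>\<close> if there is none or a noncommuting syllable stands before it.\<close>

fun hd_at :: "'v \<Rightarrow> ('v \<times> 'a) list \<Rightarrow> 'a" where
  "hd_at v [] = \<one>\<^bsub>G v\<^esub>"
| "hd_at v ((u, h) # w) = (if u = v then h else if adj u v then hd_at v w else \<one>\<^bsub>G v\<^esub>)"

text \<open>The condition on \<open>hd_at\<close> looks to the right only: no later syllable at the
  same vertex can be shuffled up to this one.\<close>

fun red :: "('v \<times> 'a) list \<Rightarrow> bool" where
  "red [] \<longleftrightarrow> True"
| "red ((v, g) # w) \<longleftrightarrow>
    v \<in> V \<and> g \<in> carrier (G v) \<and> g \<noteq> \<one>\<^bsub>G v\<^esub> \<and> hd_at v w = \<one>\<^bsub>G v\<^esub> \<and> red w"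

text \<open>Left multiplication of a reduced word by a syllable, which moves right past commuting syllables.\<close>

fun push :: "'v \<Rightarrow> 'a \<Rightarrow> ('v \<times> 'a) list \<Rightarrow> ('v \<times> 'a) list" where
  "push v g [] = (if g = \<one>\<^bsub>G v\<^esub> then [] else [(v, g)])"
| "push v g ((u, h) # w) =
    (if u = v then (if g \<otimes>\<^bsub>G v\<^esub> h = \<one>\<^bsub>G v\<^esub> then w else (v, g \<otimes>\<^bsub>G v\<^esub> h) # w)
     else if adj u v then (u, h) # push v g w
     else if g = \<one>\<^bsub>G v\<^esub> then (u, h) # w else (v, g) # (u, h) # w)"

lemma red_words: "red w \<Longrightarrow> w \<in> fp_words V G"
  by (induction w rule: red.induct) auto

lemma hd_at_closed: "\<lbrakk>red w; v \<in> V\<rbrakk> \<Longrightarrow> hd_at v w \<in> carrier (G v)"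
  by (induction w rule: red.induct) auto

lemma hd_at_push:
  "\<lbrakk>red w; v \<in> V; g \<in> carrier (G v)\<rbrakk> \<Longrightarrow> hd_at v (push v g w) = g \<otimes>\<^bsub>G v\<^esub> hd_at v w"
  by (induction v g w rule: push.induct) (auto simp: adj_irrefl)

lemma hd_at_push_adj:
  "\<lbrakk>adj u v; u \<in> V; v \<in> V\<rbrakk> \<Longrightarrow> hd_at u (push v g w) = hd_at u w"
  by (induction v g w rule: push.induct) (auto simp: adj_irrefl dest: adj_sym)

text \<open>Of two front syllables one has to be shuffled past the other, so distinct vertices that
  both have one are adjacent.\<close>

lemma hd_at_clash:
  "\<lbrakk>hd_at u w \<noteq> \<one>\<^bsub>G u\<^esub>; u \<noteq> v; \<not> adj u v\<rbrakk> \<Longrightarrow> hd_at v w = \<one>\<^bsub>G v\<^esub>"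
  by (induction u w rule: hd_at.induct) (auto split: if_splits dest: adj_sym)

lemma red_push: "\<lbrakk>red w; v \<in> V; g \<in> carrier (G v)\<rbrakk> \<Longrightarrow> red (push v g w)"
  by (induction v g w rule: push.induct) (auto simp: hd_at_push_adj dest: adj_sym)

lemma push_one: "\<lbrakk>red w; v \<in> V\<rbrakk> \<Longrightarrow> push v \<one>\<^bsub>G v\<^esub> w = w"
  by (induction w rule: red.induct) auto

lemma fst_set_push: "fst ` set (push v g w) \<subseteq> insert v (fst ` set w)"
  by (induction v g w rule: push.induct) (auto split: if_splits)

section \<open>Shuffles of commuting syllables\<close>

inductive sw :: "('v \<times> 'a) list \<Rightarrow> ('v \<times> 'a) list \<Rightarrow> bool" where
  swap: "adj u v \<Longrightarrow> sw ((u, g) # (v, h) # w) ((v, h) # (u, g) # w)"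
| cons: "sw w w' \<Longrightarrow> sw (x # w) (x # w')"

abbreviation sim :: "('v \<times> 'a) list \<Rightarrow> ('v \<times> 'a) list \<Rightarrow> bool" (infix "\<doteq>" 50)
  where "sim \<equiv> sw\<^sup>*\<^sup>*"

lemma sw_sym: "sw w w' \<Longrightarrow> sw w' w"
  by (induction rule: sw.induct) (auto intro: sw.intros dest: adj_sym)

lemma sim_sym: "w \<doteq> w' \<Longrightarrow> w' \<doteq> w"
  by (induction rule: rtranclp_induct) (auto intro: converse_rtranclp_into_rtranclp dest: sw_sym)

lemma sim_cons: "w \<doteq> w' \<Longrightarrow> x # w \<doteq> x # w'"
  by (induction rule: rtranclp_induct) (auto intro: rtranclp.rtrancl_into_rtrancl sw.cons)

lemma sim_swap: "adj u v \<Longrightarrow> (u, g) # (v, h) # w \<doteq> (v, h) # (u, g) # w"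
  by (blast intro: sw.swap)

lemma sw_hd_at: "sw w w' \<Longrightarrow> hd_at v w = hd_at v w'"
  by (induction rule: sw.induct) (auto dest: adj_sym simp: adj_irrefl)

lemma sw_length: "sw w w' \<Longrightarrow> length w = length w'"
  by (induction rule: sw.induct) auto

lemma sim_hd_at: "w \<doteq> w' \<Longrightarrow> hd_at v w = hd_at v w'"
  by (induction rule: rtranclp_induct) (auto dest: sw_hd_at)

lemma sim_length: "w \<doteq> w' \<Longrightarrow> length w = length w'"
  by (induction rule: rtranclp_induct) (auto dest: sw_length)

text \<open>The pushed syllable may pass one of the two swapped syllables and stop before the other,
  so the results agree only up to shuffles.\<close>

lemma push_sw: "sw w w' \<Longrightarrow> push v g w \<doteq> push v g w'"
proof (induction rule: sw.induct)
  case (swap a b k h w)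
  have ba: "adj b a" and ab: "a \<noteq> b" using swap adj_sym adj_irrefl by auto
  have 3: "(a, k) # (v, g) # (b, h) # w \<doteq> (v, g) # (b, h) # (a, k) # w" if "adj a v"
    using sim_swap[OF that] sim_cons[OF sim_swap[OF swap]] by (metis rtranclp_trans)
  have 4: "(v, g) # (a, k) # (b, h) # w \<doteq> (b, h) # (v, g) # (a, k) # w" if "adj b v"
    using sim_swap[OF adj_sym[OF that]] sim_cons[OF sim_swap[OF swap]] by (metis rtranclp_trans)
  show ?case using ab swap ba 3 4 by (auto simp: adj_irrefl intro: sim_swap sim_cons)
next
  case (cons w w' x)
  then show ?case by (cases x) (auto intro: sim_cons)
qed

lemma push_sim: "w \<doteq> w' \<Longrightarrow> push v g w \<doteq> push v g w'"
  by (induction rule: rtranclp_induct) (auto dest: push_sw[of _ _ v g])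

lemma push_fresh: "\<lbrakk>red w; v \<in> V; hd_at v w = \<one>\<^bsub>G v\<^esub>; g \<noteq> \<one>\<^bsub>G v\<^esub>\<rbrakk> \<Longrightarrow> push v g w \<doteq> (v, g) # w"
proof (induction v g w rule: push.induct)
  case (2 v g u h w)
  show ?case
  proof (cases "u \<noteq> v \<and> adj u v")
    case True
    then have "push v g ((u, h) # w) \<doteq> (u, h) # (v, g) # w" using 2 by (auto intro: sim_cons)
    then show ?thesis using sim_swap[of u v h g w] True by (metis rtranclp_trans)
  qed (use 2 in auto)
qed auto

lemma push_push:
  "\<lbrakk>red w; v \<in> V; g \<in> carrier (G v); h \<in> carrier (G v)\<rbrakk>
    \<Longrightarrow> push v g (push v h w) \<doteq> push v (g \<otimes>\<^bsub>G v\<^esub> h) w"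
proof (induction v h w rule: push.induct)
  case (2 v h u k w)
  show ?case
  proof (cases "u = v")
    case True
    have k: "k \<in> carrier (G v)" "k \<noteq> \<one>\<^bsub>G v\<^esub>" "hd_at v w = \<one>\<^bsub>G v\<^esub>" "red w" using 2 True by auto
    show ?thesis
    proof (cases "h \<otimes>\<^bsub>G v\<^esub> k = \<one>\<^bsub>G v\<^esub>")
      case h: True
      then have "g \<otimes>\<^bsub>G v\<^esub> h \<otimes>\<^bsub>G v\<^esub> k = g" using 2 k by (simp add: G_assoc)
      then show ?thesis using True h k 2 push_fresh[of w v g] by (auto simp: push_one)
    next
      case False
      then show ?thesis using True 2 k by (auto simp: G_assoc)
    qed
  next
    case False
    then show ?thesis using 2 by (auto intro: sim_cons simp: adj_irrefl)
  qed
qed auto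

lemma push_comm:
  "\<lbrakk>red w; adj u v; u \<in> V; v \<in> V\<rbrakk> \<Longrightarrow> push u g (push v h w) \<doteq> push v h (push u g w)"
proof (induction w rule: red.induct)
  case 1
  then show ?case using adj_sym[of u v] adj_irrefl by (auto intro: sim_swap)
next
  case (2 x k w)
  have "adj v u" "u \<noteq> v" using 2 adj_sym adj_irrefl by auto
  then show ?case using 2 by (auto intro: sim_cons sim_swap dest: adj_sym simp: adj_irrefl)
qed

section \<open>The action of words on reduced words and the normal form theorem\<close>

definition act :: "('v \<times> 'a) list \<Rightarrow> ('v \<times> 'a) list \<Rightarrow> ('v \<times> 'a) list"
  where "act w r = foldr (\<lambda>(v, g). push v g) w r"

lemma act_simps [simp]: "act [] r = r" "act ((v, g) # w) r = push v g (act w r)"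
  "act (w @ w') r = act w (act w' r)"
  by (simp_all add: act_def)

lemma red_act: "\<lbrakk>w \<in> fp_words V G; red r\<rbrakk> \<Longrightarrow> red (act w r)"
  by (induction w) (auto simp: red_push)

lemma act_sim: "r \<doteq> r' \<Longrightarrow> act w r \<doteq> act w r'"
  by (induction w) (auto intro: push_sim)

lemma gp_rel_words: "(w, w') \<in> gp_rel V adj G \<Longrightarrow> w \<in> fp_words V G \<and> w' \<in> fp_words V G"
  by (induction rule: gp_rel.induct) auto

lemma gp_rel_act:
  "(w, w') \<in> gp_rel V adj G \<Longrightarrow> red r \<Longrightarrow> act w r \<doteq> act w' r"
proof (induction arbitrary: r rule: gp_rel.induct)
  case (sym u w)
  then show ?case by (blast intro: sim_sym)
next
  case (trans u w x)
  then show ?case by (meson rtranclp_trans)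
next
  case (cong u w p q)
  then show ?case by (auto intro!: act_sim simp: red_act)
qed (auto simp: push_one push_push push_comm)

lemma act_red: "red w \<Longrightarrow> act w [] \<doteq> w"
proof (induction w rule: red.induct)
  case (2 v g w)
  then have "act ((v, g) # w) [] \<doteq> push v g w" by (auto intro: push_sim)
  also have "push v g w \<doteq> (v, g) # w" using 2 by (auto intro: push_fresh)
  finally show ?case .
qed auto

text \<open>Van der Waerden's trick: related words act on reduced words in the same way up to
  shuffles, and a reduced word applied to the empty word rebuilds itself.\<close>

lemma red_unique:
  assumes "(w, w') \<in> gp_rel V adj G" "red w" "red w'"
  shows "w \<doteq> w'"
  using gp_rel_act[OF assms(1), of "[]"] act_red[OF assms(2)] act_red[OF assms(3)]
  by (metis red.simps(1) rtranclp_trans sim_sym)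

end

section \<open>Groups with a graph product structure\<close>

definition wev :: "('h, 'n) monoid_scheme \<Rightarrow> ('v \<Rightarrow> 'a \<Rightarrow> 'h) \<Rightarrow> ('v \<times> 'a) list \<Rightarrow> 'h"
  where "wev K f w = foldr (\<lambda>(v, g) y. f v g \<otimes>\<^bsub>K\<^esub> y) w \<one>\<^bsub>K\<^esub>"

lemma wev_simps [simp]: "wev K f [] = \<one>\<^bsub>K\<^esub>" "wev K f ((v, g) # w) = f v g \<otimes>\<^bsub>K\<^esub> wev K f w"
  by (simp_all add: wev_def)

lemma wev_closed:
  assumes "group K" "\<And>v g. \<lbrakk>v \<in> V; g \<in> carrier (G v)\<rbrakk> \<Longrightarrow> f v g \<in> carrier K" "w \<in> fp_words V G"
  shows "wev K f w \<in> carrier K"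
proof -
  interpret K: group K by fact
  show ?thesis using assms(3) by (induction w) (auto simp: assms(2))
qed

lemma wev_append:
  assumes "group K" "\<And>v g. \<lbrakk>v \<in> V; g \<in> carrier (G v)\<rbrakk> \<Longrightarrow> f v g \<in> carrier K"
    and "w \<in> fp_words V G" "w' \<in> fp_words V G"
  shows "wev K f (w @ w') = wev K f w \<otimes>\<^bsub>K\<^esub> wev K f w'"
proof -
  interpret K: group K by fact
  have c: "wev K f u \<in> carrier K" if "u \<in> fp_words V G" for u using wev_closed assms(1,2) that by metis
  show ?thesis using assms(3) by (induction w) (auto simp: K.m_assoc assms c)
qed

lemma wev_gp_rel:
  assumes "(w, w') \<in> gp_rel V adj G" "vertex_groups V adj G" "group K"
    and hom: "\<And>v. v \<in> V \<Longrightarrow> f v \<in> hom (G v) K"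
    and comm: "\<And>u v g h. \<lbrakk>u \<in> V; v \<in> V; adj u v; g \<in> carrier (G u); h \<in> carrier (G v)\<rbrakk>
      \<Longrightarrow> f u g \<otimes>\<^bsub>K\<^esub> f v h = f v h \<otimes>\<^bsub>K\<^esub> f u g"
  shows "wev K f w = wev K f w'"
proof -
  interpret vertex_groups V adj G by fact
  interpret K: group K by fact
  have c: "f v g \<in> carrier K" if "v \<in> V" "g \<in> carrier (G v)" for v g using hom_in_carrier[OF hom] that .
  note app = wev_append[OF assms(3), of V G f, OF c]
  show ?thesis using assms(1)
  proof (induction rule: gp_rel.induct)
    case (cong u w p q)
    then show ?case using gp_rel_words[OF cong(1)] by (simp add: app)
  next
    case (one v)
    then show ?case using hom_one[OF hom group_G assms(3), of v] by simp
  next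
    case (mult v g h)
    then show ?case using hom_mult[OF hom, of v g h] by (simp add: c)
  next
    case (comm u v g h)
    then show ?case using assms(5)[of u v g h] by (simp add: c)
  qed auto
qed

text \<open>
  A locale cannot quantify over the types of all target groups, so the universal property of the graph
  product is expressed by \<open>faithful\<close>: the defining relations account for all equalities of words.
\<close>

locale graph_group = vertex_groups V adj G + group H
  for V :: "'v set" and adj and G :: "'v \<Rightarrow> ('a, 'm) monoid_scheme" and H :: "('h, 'n) monoid_scheme" (structure) +
  fixes \<iota> :: "'v \<Rightarrow> 'a \<Rightarrow> 'h"
  assumes finite_V: "finite V"
    and comm_G: "v \<in> V \<Longrightarrow> comm_group (G v)"
    and finite_G: "v \<in> V \<Longrightarrow> finite (carrier (G v))"
    and nontrivial_G: "v \<in> V \<Longrightarrow> \<exists>g\<in>carrier (G v). g \<noteq> \<one>\<^bsub>G v\<^esub>"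
    and iota_hom: "v \<in> V \<Longrightarrow> \<iota> v \<in> hom (G v) H"
    and iota_comm: "\<lbrakk>u \<in> V; v \<in> V; adj u v; g \<in> carrier (G u); h \<in> carrier (G v)\<rbrakk>
      \<Longrightarrow> \<iota> u g \<otimes> \<iota> v h = \<iota> v h \<otimes> \<iota> u g"
    and generated: "x \<in> carrier H \<Longrightarrow> \<exists>w\<in>fp_words V G. wev H \<iota> w = x"
    and faithful: "\<lbrakk>w \<in> fp_words V G; w' \<in> fp_words V G; wev H \<iota> w = wev H \<iota> w'\<rbrakk>
      \<Longrightarrow> (w, w') \<in> gp_rel V adj G"
begin

lemma iota_closed [simp]: "\<lbrakk>v \<in> V; g \<in> carrier (G v)\<rbrakk> \<Longrightarrow> \<iota> v g \<in> carrier H"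
  using hom_in_carrier[OF iota_hom] .

lemma iota_mult: "\<lbrakk>v \<in> V; g \<in> carrier (G v); h \<in> carrier (G v)\<rbrakk>
    \<Longrightarrow> \<iota> v (g \<otimes>\<^bsub>G v\<^esub> h) = \<iota> v g \<otimes> \<iota> v h"
  using hom_mult[OF iota_hom] .

lemma iota_one [simp]: "v \<in> V \<Longrightarrow> \<iota> v \<one>\<^bsub>G v\<^esub> = \<one>"
  using hom_one[OF iota_hom group_G is_group] .

lemma iota_inv: "\<lbrakk>v \<in> V; g \<in> carrier (G v)\<rbrakk> \<Longrightarrow> \<iota> v (inv\<^bsub>G v\<^esub> g) = inv (\<iota> v g)"
  using iota_mult[of v "inv\<^bsub>G v\<^esub> g" g] by (simp add: inv_equality)

abbreviation ev :: "('v \<times> 'a) list \<Rightarrow> 'h" where "ev \<equiv> wev H \<iota>"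

lemma ev_closed [simp]: "w \<in> fp_words V G \<Longrightarrow> ev w \<in> carrier H"
  by (rule wev_closed[OF is_group, of V G]) simp_all

lemma ev_append: "\<lbrakk>w \<in> fp_words V G; w' \<in> fp_words V G\<rbrakk> \<Longrightarrow> ev (w @ w') = ev w \<otimes> ev w'"
  by (rule wev_append[OF is_group, of V G]) simp_all

definition lift :: "('k, 'o) monoid_scheme \<Rightarrow> ('v \<Rightarrow> 'a \<Rightarrow> 'k) \<Rightarrow> 'h \<Rightarrow> 'k"
  where "lift K f x = wev K f (SOME w. w \<in> fp_words V G \<and> ev w = x)"

text \<open>The choice of a word in \<open>lift\<close> is immaterial: by \<open>faithful\<close>,
  words with the same value are related, and the relations hold for \<open>f\<close> in
  \<open>K\<close>.\<close>

lemma lift_universal: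
  assumes K: "group K" and hom: "\<And>v. v \<in> V \<Longrightarrow> f v \<in> hom (G v) K"
    and comm: "\<And>u v g h. \<lbrakk>u \<in> V; v \<in> V; adj u v; g \<in> carrier (G u); h \<in> carrier (G v)\<rbrakk>
      \<Longrightarrow> f u g \<otimes>\<^bsub>K\<^esub> f v h = f v h \<otimes>\<^bsub>K\<^esub> f u g"
  shows lift_hom: "lift K f \<in> hom H K"
    and lift_iota: "\<And>v g. \<lbrakk>v \<in> V; g \<in> carrier (G v)\<rbrakk> \<Longrightarrow> lift K f (\<iota> v g) = f v g"
proof -
  interpret K: group K by fact
  have c: "f v g \<in> carrier K" if "v \<in> V" "g \<in> carrier (G v)" for v g using hom_in_carrier[OF hom] that .
  have l: "lift K f (ev w) = wev K f w" if w: "w \<in> fp_words V G" for w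
  proof -
    define w' where "w' = (SOME w'. w' \<in> fp_words V G \<and> ev w' = ev w)"
    have "w' \<in> fp_words V G \<and> ev w' = ev w" unfolding w'_def by (rule someI_ex) (use w in auto)
    then have "wev K f w' = wev K f w"
      using w by (intro wev_gp_rel[OF faithful vertex_groups_axioms K hom comm]) auto
    then show ?thesis by (simp add: lift_def w'_def)
  qed
  show "lift K f \<in> hom H K"
  proof (rule homI)
    fix x assume "x \<in> carrier H"
    then obtain w where "w \<in> fp_words V G" "x = ev w" using generated by blast
    then show "lift K f x \<in> carrier K" using wev_closed[OF K, of V G f, OF c] by (simp add: l)
  next
    fix x y assume "x \<in> carrier H" "y \<in> carrier H"
    then obtain w w' where w: "w \<in> fp_words V G" "x = ev w" "w' \<in> fp_words V G" "y = ev w'" using generated by blast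
    then have "lift K f (x \<otimes> y) = wev K f (w @ w')" using l[of "w @ w'"] by (simp add: ev_append)
    then show "lift K f (x \<otimes> y) = lift K f x \<otimes>\<^bsub>K\<^esub> lift K f y"
      using w wev_append[OF K, of V G f, OF c] by (simp add: l)
  qed
  show "lift K f (\<iota> v g) = f v g" if "v \<in> V" "g \<in> carrier (G v)" for v g
    using l[of "[(v, g)]"] that by (simp add: c)
qed

lemma gen_induct [consumes 1, case_names one mult]:
  assumes "x \<in> carrier H" "P \<one>"
    and "\<And>v g y. \<lbrakk>v \<in> V; g \<in> carrier (G v); y \<in> carrier H; P y\<rbrakk> \<Longrightarrow> P (\<iota> v g \<otimes> y)"
  shows "P x"
proof -
  have "P (ev w)" if "w \<in> fp_words V G" for w
    using that by (induction w) (auto intro: assms(2) assms(3)[OF _ _ ev_closed])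
  then show ?thesis using generated[OF assms(1)] by blast
qed

lemma hom_ext:
  assumes K: "group K" and f: "f \<in> hom H K" and f': "f' \<in> hom H K"
    and eq: "\<And>v g. \<lbrakk>v \<in> V; g \<in> carrier (G v)\<rbrakk> \<Longrightarrow> f (\<iota> v g) = f' (\<iota> v g)" and x: "x \<in> carrier H"
  shows "f x = f' x"
  using x
proof (induction rule: gen_induct)
  case one
  then show ?case using hom_one[OF f is_group K] hom_one[OF f' is_group K] by simp
next
  case (mult v g y)
  then show ?case using hom_mult[OF f, of "\<iota> v g" y] hom_mult[OF f', of "\<iota> v g" y] eq by simp
qed

text \<open>The projection that kills every vertex group but \<open>G v\<close>. As
  \<open>G v\<close> is abelian, it is constant on conjugacy classes, and so it serves to recognize
  conjugates of vertex group elements.\<close>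

definition ab :: "'v \<Rightarrow> 'h \<Rightarrow> 'a" where
  "ab v = lift (G v) (\<lambda>u g. if u = v then g else \<one>\<^bsub>G v\<^esub>)"

lemma ab_hom: "v \<in> V \<Longrightarrow> ab v \<in> hom H (G v)"
  and ab_iota: "\<lbrakk>v \<in> V; u \<in> V; g \<in> carrier (G u)\<rbrakk> \<Longrightarrow> ab v (\<iota> u g) = (if u = v then g else \<one>\<^bsub>G v\<^esub>)"
proof -
  assume v: "v \<in> V"
  have 1: "(\<lambda>g. if u = v then g else \<one>\<^bsub>G v\<^esub>) \<in> hom (G u) (G v)" if "u \<in> V" for u
    using v that by (auto simp: hom_def)
  have 2: "(if u = v then g else \<one>\<^bsub>G v\<^esub>) \<otimes>\<^bsub>G v\<^esub> (if u' = v then h else \<one>\<^bsub>G v\<^esub>)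
    = (if u' = v then h else \<one>\<^bsub>G v\<^esub>) \<otimes>\<^bsub>G v\<^esub> (if u = v then g else \<one>\<^bsub>G v\<^esub>)"
    if "adj u u'" "g \<in> carrier (G u)" "h \<in> carrier (G u')" for u u' g h
    using v that by (auto simp: adj_irrefl)
  show "ab v \<in> hom H (G v)" unfolding ab_def
    by (rule lift_hom[OF group_G[OF v]]) (rule 1 2; assumption)+
  show "ab v (\<iota> u g) = (if u = v then g else \<one>\<^bsub>G v\<^esub>)" if "u \<in> V" "g \<in> carrier (G u)"
    unfolding ab_def by (rule lift_iota[OF group_G[OF v] _ _ that]) (rule 1 2; assumption)+
qed

lemma ab_closed [simp]: "\<lbrakk>v \<in> V; x \<in> carrier H\<rbrakk> \<Longrightarrow> ab v x \<in> carrier (G v)"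
  using hom_in_carrier[OF ab_hom] .

lemma ab_mult: "\<lbrakk>v \<in> V; x \<in> carrier H; y \<in> carrier H\<rbrakk> \<Longrightarrow> ab v (x \<otimes> y) = ab v x \<otimes>\<^bsub>G v\<^esub> ab v y"
  using hom_mult[OF ab_hom] .

lemma ab_one [simp]: "v \<in> V \<Longrightarrow> ab v \<one> = \<one>\<^bsub>G v\<^esub>"
  using hom_one[OF ab_hom is_group group_G] .

lemma ab_inv: "\<lbrakk>v \<in> V; x \<in> carrier H\<rbrakk> \<Longrightarrow> ab v (inv x) = inv\<^bsub>G v\<^esub> ab v x"
  using group_hom.hom_inv[of H "G v" "ab v" x] ab_hom group_G
  by (simp add: group_hom_def group_hom_axioms_def)

lemma ab_conj:
  assumes "v \<in> V" "x \<in> carrier H" "k \<in> carrier H"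
  shows "ab v (k \<otimes> x \<otimes> inv k) = ab v x"
proof -
  interpret Gv: comm_group "G v" by (rule comm_G[OF assms(1)])
  have "ab v (k \<otimes> x \<otimes> inv k) = ab v x \<otimes>\<^bsub>G v\<^esub> ab v k \<otimes>\<^bsub>G v\<^esub> inv\<^bsub>G v\<^esub> ab v k"
    using assms by (simp add: ab_mult ab_inv Gv.m_comm)
  then show ?thesis using assms by (simp add: Gv.m_assoc)
qed

section \<open>Standard parabolic subgroups and left syllables\<close>

definition par :: "'v set \<Rightarrow> 'h set" where "par S = ev ` fp_words S G"

lemma fp_words_mono: "S \<subseteq> T \<Longrightarrow> fp_words S G \<subseteq> fp_words T G"
  unfolding fp_words_def by (rule lists_mono) auto

lemma par_closed: "\<lbrakk>S \<subseteq> V; x \<in> par S\<rbrakk> \<Longrightarrow> x \<in> carrier H"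
  using fp_words_mono[of S V] by (auto simp: par_def)

lemma par_mono: "S \<subseteq> T \<Longrightarrow> par S \<subseteq> par T"
  using fp_words_mono[of S T] by (auto simp: par_def)

lemma par_one [simp]: "\<one> \<in> par S"
  by (auto simp: par_def intro!: image_eqI[of _ _ "[]"])

lemma par_iota [simp]: "\<lbrakk>S \<subseteq> V; v \<in> S; g \<in> carrier (G v)\<rbrakk> \<Longrightarrow> \<iota> v g \<in> par S"
  by (auto simp: par_def subset_iff intro!: image_eqI[of _ _ "[(v, g)]"])

lemma par_mult: "\<lbrakk>S \<subseteq> V; x \<in> par S; y \<in> par S\<rbrakk> \<Longrightarrow> x \<otimes> y \<in> par S"
proof -
  assume "S \<subseteq> V" "x \<in> par S" "y \<in> par S"
  then obtain w w' where "w \<in> fp_words S G" "x = ev w" "w' \<in> fp_words S G" "y = ev w'" by (auto simp: par_def)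
  then show ?thesis using fp_words_mono[OF \<open>S \<subseteq> V\<close>]
    by (auto simp: par_def ev_append subset_iff intro!: image_eqI[of _ _ "w @ w'"])
qed

lemma par_induct [consumes 2, case_names one mult]:
  assumes "x \<in> par S" "S \<subseteq> V" "P \<one>"
    and "\<And>v g y. \<lbrakk>v \<in> S; v \<in> V; g \<in> carrier (G v); y \<in> par S; y \<in> carrier H; P y\<rbrakk> \<Longrightarrow> P (\<iota> v g \<otimes> y)"
  shows "P x"
proof -
  have "P (ev w) \<and> ev w \<in> par S" if "w \<in> fp_words S G" for w
    using that
    by (induction w) (use assms par_mult[of S] par_closed[of S] in \<open>auto simp: subset_iff\<close>)
  then show ?thesis using assms(1) by (auto simp: par_def)
qed

lemma par_inv:
  assumes "x \<in> par S" and S: "S \<subseteq> V"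
  shows "inv x \<in> par S"
  using assms
proof (induction rule: par_induct)
  case (mult v g y)
  then have "inv y \<otimes> \<iota> v (inv\<^bsub>G v\<^esub> g) \<in> par S" by (intro par_mult par_iota S) (use mult in auto)
  then show ?case using mult by (simp add: inv_mult_group iota_inv)
qed simp

lemma ev_push:
  "\<lbrakk>w \<in> fp_words V G; v \<in> V; g \<in> carrier (G v)\<rbrakk> \<Longrightarrow> ev (push v g w) = \<iota> v g \<otimes> ev w"
proof (induction v g w rule: push.induct)
  case (2 v g u h w)
  then have c: "u \<in> V" "h \<in> carrier (G u)" "w \<in> fp_words V G" by auto
  show ?case
  proof (cases "u = v")
    case True
    have "\<iota> v g \<otimes> (\<iota> v h \<otimes> ev w) = \<iota> v (g \<otimes>\<^bsub>G v\<^esub> h) \<otimes> ev w"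
      using 2 c True by (simp add: iota_mult m_assoc)
    then show ?thesis using 2 c True by auto
  next
    case False
    have "\<iota> v g \<otimes> (\<iota> u h \<otimes> ev w) = \<iota> u h \<otimes> (\<iota> v g \<otimes> ev w)" if "adj u v"
      using 2 c that iota_comm[of u v h g] by (simp flip: m_assoc)
    then show ?thesis using 2 c False by auto
  qed
qed auto

lemma ev_act: "w \<in> fp_words V G \<Longrightarrow> ev (act w []) = ev w"
  by (induction w) (auto simp: ev_push red_words red_act)

lemma ex_red: "x \<in> carrier H \<Longrightarrow> \<exists>w. red w \<and> ev w = x"
  using generated[of x] ev_act red_act[of _ "[]"] by fastforce

text \<open>\<open>\<delta> v x\<close> is the largest element of \<open>G\<^sub>v\<close> that can be split off from \<open>x\<close> on the left.\<close>

definition nf :: "'h \<Rightarrow> ('v \<times> 'a) list" where "nf x = (SOME w. red w \<and> ev w = x)"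
definition \<delta> :: "'v \<Rightarrow> 'h \<Rightarrow> 'a" where "\<delta> v x = hd_at v (nf x)"
definition len :: "'h \<Rightarrow> nat" where "len x = length (nf x)"

lemma nf: "x \<in> carrier H \<Longrightarrow> red (nf x) \<and> ev (nf x) = x"
  unfolding nf_def by (rule someI_ex) (rule ex_red)

lemma nf_sim: "red w \<Longrightarrow> nf (ev w) \<doteq> w"
  using nf[of "ev w"] red_words by (intro red_unique faithful) auto

lemma delta_red: "red w \<Longrightarrow> \<delta> v (ev w) = hd_at v w"
  using nf_sim by (auto simp: \<delta>_def dest: sim_hd_at)

lemma len_red: "red w \<Longrightarrow> len (ev w) = length w"
  using nf_sim by (auto simp: len_def dest: sim_length)

lemma delta_closed [simp]: "\<lbrakk>v \<in> V; x \<in> carrier H\<rbrakk> \<Longrightarrow> \<delta> v x \<in> carrier (G v)"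
  using nf[of x] by (simp add: \<delta>_def hd_at_closed)

lemma delta_one [simp]: "\<delta> v \<one> = \<one>\<^bsub>G v\<^esub>"
  using delta_red[of "[]" v] by simp

lemma delta_iota_mult:
  assumes "v \<in> V" "g \<in> carrier (G v)" "x \<in> carrier H"
  shows "\<delta> v (\<iota> v g \<otimes> x) = g \<otimes>\<^bsub>G v\<^esub> \<delta> v x"
  using delta_red[of "push v g (nf x)" v] nf[OF assms(3)] assms
  by (simp add: red_push red_words ev_push hd_at_push \<delta>_def)

lemma delta_adj_mult:
  assumes "adj u v" "u \<in> V" "v \<in> V" "g \<in> carrier (G v)" "x \<in> carrier H"
  shows "\<delta> u (\<iota> v g \<otimes> x) = \<delta> u x"
  using delta_red[of "push v g (nf x)" u] nf[OF assms(5)] assms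
  by (simp add: red_push red_words ev_push hd_at_push_adj \<delta>_def)

lemma delta_clash:
  "\<lbrakk>\<delta> u x \<noteq> \<one>\<^bsub>G u\<^esub>; u \<noteq> v; \<not> adj u v\<rbrakk> \<Longrightarrow> \<delta> v x = \<one>\<^bsub>G v\<^esub>"
  unfolding \<delta>_def by (rule hd_at_clash)

lemma len_one [simp]: "len \<one> = 0"
  using len_red[of "[]"] by simp

lemma len_iota_mult:
  assumes "v \<in> V" "g \<in> carrier (G v)" "g \<noteq> \<one>\<^bsub>G v\<^esub>" "x \<in> carrier H" "\<delta> v x = \<one>\<^bsub>G v\<^esub>"
  shows "len (\<iota> v g \<otimes> x) = Suc (len x)"
  using len_red[of "(v, g) # nf x"] nf[OF assms(4)] assms by (simp add: \<delta>_def len_def)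

lemma red_induct [consumes 1, case_names one mult]:
  assumes "x \<in> carrier H" "P \<one>"
    and "\<And>v a y. \<lbrakk>v \<in> V; a \<in> carrier (G v); a \<noteq> \<one>\<^bsub>G v\<^esub>; y \<in> carrier H; \<delta> v y = \<one>\<^bsub>G v\<^esub>; P y\<rbrakk>
      \<Longrightarrow> P (\<iota> v a \<otimes> y)"
  shows "P x"
proof -
  have "P (ev w)" if "red w" for w
    using that by (induction w rule: red.induct) (auto simp: delta_red red_words intro!: assms)
  then show ?thesis using ex_red[OF assms(1)] by blast
qed

lemma delta_trivial: "\<lbrakk>x \<in> carrier H; \<And>v. v \<in> V \<Longrightarrow> \<delta> v x = \<one>\<^bsub>G v\<^esub>\<rbrakk> \<Longrightarrow> x = \<one>"
proof (induction rule: red_induct)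
  case (mult v a y)
  then show ?case using mult.prems[of v] by (simp add: delta_iota_mult)
qed simp

text \<open>\<open>act\<close> never brings in a new vertex, so some reduced word of
  \<open>x\<close> uses vertices of \<open>S\<close> only.\<close>

lemma delta_par:
  assumes "x \<in> par S" "S \<subseteq> V" "u \<notin> S"
  shows "\<delta> u x = \<one>\<^bsub>G u\<^esub>"
proof -
  obtain w where w: "w \<in> fp_words S G" "x = ev w" using assms by (auto simp: par_def)
  have wV: "w \<in> fp_words V G" using w fp_words_mono[OF assms(2)] by auto
  have "fst ` set (act w []) \<subseteq> S" using w(1)
  proof (induction w)
    case (Cons a w)
    then show ?case using fst_set_push[of "fst a" "snd a" "act w []"] by (cases a) fastforce
  qed simp
  moreover have "hd_at u r = \<one>\<^bsub>G u\<^esub>" if "u \<notin> fst ` set r" for r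
    using that by (induction u r rule: hd_at.induct) auto
  ultimately have "hd_at u (act w []) = \<one>\<^bsub>G u\<^esub>" using assms(3) by blast
  then show ?thesis using delta_red[OF red_act[OF wV], of "[]" u] w ev_act[OF wV] by simp
qed

section \<open>Links, stars and the crossing of walls\<close>

definition nb :: "'v \<Rightarrow> 'v set" where "nb u = {v \<in> V. adj u v}"
definition st :: "'v \<Rightarrow> 'v set" where "st u = insert u (nb u)"

lemma nb_subset [simp]: "nb u \<subseteq> V" and st_subset [simp]: "u \<in> V \<Longrightarrow> st u \<subseteq> V"
  by (auto simp: nb_def st_def)

lemma nb_irrefl [simp]: "u \<notin> nb u" by (simp add: nb_def adj_irrefl)

lemma par_nb_comm:
  assumes "y \<in> par (nb u)" and u: "u \<in> V" "a \<in> carrier (G u)"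
  shows "\<iota> u a \<otimes> y = y \<otimes> \<iota> u a"
  using assms(1) nb_subset
proof (induction rule: par_induct)
  case (mult v g y)
  have "\<iota> u a \<otimes> (\<iota> v g \<otimes> y) = \<iota> v g \<otimes> \<iota> u a \<otimes> y"
    using mult(1-5) u iota_comm[of u v a g] by (simp add: nb_def flip: m_assoc)
  then show ?case using mult u by (simp add: m_assoc)
qed (use u in simp)

lemma delta_par_nb_mult:
  assumes "y \<in> par (nb u)" "u \<in> V" "z \<in> carrier H"
  shows "\<delta> u (y \<otimes> z) = \<delta> u z"
  using assms(1) nb_subset
  by (induction rule: par_induct) (auto simp: m_assoc delta_adj_mult nb_def assms)

lemma par_st_decomp:
  assumes "x \<in> par (st u)" "u \<in> V"
  shows "\<exists>a\<in>carrier (G u). \<exists>y\<in>par (nb u). x = \<iota> u a \<otimes> y"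
  using assms(1) st_subset[OF assms(2)]
proof (induction rule: par_induct)
  case one
  then show ?case using assms(2) by (auto intro!: bexI[of _ "\<one>\<^bsub>G u\<^esub>"] bexI[of _ "\<one>"])
next
  case (mult v g y)
  then obtain a z where z: "a \<in> carrier (G u)" "z \<in> par (nb u)" "y = \<iota> u a \<otimes> z" by blast
  have zc: "z \<in> carrier H" using par_closed[OF nb_subset z(2)] .
  show ?case
  proof (cases "v = u")
    case True
    then have "\<iota> v g \<otimes> y = \<iota> u (g \<otimes>\<^bsub>G u\<^esub> a) \<otimes> z" using mult z zc by (simp add: iota_mult m_assoc)
    then show ?thesis using mult z True by auto
  next
    case False
    then have v: "v \<in> nb u" using mult by (simp add: st_def)
    then have "\<iota> v g \<otimes> y = \<iota> u a \<otimes> (\<iota> v g \<otimes> z)"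
      using mult z zc assms(2) iota_comm[of u v a g] by (simp add: nb_def flip: m_assoc)
    moreover have "\<iota> v g \<otimes> z \<in> par (nb u)" using v mult z by (simp add: par_mult)
    ultimately show ?thesis using z by blast
  qed
qed

lemma par_nb_of_st:
  assumes "x \<in> par (st u)" "u \<in> V" "\<delta> u x = \<one>\<^bsub>G u\<^esub>"
  shows "x \<in> par (nb u)"
proof -
  obtain a y where y: "a \<in> carrier (G u)" "y \<in> par (nb u)" "x = \<iota> u a \<otimes> y"
    using par_st_decomp[OF assms(1,2)] by blast
  have yc: "y \<in> carrier H" using par_closed[OF nb_subset y(2)] .
  have "a = \<one>\<^bsub>G u\<^esub>"
    using assms y yc delta_par[OF y(2) nb_subset nb_irrefl] by (simp add: delta_iota_mult)
  then show ?thesis using y yc assms by simp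
qed

text \<open>The left syllable at \<open>u\<close> labels the wings of the wall
  \<open>par (st u)\<close>, and the step from \<open>x\<close> to
  \<open>x \<otimes> \<iota> w b\<close> crosses this wall only if it starts on it. The induction
  strips the first syllable \<open>\<iota> v a\<close>, which is harmless if \<open>v\<close> equals
  \<open>u\<close> or is adjacent to it.\<close>

lemma delta_right:
  assumes x: "x \<in> carrier H" and w: "w \<in> V" "b \<in> carrier (G w)" and u: "u \<in> V"
    and "\<delta> u (x \<otimes> \<iota> w b) \<noteq> \<delta> u x"
  shows "w = u \<and> x \<in> par (st u)"
  using x u assms(5)
proof (induction arbitrary: u rule: red_induct)
  case one
  have "\<delta> u (\<iota> w b) = \<one>\<^bsub>G u\<^esub>" if "w \<noteq> u"
    using delta_par[of "\<iota> w b" "{w}" u] that w by simp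
  then show ?case using one w by auto
next
  case (mult v a y)
  consider "v = u" | "adj u v" | "v \<noteq> u" "\<not> adj v u" using adj_sym by blast
  then show ?case
  proof cases
    case 1
    then have "\<delta> u (y \<otimes> \<iota> w b) \<noteq> \<delta> u y" using mult w by (auto simp: m_assoc delta_iota_mult)
    then have "w = u \<and> y \<in> par (st u)" using mult by blast
    then show ?thesis using 1 mult par_mult[of "st u" "\<iota> u a" y] by (auto simp: st_def)
  next
    case 2
    then have "\<delta> u (y \<otimes> \<iota> w b) \<noteq> \<delta> u y" using mult w by (auto simp: m_assoc delta_adj_mult)
    then have "w = u \<and> y \<in> par (st u)" using mult by blast
    moreover have "v \<in> st u" using 2 mult by (simp add: st_def nb_def)
    ultimately show ?thesis using mult par_mult[of "st u" "\<iota> v a" y] by auto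
  next
    case 3
    \<comment> \<open>Front syllables at \<open>u\<close> and \<open>v\<close> exclude each other,
      so a new one at \<open>u\<close> has to destroy the one at \<open>v\<close>. Then
      \<open>y\<close> lies in \<open>par (nb v)\<close> and the product collapses to
      \<open>y\<close>, which has no front syllable at \<open>u\<close>.\<close>
    have "\<delta> v (\<iota> v a \<otimes> y) \<noteq> \<one>\<^bsub>G v\<^esub>" using mult by (simp add: delta_iota_mult)
    then have 4: "\<delta> u (\<iota> v a \<otimes> y) = \<one>\<^bsub>G u\<^esub>" using 3 delta_clash by blast
    then have "\<delta> u (\<iota> v a \<otimes> y \<otimes> \<iota> w b) \<noteq> \<one>\<^bsub>G u\<^esub>" using mult by simp
    then have 5: "\<delta> v (\<iota> v a \<otimes> (y \<otimes> \<iota> w b)) = \<one>\<^bsub>G v\<^esub>" using 3 delta_clash mult w by (metis adj_sym iota_closed m_assoc)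
    then have 6: "a \<otimes>\<^bsub>G v\<^esub> \<delta> v (y \<otimes> \<iota> w b) = \<one>\<^bsub>G v\<^esub>" using mult w by (simp add: delta_iota_mult)
    then have "\<delta> v (y \<otimes> \<iota> w b) \<noteq> \<delta> v y" using mult by auto
    then have v: "w = v" "y \<in> par (st v)" using mult.IH[of v] mult by auto
    then have ynb: "y \<in> par (nb v)" using par_nb_of_st mult by blast
    have "\<delta> v (y \<otimes> \<iota> w b) = b"
      using v mult w ynb delta_par_nb_mult[of y v "\<iota> v b"] delta_iota_mult[of v b "\<one>"] by simp
    then have "a \<otimes>\<^bsub>G v\<^esub> b = \<one>\<^bsub>G v\<^esub>" using 6 by simp
    then have "\<iota> v a \<otimes> \<iota> v b = \<one>" using iota_mult[of v a b] mult w v by simp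
    then have "\<iota> v a \<otimes> y \<otimes> \<iota> w b = y"
      using v par_nb_comm[OF ynb, of b] par_nb_comm[OF ynb, of a] mult w by (simp add: m_assoc)
    moreover have "u \<notin> nb v" using 3 by (simp add: nb_def)
    ultimately show ?thesis using delta_par[OF ynb nb_subset, of u] 4 mult.prems by simp
  qed
qed

lemma delta_mult_par:
  assumes "y \<in> par S" "S \<subseteq> V" "u \<in> V" "u \<notin> S" "x \<in> carrier H"
  shows "\<delta> u (x \<otimes> y) = \<delta> u x"
  using assms
proof (induction arbitrary: x rule: par_induct)
  case (mult v g y)
  have "\<delta> u (x \<otimes> (\<iota> v g \<otimes> y)) = \<delta> u (x \<otimes> \<iota> v g)" using mult by (simp flip: m_assoc)
  then show ?case using delta_right[of x v g u] mult by auto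
qed simp

text \<open>Commuting turns right multiplication by \<open>\<iota> u a\<close> into left
  multiplication, which changes \<open>\<delta> u\<close> by the factor \<open>a\<close>; now
  \<open>delta_right\<close> applies.\<close>

lemma centralizer:
  assumes "x \<in> carrier H" "u \<in> V" "a \<in> carrier (G u)" "a \<noteq> \<one>\<^bsub>G u\<^esub>" "x \<otimes> \<iota> u a = \<iota> u a \<otimes> x"
  shows "x \<in> par (st u)"
proof -
  interpret Gu: group "G u" by (rule group_G) fact
  have "\<delta> u (x \<otimes> \<iota> u a) \<noteq> \<delta> u x" using assms by (simp add: delta_iota_mult)
  then show ?thesis using delta_right assms by blast
qed

section \<open>Retractions onto parabolic subgroups\<close>

definition retr :: "'v set \<Rightarrow> 'h \<Rightarrow> 'h" where
  "retr S = lift H (\<lambda>u g. if u \<in> S then \<iota> u g else \<one>)"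

lemma retr_hom: "retr S \<in> hom H H"
  and retr_iota: "\<lbrakk>u \<in> V; g \<in> carrier (G u)\<rbrakk> \<Longrightarrow> retr S (\<iota> u g) = (if u \<in> S then \<iota> u g else \<one>)"
proof -
  have 1: "(\<lambda>g. if u \<in> S then \<iota> u g else \<one>) \<in> hom (G u) H" if "u \<in> V" for u
    using that iota_hom[OF that] by (auto simp: hom_def)
  have 2: "(if u \<in> S then \<iota> u g else \<one>) \<otimes> (if v \<in> S then \<iota> v h else \<one>)
    = (if v \<in> S then \<iota> v h else \<one>) \<otimes> (if u \<in> S then \<iota> u g else \<one>)"
    if "u \<in> V" "v \<in> V" "adj u v" "g \<in> carrier (G u)" "h \<in> carrier (G v)" for u v g h
    using that iota_comm by auto
  show "retr S \<in> hom H H" unfolding retr_def by (rule lift_hom[OF is_group 1 2])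
  show "retr S (\<iota> u g) = (if u \<in> S then \<iota> u g else \<one>)" if "u \<in> V" "g \<in> carrier (G u)"
    unfolding retr_def by (rule lift_iota[OF is_group 1 2 that])
qed

lemma retr_closed [simp]: "x \<in> carrier H \<Longrightarrow> retr S x \<in> carrier H"
  using hom_in_carrier[OF retr_hom] .

lemma retr_mult: "\<lbrakk>x \<in> carrier H; y \<in> carrier H\<rbrakk> \<Longrightarrow> retr S (x \<otimes> y) = retr S x \<otimes> retr S y"
  using hom_mult[OF retr_hom] .

lemma retr_one [simp]: "retr S \<one> = \<one>"
  using hom_one[OF retr_hom is_group is_group] .

lemma retr_inv: "x \<in> carrier H \<Longrightarrow> retr S (inv x) = inv (retr S x)"
  using group_hom.hom_inv[of H H "retr S" x] retr_hom by (simp add: group_hom_def group_hom_axioms_def)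

lemma retr_par: "\<lbrakk>x \<in> par S; S \<subseteq> V\<rbrakk> \<Longrightarrow> retr S x = x"
  by (induction rule: par_induct) (auto simp: retr_mult retr_iota)

lemma retr_in_par: "\<lbrakk>x \<in> carrier H; S \<subseteq> V\<rbrakk> \<Longrightarrow> retr S x \<in> par S"
  by (induction rule: gen_induct) (auto simp: retr_mult retr_iota par_closed intro: par_mult)

end

section \<open>Conjugating endomorphisms\<close>

context graph_group
begin

lemma cancel_simps [simp]:
  "\<lbrakk>x \<in> carrier H; y \<in> carrier H\<rbrakk> \<Longrightarrow> inv x \<otimes> (x \<otimes> y) = y"
  "\<lbrakk>x \<in> carrier H; y \<in> carrier H\<rbrakk> \<Longrightarrow> x \<otimes> (inv x \<otimes> y) = y"
  by (simp_all flip: m_assoc)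

lemma ab_par: "\<lbrakk>x \<in> par S; S \<subseteq> V; v \<in> V; v \<notin> S\<rbrakk> \<Longrightarrow> ab v x = \<one>\<^bsub>G v\<^esub>"
  by (induction rule: par_induct) (auto simp: ab_mult ab_iota)

text \<open>The star subgroup is the product of \<open>G v\<close> and \<open>par (nb v)\<close>,
  and both maps read off the first factor.\<close>

lemma ab_st:
  assumes "x \<in> par (st v)" "v \<in> V"
  shows "ab v x = \<delta> v x"
proof -
  obtain a y where y: "a \<in> carrier (G v)" "y \<in> par (nb v)" "x = \<iota> v a \<otimes> y"
    using par_st_decomp[OF assms] by blast
  have yc: "y \<in> carrier H" using par_closed[OF nb_subset y(2)] .
  show ?thesis using y yc assms(2) ab_par[OF y(2)] delta_par[OF y(2)]
    by (simp add: ab_mult ab_iota delta_iota_mult)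
qed

lemma par_st_comm:
  assumes "t \<in> par (st u)" "u \<in> V" "a \<in> carrier (G u)"
  shows "t \<otimes> \<iota> u a = \<iota> u a \<otimes> t"
proof -
  interpret Gu: comm_group "G u" by (rule comm_G) fact
  obtain b y where y: "b \<in> carrier (G u)" "y \<in> par (nb u)" "t = \<iota> u b \<otimes> y"
    using par_st_decomp[OF assms(1,2)] by blast
  have yc: "y \<in> carrier H" using par_closed[OF nb_subset y(2)] .
  have "t \<otimes> \<iota> u a = \<iota> u (b \<otimes>\<^bsub>G u\<^esub> a) \<otimes> y"
    using y yc assms par_nb_comm[OF y(2) assms(2,3)] by (simp add: iota_mult m_assoc)
  also have "b \<otimes>\<^bsub>G u\<^esub> a = a \<otimes>\<^bsub>G u\<^esub> b" using y assms by (simp add: Gu.m_comm)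
  finally show ?thesis using y yc assms by (simp add: iota_mult m_assoc)
qed

lemma iota_eq_one: "\<lbrakk>v \<in> V; a \<in> carrier (G v); \<iota> v a = \<one>\<rbrakk> \<Longrightarrow> a = \<one>\<^bsub>G v\<^esub>"
  using ab_iota[of v v a] by simp

lemma inner_hom: "y \<in> carrier H \<Longrightarrow> (\<lambda>x. y \<otimes> x \<otimes> inv y) \<in> hom H H"
  by (auto intro!: homI simp: m_assoc)

text \<open>Gallery distance, counted in letters, from the chamber \<open>x\<close> to the set
  \<open>T\<close>.\<close>

definition dist :: "'h set \<Rightarrow> 'h \<Rightarrow> nat"
  where "dist T x = (LEAST n. \<exists>w\<in>fp_words V G. length w = n \<and> x \<otimes> ev w \<in> T)"

lemma dist_attained:
  assumes "x \<in> carrier H" "t \<in> T" "T \<subseteq> carrier H"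
  shows "\<exists>w\<in>fp_words V G. length w = dist T x \<and> x \<otimes> ev w \<in> T"
proof -
  obtain w where "w \<in> fp_words V G" "ev w = inv x \<otimes> t" using generated[of "inv x \<otimes> t"] assms by auto
  then have "x \<otimes> ev w \<in> T" using assms by auto
  then show ?thesis unfolding dist_def
    using LeastI[of "\<lambda>n. \<exists>w\<in>fp_words V G. length w = n \<and> x \<otimes> ev w \<in> T" "length w"] \<open>w \<in> _\<close> by blast
qed

lemma dist_le: "\<lbrakk>w \<in> fp_words V G; x \<otimes> ev w \<in> T\<rbrakk> \<Longrightarrow> dist T x \<le> length w"
  unfolding dist_def by (rule Least_le) auto

end

text \<open>\<open>h\<close> is not determined by \<open>\<phi>\<close>: \<open>h v\<close> may be
  multiplied on the right by any element of \<open>par (st v)\<close>, which leaves the wall in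
  place. Only an endomorphism is required, so that the locale also covers an automorphism followed
  by a retraction.\<close>

locale conj_endo = graph_group V adj G H \<iota>
  for V :: "'v set" and adj and G :: "'v \<Rightarrow> ('a, 'm) monoid_scheme" and H :: "('h, 'n) monoid_scheme" (structure)
    and \<iota> :: "'v \<Rightarrow> 'a \<Rightarrow> 'h" +
  fixes \<phi> :: "'h \<Rightarrow> 'h" and h :: "'v \<Rightarrow> 'h"
  assumes phi_hom: "\<phi> \<in> hom H H"
    and h_closed [simp]: "v \<in> V \<Longrightarrow> h v \<in> carrier H"
    and phi_iota: "\<lbrakk>v \<in> V; a \<in> carrier (G v)\<rbrakk> \<Longrightarrow> \<phi> (\<iota> v a) = h v \<otimes> \<iota> v a \<otimes> inv (h v)"
begin

lemma phi_closed [simp]: "x \<in> carrier H \<Longrightarrow> \<phi> x \<in> carrier H"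
  using hom_in_carrier[OF phi_hom] .

lemma phi_mult: "\<lbrakk>x \<in> carrier H; y \<in> carrier H\<rbrakk> \<Longrightarrow> \<phi> (x \<otimes> y) = \<phi> x \<otimes> \<phi> y"
  using hom_mult[OF phi_hom] .

lemma phi_one [simp]: "\<phi> \<one> = \<one>"
  using hom_one[OF phi_hom is_group is_group] .

text \<open>The wing of the wall \<open>h\<^sub>u G\<^bsub>st u\<^esub>\<close> in which the chamber \<open>x\<close> lies.\<close>

definition \<kappa> :: "'v \<Rightarrow> 'h \<Rightarrow> 'a" where "\<kappa> u x = \<delta> u (inv (h u) \<otimes> x)"

lemma kappa_closed [simp]: "\<lbrakk>u \<in> V; x \<in> carrier H\<rbrakk> \<Longrightarrow> \<kappa> u x \<in> carrier (G u)"
  by (simp add: \<kappa>_def)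

text \<open>The element commutes with \<open>G v\<close>, hence lies in the star subgroup; its
  component in \<open>G v\<close> is seen by \<open>ab v\<close>, which conjugation does not
  change.\<close>

lemma phi_adj:
  assumes "u \<in> V" "v \<in> V" "adj u v" "a \<in> carrier (G u)"
  shows "inv (h v) \<otimes> \<phi> (\<iota> u a) \<otimes> h v \<in> par (nb v)"
proof -
  obtain b where b: "b \<in> carrier (G v)" "b \<noteq> \<one>\<^bsub>G v\<^esub>" using nontrivial_G assms by blast
  let ?c = "inv (h v) \<otimes> \<phi> (\<iota> u a) \<otimes> h v"
  have com: "\<phi> (\<iota> u a) \<otimes> \<phi> (\<iota> v b) = \<phi> (\<iota> v b) \<otimes> \<phi> (\<iota> u a)"
    using iota_comm[of u v a b] assms b by (simp flip: phi_mult)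
  have i: "\<iota> v b = inv (h v) \<otimes> \<phi> (\<iota> v b) \<otimes> h v" using assms b by (simp add: phi_iota m_assoc)
  have "?c \<otimes> \<iota> v b = inv (h v) \<otimes> (\<phi> (\<iota> u a) \<otimes> \<phi> (\<iota> v b)) \<otimes> h v"
    by (subst i) (use assms b in \<open>simp add: m_assoc\<close>)
  also have "\<dots> = \<iota> v b \<otimes> ?c"
    unfolding com by (subst (2) i) (use assms b in \<open>simp add: m_assoc\<close>)
  finally have st: "?c \<in> par (st v)" using assms b by (intro centralizer[of _ v b]) auto
  have "ab v ?c = ab v (\<phi> (\<iota> u a))"
    using ab_conj[of v "\<phi> (\<iota> u a)" "inv (h v)"] assms by simp
  also have "\<dots> = \<one>\<^bsub>G v\<^esub>"
    using assms ab_conj[of v "\<iota> u a" "h u"] by (simp add: phi_iota ab_iota) (use adj_irrefl in auto)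
  finally show ?thesis using st assms ab_st par_nb_of_st by metis
qed

lemma kappa_phi_same:
  "\<lbrakk>u \<in> V; a \<in> carrier (G u); x \<in> carrier H\<rbrakk> \<Longrightarrow> \<kappa> u (\<phi> (\<iota> u a) \<otimes> x) = a \<otimes>\<^bsub>G u\<^esub> \<kappa> u x"
  by (simp add: \<kappa>_def phi_iota m_assoc delta_iota_mult)

lemma kappa_phi_adj:
  assumes "u \<in> V" "v \<in> V" "adj u v" "a \<in> carrier (G u)" "x \<in> carrier H"
  shows "\<kappa> v (\<phi> (\<iota> u a) \<otimes> x) = \<kappa> v x"
proof -
  have "inv (h v) \<otimes> (\<phi> (\<iota> u a) \<otimes> x) = (inv (h v) \<otimes> \<phi> (\<iota> u a) \<otimes> h v) \<otimes> (inv (h v) \<otimes> x)"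
    using assms by (simp add: m_assoc)
  then show ?thesis using delta_par_nb_mult[OF phi_adj] assms by (simp add: \<kappa>_def)
qed

lemma kappa_right:
  assumes "u \<in> V" "w \<in> V" "b \<in> carrier (G w)" "x \<in> carrier H" "\<kappa> u (x \<otimes> \<iota> w b) \<noteq> \<kappa> u x"
  shows "w = u \<and> inv (h u) \<otimes> x \<in> par (st u)"
  using delta_right[of "inv (h u) \<otimes> x" w b u] assms by (simp add: \<kappa>_def m_assoc)

text \<open>A path along the wall of \<open>v\<close> uses letters of \<open>st v\<close> only, and
  \<open>u\<close> is not among them.\<close>

lemma kappa_mult_par:
  assumes "t \<in> par (st v)" "u \<in> V" "v \<in> V" "u \<noteq> v" "\<not> adj u v" "x \<in> carrier H"
  shows "\<kappa> u (x \<otimes> t) = \<kappa> u x"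
proof -
  have "u \<notin> st v" using assms adj_sym by (auto simp: st_def nb_def)
  then show ?thesis using delta_mult_par[of t "st v" u "inv (h u) \<otimes> x"] assms par_closed[of "st v" t]
    by (simp add: \<kappa>_def m_assoc)
qed

text \<open>For a chamber on the wall, the result of moving it into the wing \<open>\<one>\<close>
  does not depend on \<open>c\<close>: chambers that face each other across the wall are moved to
  the same one. This is how \<open>shorten\<close> saves a letter.\<close>

lemma kappa_wall:
  assumes "u \<in> V" "c \<in> carrier (G u)" "y \<in> par (nb u)" "x \<in> carrier H" "inv (h u) \<otimes> x = \<iota> u c \<otimes> y"
  shows "\<kappa> u x = c" "\<phi> (\<iota> u (inv\<^bsub>G u\<^esub> \<kappa> u x)) \<otimes> x = h u \<otimes> y"
proof -
  have yc: "y \<in> carrier H" using par_closed[OF nb_subset assms(3)] .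
  show k: "\<kappa> u x = c" using assms yc delta_par[OF assms(3)] by (simp add: \<kappa>_def delta_iota_mult)
  have "h u \<otimes> (inv (h u) \<otimes> x) = x" using assms(1,4) by simp
  then have "x = h u \<otimes> (\<iota> u c \<otimes> y)" using assms(5) by simp
  then show "\<phi> (\<iota> u (inv\<^bsub>G u\<^esub> \<kappa> u x)) \<otimes> x = h u \<otimes> y"
    using assms yc unfolding k by (simp add: phi_iota m_assoc) (simp add: iota_inv)
qed

text \<open>
  A gallery from \<open>x\<close> to a target in the wing \<open>\<one>\<close> crosses the wall of \<open>u\<close>. Moving its initial segment by
  the element of \<open>\<phi> G\<^sub>u\<close> that takes \<open>x\<close> to the wing \<open>\<one>\<close> makes the last crossing redundant.
\<close>

lemma shorten:
  assumes u: "u \<in> V" and T: "\<And>t. t \<in> T \<Longrightarrow> \<kappa> u t = \<one>\<^bsub>G u\<^esub>"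
    and "w \<in> fp_words V G" "x \<in> carrier H" "x \<otimes> ev w \<in> T" "\<kappa> u x \<noteq> \<one>\<^bsub>G u\<^esub>"
  shows "\<exists>w'\<in>fp_words V G. length w' < length w \<and> \<phi> (\<iota> u (inv\<^bsub>G u\<^esub> \<kappa> u x)) \<otimes> x \<otimes> ev w' \<in> T"
  using assms(3-)
proof (induction w arbitrary: x)
  case Nil
  then show ?case using T by simp
next
  case (Cons p w)
  obtain v s where p: "p = (v, s)" by (cases p)
  have v: "v \<in> V" "s \<in> carrier (G v)" "w \<in> fp_words V G" using Cons.prems p by auto
  define x1 where "x1 = x \<otimes> \<iota> v s"
  have x1: "x1 \<in> carrier H" "x1 \<otimes> ev w \<in> T" using Cons.prems v p by (auto simp: x1_def m_assoc)
  let ?f = "\<lambda>x. \<phi> (\<iota> u (inv\<^bsub>G u\<^esub> \<kappa> u x)) \<otimes> x"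
  show ?case
  proof (cases "\<kappa> u x1 = \<kappa> u x")
    case True
    then obtain w' where w': "w' \<in> fp_words V G" "length w' < length w" "?f x1 \<otimes> ev w' \<in> T"
      using Cons.IH[of x1] x1 v Cons.prems by auto
    have "?f x1 \<otimes> ev w' = ?f x \<otimes> ev (p # w')"
      using True Cons.prems v w' u p by (simp add: m_assoc x1_def)
    then show ?thesis using w' v p by (intro bexI[of _ "p # w'"]) auto
  next
    case False
    then have vu: "v = u" "inv (h u) \<otimes> x \<in> par (st u)"
      using kappa_right[of u v s x] Cons.prems u v by (auto simp: x1_def)
    obtain c y where y: "c \<in> carrier (G u)" "y \<in> par (nb u)" "inv (h u) \<otimes> x = \<iota> u c \<otimes> y"
      using par_st_decomp[OF vu(2) u] by blast
    have yc: "y \<in> carrier H" using par_closed[OF nb_subset y(2)] .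
    have "inv (h u) \<otimes> x1 = (inv (h u) \<otimes> x) \<otimes> \<iota> u s" using Cons.prems u v vu by (simp add: x1_def m_assoc)
    also have "\<dots> = \<iota> u (c \<otimes>\<^bsub>G u\<^esub> s) \<otimes> y"
      using y yc u v vu par_nb_comm[OF y(2) u, of s] by (simp add: iota_mult m_assoc)
    finally have x1y: "inv (h u) \<otimes> x1 = \<iota> u (c \<otimes>\<^bsub>G u\<^esub> s) \<otimes> y" .
    have eq: "?f x1 = h u \<otimes> y" "?f x = h u \<otimes> y"
      using kappa_wall[OF u _ y(2) x1(1) x1y] kappa_wall[OF u y(1,2) Cons.prems(2) y(3)] y u v vu by auto
    show ?thesis
    proof (cases "\<kappa> u x1 = \<one>\<^bsub>G u\<^esub>")
      case True
      then have "?f x1 = x1" using x1 u by simp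
      then show ?thesis using eq x1 v by (intro bexI[of _ w]) auto
    next
      case False
      then obtain w' where "w' \<in> fp_words V G" "length w' < length w" "?f x1 \<otimes> ev w' \<in> T"
        using Cons.IH[of x1] x1 v by auto
      then show ?thesis using eq by (intro bexI[of _ w']) auto
    qed
  qed
qed

text \<open>A chamber with the least total distance to the sets \<open>T v\<close> lies in all the
  wings \<open>\<one>\<close>. Otherwise, moving it into the wing \<open>\<one>\<close> of some
  \<open>u\<close> brings it nearer to \<open>T u\<close> and to \<open>T v\<close> for every
  \<open>v\<close> not adjacent to \<open>u\<close>, and no farther from the rest.\<close>

lemma ex_base:
  assumes norm: "\<And>u v. \<lbrakk>u \<in> V; v \<in> V; u \<noteq> v; \<not> adj u v\<rbrakk> \<Longrightarrow> \<kappa> u (h v) = \<one>\<^bsub>G u\<^esub>"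
  shows "\<exists>y\<in>carrier H. \<forall>u\<in>V. \<kappa> u y = \<one>\<^bsub>G u\<^esub>"
proof -
  \<comment> \<open>The chambers on the wall of \<open>v\<close> that lie in its wing
    \<open>\<one>\<close>.\<close>
  define T where "T v = (\<lambda>y. h v \<otimes> y) ` par (nb v)" for v
  have Tc: "T v \<subseteq> carrier H" if "v \<in> V" for v using that par_closed[OF nb_subset] by (auto simp: T_def)
  have hT: "h v \<in> T v" if "v \<in> V" for v using that by (auto simp: T_def intro!: image_eqI[of _ _ "\<one>"])
  define F where "F x = (\<Sum>v\<in>V. dist (T v) x)" for x
  obtain x where x: "x \<in> carrier H" "\<And>y. y \<in> carrier H \<Longrightarrow> F x \<le> F y"
    using ex_has_least_nat[of "\<lambda>x. x \<in> carrier H" \<one> F] by auto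
  have "\<kappa> u x = \<one>\<^bsub>G u\<^esub>" if u: "u \<in> V" for u
  proof (rule ccontr)
    assume k: "\<kappa> u x \<noteq> \<one>\<^bsub>G u\<^esub>"
    define x' where "x' = \<phi> (\<iota> u (inv\<^bsub>G u\<^esub> \<kappa> u x)) \<otimes> x"
    have x': "x' \<in> carrier H" using x u by (simp add: x'_def)
    have less: "dist (T v) x' < dist (T v) x" if v: "v \<in> V" "v = u \<or> \<not> adj u v" for v
    proof -
      have "\<kappa> u t = \<one>\<^bsub>G u\<^esub>" if "t \<in> T v" for t
      proof -
        obtain y where y: "y \<in> par (nb v)" "t = h v \<otimes> y" using \<open>t \<in> T v\<close> by (auto simp: T_def)
        show ?thesis
        proof (cases "v = u")
          case True
          then show ?thesis using y u par_closed[OF nb_subset y(1)] delta_par[OF y(1)] by (simp add: \<kappa>_def)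
        next
          case False
          moreover have "y \<in> par (st v)" using y par_mono[of "nb v" "st v"] by (auto simp: st_def)
          ultimately show ?thesis using kappa_mult_par[of y v u "h v"] y u v norm by auto
        qed
      qed
      moreover obtain w where "w \<in> fp_words V G" "length w = dist (T v) x" "x \<otimes> ev w \<in> T v"
        using dist_attained[OF x(1) hT Tc] v by blast
      ultimately obtain w' where "w' \<in> fp_words V G" "length w' < dist (T v) x" "x' \<otimes> ev w' \<in> T v"
        using shorten[of u "T v" w x] u x(1) k by (auto simp: x'_def)
      then show ?thesis using dist_le[of w' x' "T v"] by simp
    qed
    \<comment> \<open>By \<open>phi_adj\<close> the element that moves \<open>x\<close> maps
      \<open>T v\<close> into itself, so the same gallery still ends there.\<close>
    have le: "dist (T v) x' \<le> dist (T v) x" if v: "v \<in> V" "adj u v" for v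
    proof -
      obtain w where w: "w \<in> fp_words V G" "length w = dist (T v) x" "x \<otimes> ev w \<in> T v"
        using dist_attained[OF x(1) hT Tc] v by blast
      define c where "c = \<phi> (\<iota> u (inv\<^bsub>G u\<^esub> \<kappa> u x))"
      obtain y where y: "y \<in> par (nb v)" "x \<otimes> ev w = h v \<otimes> y" using w by (auto simp: T_def)
      have yc: "y \<in> carrier H" using par_closed[OF nb_subset y(1)] .
      have c: "c \<in> carrier H" "inv (h v) \<otimes> c \<otimes> h v \<in> par (nb v)"
        using phi_adj[of u v] u v x by (auto simp: c_def)
      have "x' \<otimes> ev w = c \<otimes> (x \<otimes> ev w)" using c x w by (simp add: x'_def c_def m_assoc)
      also have "\<dots> = h v \<otimes> ((inv (h v) \<otimes> c \<otimes> h v) \<otimes> y)" using c y yc v by (simp add: m_assoc)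
      also have "\<dots> \<in> T v" using par_mult[OF nb_subset c(2) y(1)] by (auto simp: T_def)
      finally show ?thesis using dist_le[OF w(1), of x' "T v"] w by simp
    qed
    have "F x' < F x" unfolding F_def
    proof (rule sum_strict_mono_ex1[OF finite_V])
      show "\<forall>v\<in>V. dist (T v) x' \<le> dist (T v) x" using less le by (metis less_imp_le)
      show "\<exists>v\<in>V. dist (T v) x' < dist (T v) x" using less u by blast
    qed
    then show False using x(2)[OF x'] by simp
  qed
  then show ?thesis using x by blast
qed

text \<open>By normalization each of the walls of \<open>u\<close> and \<open>w\<close> lies in the
  wing \<open>\<one>\<close> of the other. On a gallery from \<open>x\<close> to \<open>h w\<close>,
  the first crossing of either wall starts at a chamber on that wall, where the other label is
  \<open>\<one>\<close>.\<close>

lemma kappa_clash: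
  assumes norm: "\<And>u v. \<lbrakk>u \<in> V; v \<in> V; u \<noteq> v; \<not> adj u v\<rbrakk> \<Longrightarrow> \<kappa> u (h v) = \<one>\<^bsub>G u\<^esub>"
    and uw: "u \<in> V" "w \<in> V" "u \<noteq> w" "\<not> adj u w" and x: "x \<in> carrier H" "\<kappa> w x \<noteq> \<one>\<^bsub>G w\<^esub>"
  shows "\<kappa> u x = \<one>\<^bsub>G u\<^esub>"
proof -
  have wall: "\<kappa> b z = \<one>\<^bsub>G b\<^esub>"
    if "a \<in> V" "b \<in> V" "a \<noteq> b" "\<not> adj a b" "z \<in> carrier H" "inv (h a) \<otimes> z \<in> par (st a)" for a b z
  proof -
    have "\<kappa> b (h a \<otimes> (inv (h a) \<otimes> z)) = \<kappa> b (h a)" using that adj_sym by (intro kappa_mult_par[of _ a]) auto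
    then show ?thesis using norm[of b a] that adj_sym by auto
  qed
  have "\<kappa> u x = \<one>\<^bsub>G u\<^esub>" if "ws \<in> fp_words V G" "x \<in> carrier H" "x \<otimes> ev ws = h w" "\<kappa> w x \<noteq> \<one>\<^bsub>G w\<^esub>" for ws x
    using that
  proof (induction ws arbitrary: x)
    case Nil
    then show ?case using norm uw by simp
  next
    case (Cons p ws)
    obtain v s where p: "p = (v, s)" by (cases p)
    have v: "v \<in> V" "s \<in> carrier (G v)" "ws \<in> fp_words V G" using Cons.prems p by auto
    let ?x = "x \<otimes> \<iota> v s"
    have x1: "?x \<in> carrier H" "?x \<otimes> ev ws = h w" using Cons.prems v p by (auto simp: m_assoc)
    consider "\<kappa> u ?x \<noteq> \<kappa> u x" | "\<kappa> w ?x \<noteq> \<kappa> w x" | "\<kappa> u ?x = \<kappa> u x" "\<kappa> w ?x = \<kappa> w x" by blast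
    then show ?case
    proof cases
      case 1
      then have "inv (h u) \<otimes> x \<in> par (st u)" using kappa_right[of u v s x] uw v Cons.prems by blast
      then show ?thesis using wall[of u w x] uw Cons.prems by auto
    next
      case 2
      then have "inv (h w) \<otimes> x \<in> par (st w)" using kappa_right[of w v s x] uw v Cons.prems by blast
      then show ?thesis using wall[of w u x] uw adj_sym Cons.prems by auto
    next
      case 3
      then show ?thesis using Cons.IH[of ?x] x1 v Cons.prems by auto
    qed
  qed
  moreover obtain ws where "ws \<in> fp_words V G" "ev ws = inv x \<otimes> h w"
    using generated[of "inv x \<otimes> h w"] x uw by auto
  ultimately show ?thesis using x uw by simp
qed

text \<open>Ping-pong: a left syllable of \<open>g\<close> at \<open>w\<close> takes the chamber out
  of the wing \<open>\<one>\<close> of the wall of \<open>w\<close>, and \<open>kappa_clash\<close>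
  then fixes the label for every vertex not adjacent to \<open>w\<close>. Hence
  \<open>\<phi> g\<close> with \<open>g \<noteq> \<one>\<close> moves \<open>y\<close> out of the
  intersection of the wings \<open>\<one>\<close>.\<close>

lemma kappa_phi:
  assumes norm: "\<And>u v. \<lbrakk>u \<in> V; v \<in> V; u \<noteq> v; \<not> adj u v\<rbrakk> \<Longrightarrow> \<kappa> u (h v) = \<one>\<^bsub>G u\<^esub>"
    and y: "y \<in> carrier H" "\<And>u. u \<in> V \<Longrightarrow> \<kappa> u y = \<one>\<^bsub>G u\<^esub>" and "g \<in> carrier H" "u \<in> V"
  shows "\<kappa> u (\<phi> g \<otimes> y) = \<delta> u g"
  using assms(4,5)
proof (induction arbitrary: u rule: red_induct)
  case one
  then show ?case using y by simp
next
  case (mult w a g)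
  let ?x = "\<phi> (\<iota> w a \<otimes> g) \<otimes> y"
  have eq: "?x = \<phi> (\<iota> w a) \<otimes> (\<phi> g \<otimes> y)" using mult y by (simp add: phi_mult m_assoc)
  have w: "\<kappa> w ?x = a" using mult y by (simp add: eq kappa_phi_same)
  consider "u = w" | "adj w u" | "u \<noteq> w" "\<not> adj w u" by blast
  then show ?case
  proof cases
    case 1
    then show ?thesis using w mult by (simp add: delta_iota_mult)
  next
    case 2
    then show ?thesis using mult y adj_sym unfolding eq by (simp add: kappa_phi_adj delta_adj_mult)
  next
    case 3
    have "\<kappa> u ?x = \<one>\<^bsub>G u\<^esub>"
      by (rule kappa_clash[where w = w, OF norm]) (use 3 mult w y adj_sym in auto)
    moreover have "\<delta> u (\<iota> w a \<otimes> g) = \<one>\<^bsub>G u\<^esub>"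
      using delta_clash[of w "\<iota> w a \<otimes> g" u] 3 mult by (simp add: delta_iota_mult)
    ultimately show ?thesis by simp
  qed
qed

text \<open>Surjectivity makes the neighbour \<open>y \<otimes> \<iota> w s\<close> of
  \<open>y\<close> a translate \<open>\<phi> g \<otimes> y\<close> with
  \<open>g \<noteq> \<one>\<close>. So it has left some wing \<open>\<one>\<close>, which is
  possible only if \<open>y\<close> lies on the wall of \<open>w\<close>. As this holds for every
  \<open>w\<close>, the single element \<open>y\<close> can replace every
  \<open>h w\<close>.\<close>

theorem inner_if_normalized:
  assumes norm: "\<And>u v. \<lbrakk>u \<in> V; v \<in> V; u \<noteq> v; \<not> adj u v\<rbrakk> \<Longrightarrow> \<kappa> u (h v) = \<one>\<^bsub>G u\<^esub>"
    and surj: "carrier H \<subseteq> \<phi> ` carrier H"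
  shows "\<exists>y\<in>carrier H. \<forall>x\<in>carrier H. \<phi> x = y \<otimes> x \<otimes> inv y"
proof -
  obtain y where y: "y \<in> carrier H" "\<And>u. u \<in> V \<Longrightarrow> \<kappa> u y = \<one>\<^bsub>G u\<^esub>" using ex_base[OF norm] by blast
  have "\<phi> (\<iota> w a) = y \<otimes> \<iota> w a \<otimes> inv y" if w: "w \<in> V" "a \<in> carrier (G w)" for w a
  proof -
    obtain s where s: "s \<in> carrier (G w)" "s \<noteq> \<one>\<^bsub>G w\<^esub>" using nontrivial_G w by blast
    obtain g where g: "g \<in> carrier H" "y \<otimes> \<iota> w s \<otimes> inv y = \<phi> g"
      using surj y w s by (metis imageE inv_closed iota_closed m_closed subsetD)
    have gy: "\<phi> g \<otimes> y = y \<otimes> \<iota> w s" using y w s by (simp add: m_assoc flip: g(2))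
    have "\<exists>v\<in>V. \<kappa> v (y \<otimes> \<iota> w s) \<noteq> \<one>\<^bsub>G v\<^esub>"
    proof (rule ccontr)
      assume "\<not> ?thesis"
      then have "g = \<one>" using kappa_phi[OF norm y g(1)] gy g(1) by (intro delta_trivial) auto
      then have "\<iota> w s = \<one>" using gy y w s by simp
      then show False using iota_eq_one w s by blast
    qed
    then have "inv (h w) \<otimes> y \<in> par (st w)" using kappa_right[OF _ w(1) s(1) y(1)] y(2) by metis
    then have t: "(inv (h w) \<otimes> y) \<otimes> \<iota> w a = \<iota> w a \<otimes> (inv (h w) \<otimes> y)" using par_st_comm w by blast
    have "h w \<otimes> ((inv (h w) \<otimes> y) \<otimes> \<iota> w a) \<otimes> inv y = y \<otimes> \<iota> w a \<otimes> inv y"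
      using w y by (simp add: m_assoc)
    then show ?thesis using w y unfolding t by (simp add: phi_iota m_assoc)
  qed
  then show ?thesis using hom_ext[OF is_group phi_hom inner_hom[OF y(1)]] y(1) by blast
qed

end

section \<open>Torsion elements\<close>

context graph_group
begin

lemma len_remove:
  assumes "v \<in> V" "x \<in> carrier H" "\<delta> v x \<noteq> \<one>\<^bsub>G v\<^esub>"
  shows "len x = Suc (len (\<iota> v (inv\<^bsub>G v\<^esub> \<delta> v x) \<otimes> x))"
proof -
  have "\<delta> v (\<iota> v (inv\<^bsub>G v\<^esub> \<delta> v x) \<otimes> x) = \<one>\<^bsub>G v\<^esub>" using assms by (simp add: delta_iota_mult)
  from len_iota_mult[OF assms(1) _ assms(3) _ this] show ?thesis
    using assms by (simp add: iota_inv)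
qed

lemma len_iota_mult_le:
  assumes "v \<in> V" "a \<in> carrier (G v)" "x \<in> carrier H"
  shows "len (\<iota> v a \<otimes> x) \<le> Suc (len x)"
proof -
  have 1: "len (\<iota> v b \<otimes> y) \<le> Suc (len y)"
    if "b \<in> carrier (G v)" "y \<in> carrier H" "\<delta> v y = \<one>\<^bsub>G v\<^esub>" for b y
    using that assms(1) len_iota_mult[of v b y] by (cases "b = \<one>\<^bsub>G v\<^esub>") auto
  show ?thesis
  proof (cases "\<delta> v x = \<one>\<^bsub>G v\<^esub>")
    case False
    let ?y = "\<iota> v (inv\<^bsub>G v\<^esub> \<delta> v x) \<otimes> x"
    have "\<iota> v a \<otimes> x = \<iota> v (a \<otimes>\<^bsub>G v\<^esub> \<delta> v x) \<otimes> ?y" using assms by (simp add: iota_mult iota_inv m_assoc)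
    moreover have "\<delta> v ?y = \<one>\<^bsub>G v\<^esub>" using assms by (simp add: delta_iota_mult)
    ultimately show ?thesis using 1[of "a \<otimes>\<^bsub>G v\<^esub> \<delta> v x" ?y] len_remove[OF assms(1,3) False] assms by simp
  qed (use 1 assms in auto)
qed

lemma len_inv:
  assumes "x \<in> carrier H"
  shows "len (inv x) = len x"
proof -
  have le: "len (ev w) \<le> length w" if "w \<in> fp_words V G" for w
    using that
  proof (induction w)
    case (Cons p w)
    then show ?case using len_iota_mult_le[of "fst p" "snd p" "ev w"] by (cases p) auto
  qed simp
  have rev: "\<exists>w'\<in>fp_words V G. length w' = length w \<and> ev w' = inv (ev w)" if "w \<in> fp_words V G" for w
    using that
  proof (induction w)
    case Nil
    show ?case by (intro bexI[of _ "[]"]) auto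
  next
    case (Cons p w)
    obtain v g where p: "p = (v, g)" by (cases p)
    from Cons obtain w' where "w' \<in> fp_words V G" "length w' = length w" "ev w' = inv (ev w)" by (cases p) auto
    then show ?case using Cons.prems p
      by (intro bexI[of _ "w' @ [(v, inv\<^bsub>G v\<^esub> g)]"]) (auto simp: ev_append iota_inv inv_mult_group)
  qed
  have "len (inv y) \<le> len y" if y: "y \<in> carrier H" for y
  proof -
    obtain w where w: "red w" "ev w = y" using ex_red[OF y] by blast
    then show ?thesis using rev[OF red_words[OF w(1)]] le len_red[OF w(1)] by metis
  qed
  from this[OF assms] this[of "inv x"] show ?thesis using assms by simp
qed

lemma par_invD: "\<lbrakk>x \<in> carrier H; S \<subseteq> V; inv x \<in> par S\<rbrakk> \<Longrightarrow> x \<in> par S"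
  using par_inv[of "inv x" S] by simp

lemma par_cancel_right: "\<lbrakk>x \<in> carrier H; S \<subseteq> V; s \<in> par S; x \<otimes> s \<in> par S\<rbrakk> \<Longrightarrow> x \<in> par S"
  using par_mult[of S "x \<otimes> s" "inv s"] par_inv[of s S] par_closed[of S s] by (simp add: m_assoc)

lemma par_cancel_left: "\<lbrakk>x \<in> carrier H; S \<subseteq> V; s \<in> par S; s \<otimes> x \<in> par S\<rbrakk> \<Longrightarrow> x \<in> par S"
  using par_mult[of S "inv s" "s \<otimes> x"] par_inv[of s S] par_closed[of S s] by simp

lemma delta_outside_wall:
  assumes "s \<in> par (st v)" "v \<in> V" "x \<in> carrier H" "x \<notin> par (st v)"
  shows "\<delta> v (x \<otimes> s) = \<delta> v x"
  using assms(1) st_subset[OF assms(2)] assms(3-)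
proof (induction arbitrary: x rule: par_induct)
  case (mult u g y)
  have "\<delta> v (x \<otimes> \<iota> u g) = \<delta> v x" using delta_right[of x u g v] mult assms by auto
  moreover have "x \<otimes> \<iota> u g \<notin> par (st v)" using par_cancel_right[of x "st v" "\<iota> u g"] mult assms by auto
  ultimately show ?case using mult.IH[of "x \<otimes> \<iota> u g"] mult by (simp add: m_assoc)
qed simp

text \<open>The syllable is taken off at the left end, and at the right end it merges with the
  \<open>v\<close>-syllable already there, so the length saved is not lost again.\<close>

lemma conj_shorten:
  assumes x: "x \<in> carrier H" "x \<notin> par (st v)" and v: "v \<in> V"
    and d: "\<delta> v x \<noteq> \<one>\<^bsub>G v\<^esub>" "\<delta> v (inv x) \<noteq> \<one>\<^bsub>G v\<^esub>"
  shows "len (inv (\<iota> v (\<delta> v x)) \<otimes> x \<otimes> \<iota> v (\<delta> v x)) < len x"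
proof -
  define a b where "a = \<delta> v x" and "b = \<delta> v (inv x)"
  define z where "z = inv x \<otimes> \<iota> v a"
  have c: "a \<in> carrier (G v)" "b \<in> carrier (G v)" "z \<in> carrier H" using x v by (auto simp: a_def b_def z_def)
  have "len x = Suc (len (inv z))"
    using len_remove[OF v x(1) d(1)] x v c by (simp add: z_def inv_mult_group iota_inv flip: a_def)
  then have lx: "len x = Suc (len z)" using c by (simp add: len_inv)
  have dz: "\<delta> v z = b" unfolding z_def b_def
    by (rule delta_outside_wall) (use x v c par_invD[of x "st v"] in \<open>auto simp: st_def\<close>)
  then have lz: "len z = Suc (len (\<iota> v (inv\<^bsub>G v\<^esub> b) \<otimes> z))" using len_remove[OF v c(3)] d(2) by (simp add: b_def)
  have "inv (inv (\<iota> v a) \<otimes> x \<otimes> \<iota> v a) = \<iota> v (inv\<^bsub>G v\<^esub> a \<otimes>\<^bsub>G v\<^esub> b) \<otimes> (\<iota> v (inv\<^bsub>G v\<^esub> b) \<otimes> z)"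
    using x v c by (simp add: inv_mult_group iota_mult iota_inv m_assoc z_def)
  moreover have "len (inv (inv (\<iota> v a) \<otimes> x \<otimes> \<iota> v a)) = len (inv (\<iota> v a) \<otimes> x \<otimes> \<iota> v a)"
    using x v c by (simp add: len_inv)
  ultimately have "len (inv (\<iota> v a) \<otimes> x \<otimes> \<iota> v a) \<le> len z"
    using len_iota_mult_le[of v "inv\<^bsub>G v\<^esub> a \<otimes>\<^bsub>G v\<^esub> b" "\<iota> v (inv\<^bsub>G v\<^esub> b) \<otimes> z"] c v lz by simp
  then show ?thesis using lx by (simp add: a_def)
qed

text \<open>Left multiplication by \<open>x\<close> maps the complement of the wing \<open>\<one>\<close> of the wall \<open>G\<^bsub>st v\<^esub>\<close> into itself.\<close>

lemma not_torsion:
  assumes x: "x \<in> carrier H" "x \<notin> par (st v)" and v: "v \<in> V"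
    and d: "\<delta> v x \<noteq> \<one>\<^bsub>G v\<^esub>" "\<delta> v (inv x) = \<one>\<^bsub>G v\<^esub>" and n: "n > 0"
  shows "x [^] (n::nat) \<noteq> \<one>"
proof -
  have ix: "inv x \<notin> par (st v)" using par_invD[of x "st v"] x v by auto
  \<comment> \<open>The walls \<open>par (st v)\<close> and its translate by \<open>x\<close> do not
    cross: a chamber on the first has the label of \<open>\<one>\<close> for the second, and a
    chamber on the second has the label of \<open>x\<close> for the first. This settles every
    crossing on the way from \<open>y\<close> to \<open>x\<close>.\<close>
  have nest: "\<delta> v y = \<delta> v x"
    if "w \<in> fp_words V G" "y \<in> carrier H" "y \<otimes> ev w = x" "\<delta> v (inv x \<otimes> y) \<noteq> \<one>\<^bsub>G v\<^esub>" for w y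
    using that
  proof (induction w arbitrary: y)
    case (Cons p w)
    obtain u s where p: "p = (u, s)" by (cases p)
    have u: "u \<in> V" "s \<in> carrier (G u)" "w \<in> fp_words V G" using Cons.prems p by auto
    let ?y = "y \<otimes> \<iota> u s"
    have y1: "?y \<in> carrier H" "?y \<otimes> ev w = x" using Cons.prems u p by (auto simp: m_assoc)
    consider "\<delta> v ?y \<noteq> \<delta> v y" | "\<delta> v (inv x \<otimes> ?y) \<noteq> \<delta> v (inv x \<otimes> y)"
      | "\<delta> v ?y = \<delta> v y" "\<delta> v (inv x \<otimes> ?y) = \<delta> v (inv x \<otimes> y)" by blast
    then show ?case
    proof cases
      case 1
      then have "y \<in> par (st v)" using delta_right[of y u s v] Cons.prems u v by auto
      then show ?thesis using delta_outside_wall[OF _ v _ ix, of y] x d Cons.prems by simp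
    next
      case 2
      then have "inv x \<otimes> y \<in> par (st v)" using delta_right[of "inv x \<otimes> y" u s v] Cons.prems u v x by (auto simp: m_assoc)
      then show ?thesis using delta_outside_wall[OF _ v x, of "inv x \<otimes> y"] x Cons.prems by simp
    next
      case 3
      then show ?thesis using Cons.IH[of ?y] Cons.prems y1 u by auto
    qed
  qed (use x in auto)
  have step: "\<delta> v (x \<otimes> z) = \<delta> v x" if z: "z \<in> carrier H" "\<delta> v z \<noteq> \<one>\<^bsub>G v\<^esub>" for z
  proof -
    obtain w where "w \<in> fp_words V G" "ev w = inv (x \<otimes> z) \<otimes> x" using generated[of "inv (x \<otimes> z) \<otimes> x"] x z by auto
    then show ?thesis using nest[of w "x \<otimes> z"] x z by simp
  qed
  have "\<delta> v (x [^] Suc n) = \<delta> v x" for n :: nat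
  proof (induction n)
    case (Suc n)
    then show ?case using step[of "x [^] Suc n"] x d nat_pow_Suc2[of x "Suc n"] by simp
  qed (use x in simp)
  then have "\<delta> v (x [^] n) = \<delta> v x" using n by (cases n) auto
  then show ?thesis using d by auto
qed

definition torsion :: "'h \<Rightarrow> bool" where "torsion x \<longleftrightarrow> x \<in> carrier H \<and> (\<exists>n>0. x [^] (n::nat) = \<one>)"

text \<open>In effect an element of the product of the vertex groups of a clique: by
  \<open>delta_clash\<close> the front vertices are pairwise adjacent, and by
  \<open>clique_elt_word\<close> no others are needed.\<close>

definition clique_elt :: "'h \<Rightarrow> bool" where
  "clique_elt x \<longleftrightarrow> x \<in> carrier H \<and> (\<forall>v\<in>V. \<delta> v x = \<one>\<^bsub>G v\<^esub> \<or> x \<in> par (st v))"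

lemma conj_pow:
  assumes "x \<in> carrier H" "k \<in> carrier H"
  shows "(k \<otimes> x \<otimes> inv k) [^] (n::nat) = k \<otimes> x [^] n \<otimes> inv k"
  using assms by (induction n) (auto simp: m_assoc)

lemma torsion_conj:
  assumes "torsion x" "k \<in> carrier H"
  shows "torsion (k \<otimes> x \<otimes> inv k)"
proof -
  obtain n :: nat where "n > 0" "x [^] n = \<one>" "x \<in> carrier H" using assms by (auto simp: torsion_def)
  then show ?thesis using assms(2) by (auto simp: torsion_def conj_pow intro!: exI[of _ n] simp del: nat_pow_Suc)
qed

text \<open>Take a conjugate of least length. If it had a front syllable at \<open>v\<close> without
  lying in \<open>par (st v)\<close>, then either \<open>conj_shorten\<close> would shorten it or
  \<open>not_torsion\<close> would give it infinite order.\<close>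

lemma torsion_conj_clique:
  assumes "torsion x"
  shows "\<exists>k\<in>carrier H. \<exists>c. clique_elt c \<and> x = k \<otimes> c \<otimes> inv k"
proof -
  have x: "x \<in> carrier H" using assms by (simp add: torsion_def)
  obtain k where k: "k \<in> carrier H"
    and min: "\<And>l. l \<in> carrier H \<Longrightarrow> len (inv k \<otimes> x \<otimes> k) \<le> len (inv l \<otimes> x \<otimes> l)"
    using ex_has_least_nat[of "\<lambda>k. k \<in> carrier H" \<one> "\<lambda>k. len (inv k \<otimes> x \<otimes> k)"] by auto
  define c where "c = inv k \<otimes> x \<otimes> k"
  have c: "c \<in> carrier H" "x = k \<otimes> c \<otimes> inv k" using x k by (auto simp: c_def m_assoc)
  have "torsion c" using torsion_conj[OF assms, of "inv k"] k by (simp add: c_def)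
  then obtain n :: nat where n: "n > 0" "c [^] n = \<one>" by (auto simp: torsion_def)
  have "\<delta> v c = \<one>\<^bsub>G v\<^esub> \<or> c \<in> par (st v)" if v: "v \<in> V" for v
  proof (rule ccontr)
    assume neg: "\<not> ?thesis"
    show False
    proof (cases "\<delta> v (inv c) = \<one>\<^bsub>G v\<^esub>")
      case True
      then show ?thesis using not_torsion[OF c(1) _ v _ _ n(1)] neg n by auto
    next
      case False
      let ?a = "\<iota> v (\<delta> v c)"
      have "len (inv ?a \<otimes> c \<otimes> ?a) < len c" using conj_shorten[OF c(1) _ v] neg False by auto
      moreover have "inv ?a \<otimes> c \<otimes> ?a = inv (k \<otimes> ?a) \<otimes> x \<otimes> (k \<otimes> ?a)"
        using x k v c(1) by (simp add: inv_mult_group m_assoc c_def)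
      ultimately show ?thesis using min[of "k \<otimes> ?a"] k v c(1) by (simp add: c_def)
    qed
  qed
  then show ?thesis using c k by (auto simp: clique_elt_def)
qed

lemma clique_elt_ab: "\<lbrakk>clique_elt x; v \<in> V; \<delta> v x \<noteq> \<one>\<^bsub>G v\<^esub>\<rbrakk> \<Longrightarrow> ab v x = \<delta> v x"
  using ab_st by (auto simp: clique_elt_def)

lemma clique_elt_one:
  assumes "clique_elt x" "\<And>v. v \<in> V \<Longrightarrow> ab v x = \<one>\<^bsub>G v\<^esub>"
  shows "x = \<one>"
  using delta_trivial[of x] clique_elt_ab[OF assms(1)] assms by (metis clique_elt_def)

text \<open>\<open>ab\<close> sees every front syllable of a clique element, so \<open>v\<close>
  alone can carry one; what remains of \<open>x\<close> after its removal has no front syllable at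
  all.\<close>

lemma clique_elt_iota:
  assumes x: "clique_elt x" and v: "v \<in> V" "b \<in> carrier (G v)"
    and ab: "\<And>u. u \<in> V \<Longrightarrow> ab u x = ab u (\<iota> v b)"
  shows "x = \<iota> v b"
proof (cases "b = \<one>\<^bsub>G v\<^esub>")
  case True
  then show ?thesis using clique_elt_one[OF x] ab v by simp
next
  case False
  have xc: "x \<in> carrier H" using x by (simp add: clique_elt_def)
  have only: "w = v \<and> \<delta> w x = b" if "w \<in> V" "\<delta> w x \<noteq> \<one>\<^bsub>G w\<^esub>" for w
    using clique_elt_ab[OF x that] ab[OF that(1)] that v by (auto simp: ab_iota split: if_splits)
  have "x \<noteq> \<one>" using ab[OF v(1)] v False by (auto simp: ab_iota)
  then have dv: "\<delta> v x = b" using delta_trivial[OF xc] only by metis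
  then have "x \<in> par (st v)" using x v False by (auto simp: clique_elt_def)
  then obtain a y where y: "a \<in> carrier (G v)" "y \<in> par (nb v)" "x = \<iota> v a \<otimes> y"
    using par_st_decomp v by blast
  have yc: "y \<in> carrier H" using par_closed[OF nb_subset y(2)] .
  have ab': "a = b" using dv y yc v delta_par[OF y(2) nb_subset nb_irrefl] by (simp add: delta_iota_mult)
  have "y = \<one>"
  proof (rule delta_trivial[OF yc])
    fix w assume w: "w \<in> V"
    show "\<delta> w y = \<one>\<^bsub>G w\<^esub>"
    proof (cases "w \<in> nb v")
      case True
      then have "adj w v" "w \<noteq> v" using adj_sym by (auto simp: nb_def adj_irrefl)
      then have "\<delta> w x = \<delta> w y" unfolding y(3) using delta_adj_mult[OF _ w v(1) y(1) yc] by blast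
      then show ?thesis using only[OF w] \<open>w \<noteq> v\<close> by metis
    next
      case False
      then show ?thesis using delta_par[OF y(2)] by simp
    qed
  qed
  then show ?thesis using y ab' v by simp
qed

lemma clique_elt_word:
  assumes "clique_elt x"
  shows "\<exists>w\<in>fp_words V G. distinct (map fst w) \<and> fst ` set w \<subseteq> {u. \<delta> u x \<noteq> \<one>\<^bsub>G u\<^esub>} \<and> ev w = x"
proof -
  have "x \<in> carrier H" using assms by (simp add: clique_elt_def)
  then show ?thesis using assms
  proof (induction rule: red_induct)
    case one
    show ?case by (intro bexI[of _ "[]"]) auto
  next
    case (mult v a y)
    let ?x = "\<iota> v a \<otimes> y"
    have dx: "\<delta> v ?x = a" using mult by (simp add: delta_iota_mult)
    then have "?x \<in> par (st v)" using mult by (auto simp: clique_elt_def)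
    then have "y \<in> par (st v)" using par_cancel_left[of y "st v" "\<iota> v a"] mult by (auto simp: st_def[of v])
    then have ynb: "y \<in> par (nb v)" using mult par_nb_of_st by blast
    have dy: "w \<in> nb v \<and> \<delta> w ?x = \<delta> w y" if "\<delta> w y \<noteq> \<one>\<^bsub>G w\<^esub>" for w
    proof -
      have w: "w \<in> nb v" using delta_par[OF ynb nb_subset, of w] that by blast
      then show ?thesis using mult adj_sym by (auto simp: nb_def delta_adj_mult)
    qed
    have "clique_elt y" unfolding clique_elt_def
    proof (intro conjI ballI)
      fix w assume w: "w \<in> V"
      show "\<delta> w y = \<one>\<^bsub>G w\<^esub> \<or> y \<in> par (st w)"
      proof (cases "\<delta> w y = \<one>\<^bsub>G w\<^esub>")
        case False
        then have "?x \<in> par (st w)" "v \<in> st w"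
          using dy[OF False] mult w adj_sym by (auto simp: clique_elt_def st_def nb_def)
        then show ?thesis using par_cancel_left[of y "st w" "\<iota> v a"] mult w by auto
      qed simp
    qed (use mult in simp)
    then obtain w where w: "w \<in> fp_words V G" "distinct (map fst w)"
      "fst ` set w \<subseteq> {u. \<delta> u y \<noteq> \<one>\<^bsub>G u\<^esub>}" "ev w = y" using mult.IH by blast
    have "v \<notin> fst ` set w" using w(3) mult by auto
    moreover have "fst ` set w \<subseteq> {u. \<delta> u ?x \<noteq> \<one>\<^bsub>G u\<^esub>}" using w(3) dy by fastforce
    ultimately show ?case using w mult dx by (intro bexI[of _ "(v, a) # w"]) auto
  qed
qed

text \<open>The vertices of the word are distinct, which bounds its length. Together with
  \<open>torsion_conj_clique\<close> this leaves finitely many conjugacy classes of torsion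
  elements.\<close>

lemma finite_clique_elts: "finite {x. clique_elt x}"
proof -
  let ?L = "SIGMA v:V. carrier (G v)"
  have "{x. clique_elt x} \<subseteq> ev ` {w. set w \<subseteq> ?L \<and> length w \<le> card V}"
  proof
    fix x assume "x \<in> {x. clique_elt x}"
    then obtain w where w: "w \<in> fp_words V G" "distinct (map fst w)" "ev w = x" using clique_elt_word by blast
    have "set w \<subseteq> ?L" using w(1) by (auto simp: fp_words_def)
    then have "fst ` set w \<subseteq> V" by auto
    then have "length w \<le> card V" using card_mono[OF finite_V, of "fst ` set w"] distinct_card[OF w(2)] by simp
    then show "x \<in> ev ` {w. set w \<subseteq> ?L \<and> length w \<le> card V}" using w \<open>set w \<subseteq> ?L\<close> by auto
  qed
  moreover have "finite ?L" using finite_V finite_G by auto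
  ultimately show ?thesis
    by (rule finite_subset[OF _ finite_imageI[OF finite_lists_length_le]])
qed

lemma torsion_iota:
  assumes "v \<in> V" "a \<in> carrier (G v)"
  shows "torsion (\<iota> v a)"
proof -
  interpret Gv: group "G v" by (rule group_G) fact
  have "\<iota> v a [^] order (G v) = \<iota> v (a [^]\<^bsub>G v\<^esub> order (G v))"
    using group_hom.hom_nat_pow[of "G v" H "\<iota> v" a] assms iota_hom Gv.is_group is_group
    by (simp add: group_hom_def group_hom_axioms_def)
  then have "\<iota> v a [^] order (G v) = \<one>" using assms Gv.pow_order_eq_1 by simp
  moreover have "order (G v) > 0" using Gv.order_gt_0_iff_finite finite_G assms by blast
  ultimately show ?thesis using assms by (auto simp: torsion_def)
qed

lemma torsion_mult:
  assumes "torsion x" "torsion y" "x \<otimes> y = y \<otimes> x"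
  shows "torsion (x \<otimes> y)"
proof -
  obtain n m :: nat where nm: "n > 0" "m > 0" "x [^] n = \<one>" "y [^] m = \<one>" "x \<in> carrier H" "y \<in> carrier H"
    using assms by (auto simp: torsion_def)
  have "(x \<otimes> y) [^] (n * m) = x [^] (n * m) \<otimes> y [^] (m * n)"
    using pow_mult_distrib[OF assms(3) nm(5,6), of "n * m"] by (simp add: mult.commute)
  also have "\<dots> = \<one>" using nm by (simp flip: nat_pow_pow)
  finally show ?thesis using nm by (auto simp: torsion_def intro!: exI[of _ "n * m"])
qed

text \<open>The conjugators for different elements of \<open>G v\<close> might differ. Undoing the
  one for a fixed \<open>a \<noteq> \<one>\<close> puts the image of \<open>\<iota> v b\<close> into
  the centralizer of \<open>\<iota> v a\<close>. There it differs from \<open>\<iota> v b\<close> by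
  a torsion element that every \<open>ab u\<close> kills, and such an element is trivial.\<close>

lemma uniform_conj:
  assumes phi: "\<phi> \<in> hom H H" and v: "v \<in> V"
    and conj: "\<And>a. a \<in> carrier (G v) \<Longrightarrow> \<exists>k\<in>carrier H. \<phi> (\<iota> v a) = k \<otimes> \<iota> v a \<otimes> inv k"
  shows "\<exists>k\<in>carrier H. \<forall>a\<in>carrier (G v). \<phi> (\<iota> v a) = k \<otimes> \<iota> v a \<otimes> inv k"
proof -
  obtain a where a: "a \<in> carrier (G v)" "a \<noteq> \<one>\<^bsub>G v\<^esub>" using nontrivial_G v by blast
  interpret Gv: comm_group "G v" by (rule comm_G[OF v])
  obtain k where k: "k \<in> carrier H" "\<phi> (\<iota> v a) = k \<otimes> \<iota> v a \<otimes> inv k" using conj a by blast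
  have pc: "\<phi> x \<in> carrier H" if "x \<in> carrier H" for x using hom_in_carrier[OF phi that] .
  have "\<phi> (\<iota> v b) = k \<otimes> \<iota> v b \<otimes> inv k" if b: "b \<in> carrier (G v)" for b
  proof -
    define s where "s = inv k \<otimes> \<phi> (\<iota> v b) \<otimes> k"
    obtain k' where k': "k' \<in> carrier H" "\<phi> (\<iota> v b) = k' \<otimes> \<iota> v b \<otimes> inv k'" using conj b by blast
    have sc: "s \<in> carrier H" using k b v pc by (simp add: s_def)
    have com: "\<phi> (\<iota> v b) \<otimes> \<phi> (\<iota> v a) = \<phi> (\<iota> v a) \<otimes> \<phi> (\<iota> v b)"
      using hom_mult[OF phi] iota_mult[OF v] a b v Gv.m_comm by (metis iota_closed)
    have ia: "\<iota> v a = inv k \<otimes> \<phi> (\<iota> v a) \<otimes> k" using k a v by (simp add: m_assoc)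
    have "s \<otimes> \<iota> v a = inv k \<otimes> (\<phi> (\<iota> v b) \<otimes> \<phi> (\<iota> v a)) \<otimes> k"
      by (subst ia) (use k a b v pc in \<open>simp add: s_def m_assoc\<close>)
    also have "\<dots> = \<iota> v a \<otimes> s"
      unfolding com by (subst (2) ia) (use k a b v pc in \<open>simp add: s_def m_assoc\<close>)
    finally have sst: "s \<in> par (st v)" using a v sc by (intro centralizer[of s v a]) auto
    have tb: "torsion (\<phi> (\<iota> v b))" using torsion_conj[OF torsion_iota[OF v b] k'(1)] k' by simp
    have ts: "torsion s" using torsion_conj[OF tb, of "inv k"] k by (simp add: s_def)
    have abs: "ab u s = ab u (\<iota> v b)" if "u \<in> V" for u
      using ab_conj[OF that, of "\<phi> (\<iota> v b)" "inv k"] ab_conj[OF that, of "\<iota> v b" k'] k k' b v pc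
      by (simp add: s_def)
    define t where "t = \<iota> v (inv\<^bsub>G v\<^esub> b) \<otimes> s"
    have tc: "t \<in> carrier H" using sc b v by (simp add: t_def)
    have "torsion t" unfolding t_def
      using torsion_mult[OF torsion_iota[of v "inv\<^bsub>G v\<^esub> b"] ts] par_st_comm[OF sst v, of "inv\<^bsub>G v\<^esub> b"] b v by simp
    then obtain l c where c: "l \<in> carrier H" "clique_elt c" "t = l \<otimes> c \<otimes> inv l" using torsion_conj_clique by blast
    have cc: "c \<in> carrier H" using c by (simp add: clique_elt_def)
    have "ab u c = \<one>\<^bsub>G u\<^esub>" if u: "u \<in> V" for u
    proof -
      have "ab u c = ab u t" using ab_conj[OF u cc c(1)] c by simp
      then show ?thesis using u b v sc by (auto simp: t_def ab_mult ab_iota abs)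
    qed
    then have "c = \<one>" using clique_elt_one c by blast
    then have "t = \<one>" using c by simp
    then have "\<iota> v b \<otimes> t = \<iota> v b" using b v by simp
    then have "s = \<iota> v b" using b v sc by (simp add: t_def iota_inv)
    then have "k \<otimes> s \<otimes> inv k = k \<otimes> \<iota> v b \<otimes> inv k" by simp
    then show ?thesis using k b v pc by (simp add: s_def m_assoc)
  qed
  then show ?thesis using k by blast
qed

lemma conj_endoI:
  assumes "\<phi> \<in> hom H H"
    and "\<And>v a. \<lbrakk>v \<in> V; a \<in> carrier (G v)\<rbrakk> \<Longrightarrow> \<exists>k\<in>carrier H. \<phi> (\<iota> v a) = k \<otimes> \<iota> v a \<otimes> inv k"
  shows "\<exists>h. conj_endo V adj G H \<iota> \<phi> h"
proof -
  have "\<forall>v\<in>V. \<exists>k. k \<in> carrier H \<and> (\<forall>a\<in>carrier (G v). \<phi> (\<iota> v a) = k \<otimes> \<iota> v a \<otimes> inv k)"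
    using uniform_conj[OF assms(1) _ assms(2)] by blast
  from bchoice[OF this] obtain h where
    "\<forall>v\<in>V. h v \<in> carrier H \<and> (\<forall>a\<in>carrier (G v). \<phi> (\<iota> v a) = h v \<otimes> \<iota> v a \<otimes> inv (h v))" ..
  then have "conj_endo V adj G H \<iota> \<phi> h"
    using assms(1) by (intro conj_endo.intro graph_group_axioms conj_endo_axioms.intro) auto
  then show ?thesis by blast
qed

end

context conj_endo
begin

text \<open>The walls of \<open>v\<close> and \<open>v'\<close> share the chamber
  \<open>h v \<otimes> k'\<close>. The way from \<open>h v\<close> to \<open>h v'\<close> through it
  runs along the wall of \<open>v\<close> and then along that of \<open>v'\<close>, so it does not
  cross the wall of \<open>u\<close>.\<close>

lemma kappa_adjacent:
  assumes V: "u \<in> V" "v \<in> V" "v' \<in> V" and "adj v v'" "u \<noteq> v" "u \<noteq> v'" "\<not> adj u v" "\<not> adj u v'"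
  shows "\<kappa> u (h v) = \<kappa> u (h v')"
proof -
  obtain b where b: "b \<in> carrier (G v')" "b \<noteq> \<one>\<^bsub>G v'\<^esub>" using nontrivial_G V by blast
  define c where "c = inv (h v) \<otimes> \<phi> (\<iota> v' b) \<otimes> h v"
  have c: "c \<in> par (nb v)" unfolding c_def using phi_adj[of v' v b] assms b adj_sym by blast
  have "torsion (\<phi> (\<iota> v' b))" using torsion_conj[OF torsion_iota[of v' b]] V b by (simp add: phi_iota)
  then have "torsion c" using torsion_conj[of "\<phi> (\<iota> v' b)" "inv (h v)"] V by (simp add: c_def)
  then obtain k d where d: "k \<in> carrier H" "clique_elt d" "c = k \<otimes> d \<otimes> inv k" using torsion_conj_clique by blast
  have dc: "d \<in> carrier H" using d by (simp add: clique_elt_def)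
  have "d = \<iota> v' b"
  proof (rule clique_elt_iota[OF d(2) V(3) b(1)])
    fix u assume u: "u \<in> V"
    have "ab u d = ab u c" using ab_conj[OF u dc d(1)] d by simp
    also have "\<dots> = ab u (\<phi> (\<iota> v' b))" using ab_conj[OF u, of "\<phi> (\<iota> v' b)" "inv (h v)"] V b by (simp add: c_def)
    also have "\<dots> = ab u (\<iota> v' b)" using ab_conj[OF u, of "\<iota> v' b" "h v'"] V b by (simp add: phi_iota)
    finally show "ab u d = ab u (\<iota> v' b)" .
  qed
  moreover have "v' \<in> nb v" using assms by (simp add: nb_def)
  ultimately have rd: "retr (nb v) d = \<iota> v' b" using V b by (simp add: retr_iota)
  \<comment> \<open>The conjugator \<open>k\<close> is known in \<open>H\<close> only; as
    \<open>c\<close> lies in \<open>par (nb v)\<close>, the retraction replaces it by one inside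
    that subgroup.\<close>
  define k' where "k' = retr (nb v) k"
  have k': "k' \<in> par (nb v)" "k' \<in> carrier H" using d retr_in_par[of k "nb v"] by (auto simp: k'_def)
  have cr: "c = k' \<otimes> \<iota> v' b \<otimes> inv k'"
    using retr_par[OF c nb_subset] d dc rd by (simp add: retr_mult retr_inv k'_def)
  define m where "m = inv (h v \<otimes> k') \<otimes> h v'"
  have mc: "m \<in> carrier H" using V k' by (simp add: m_def)
  have "h v \<otimes> c \<otimes> inv (h v) = \<phi> (\<iota> v' b)" using V b by (simp add: c_def m_assoc)
  then have e: "h v \<otimes> k' \<otimes> \<iota> v' b \<otimes> inv k' \<otimes> inv (h v) = h v' \<otimes> \<iota> v' b \<otimes> inv (h v')"
    using V b k' by (simp add: cr phi_iota m_assoc)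
  have "inv (h v \<otimes> k') \<otimes> (h v \<otimes> k' \<otimes> \<iota> v' b \<otimes> inv k' \<otimes> inv (h v)) \<otimes> h v' = \<iota> v' b \<otimes> m"
    using V b k' by (simp add: m_def inv_mult_group m_assoc)
  then have "m \<otimes> \<iota> v' b = \<iota> v' b \<otimes> m" unfolding e using V b k' by (simp add: m_def m_assoc)
  then have mst: "m \<in> par (st v')" using centralizer[OF mc V(3) b] by simp
  have k'st: "k' \<in> par (st v)" using k' par_mono[of "nb v" "st v"] by (auto simp: st_def)
  have "\<kappa> u (h v) = \<kappa> u (h v \<otimes> k')" using kappa_mult_par[OF k'st, of u "h v"] assms by simp
  also have "\<dots> = \<kappa> u (h v \<otimes> k' \<otimes> m)" using kappa_mult_par[OF mst, of u "h v \<otimes> k'"] assms k' by simp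
  also have "h v \<otimes> k' \<otimes> m = h v'" using V k' by (simp add: m_def)
  finally show ?thesis .
qed

end

section \<open>Partial conjugations and the finite case\<close>

lemma finite_image_reps:
  assumes "finite (f ` S)"
  shows "\<exists>D. finite D \<and> D \<subseteq> S \<and> (\<forall>x\<in>S. \<exists>d\<in>D. f d = f x)"
proof -
  obtain D where "D \<subseteq> S" "finite D" "f ` S = f ` D" using finite_subset_image[OF assms order_refl] by blast
  then show ?thesis by (metis imageE imageI)
qed

lemma (in group) AutoGroup_simps:
  shows carrier_AutoGroup: "carrier (AutoGroup G) = auto G"
    and AutoGroup_apply: "\<And>f g x. \<lbrakk>f \<in> auto G; g \<in> auto G; x \<in> carrier G\<rbrakk> \<Longrightarrow> (f \<otimes>\<^bsub>AutoGroup G\<^esub> g) x = f (g x)"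
    and AutoGroup_one_apply: "\<And>x. x \<in> carrier G \<Longrightarrow> \<one>\<^bsub>AutoGroup G\<^esub> x = x"
  by (auto simp: AutoGroup_def BijGroup_def auto_def compose_def)

lemma (in group) AutoGroup_inv_apply:
  assumes "f \<in> auto G" "x \<in> carrier G"
  shows "(inv\<^bsub>AutoGroup G\<^esub> f) (f x) = x" "f ((inv\<^bsub>AutoGroup G\<^esub> f) x) = x"
proof -
  interpret A: group "AutoGroup G" by (rule AutoGroup)
  have i: "inv\<^bsub>AutoGroup G\<^esub> f \<in> auto G" using A.inv_closed[of f] assms by (simp add: carrier_AutoGroup)
  have "(inv\<^bsub>AutoGroup G\<^esub> f \<otimes>\<^bsub>AutoGroup G\<^esub> f) x = x" "(f \<otimes>\<^bsub>AutoGroup G\<^esub> inv\<^bsub>AutoGroup G\<^esub> f) x = x"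
    using assms by (simp_all add: carrier_AutoGroup AutoGroup_one_apply)
  then show "(inv\<^bsub>AutoGroup G\<^esub> f) (f x) = x" "f ((inv\<^bsub>AutoGroup G\<^esub> f) x) = x"
    using AutoGroup_apply[OF i assms] AutoGroup_apply[OF assms(1) i assms(2)] by simp_all
qed

lemma (in group) autoI:
  assumes "f \<in> hom G G" "g \<in> carrier G \<rightarrow> carrier G"
    "\<And>x. x \<in> carrier G \<Longrightarrow> g (f x) = x" "\<And>x. x \<in> carrier G \<Longrightarrow> f (g x) = x"
  shows "restrict f (carrier G) \<in> auto G"
proof -
  have fc: "f x \<in> carrier G" if "x \<in> carrier G" for x using hom_in_carrier[OF assms(1) that] .
  have "bij_betw (restrict f (carrier G)) (carrier G) (carrier G)"
    by (rule bij_betwI[of _ _ _ g]) (use assms fc in auto)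
  moreover have "restrict f (carrier G) \<in> hom G G" using assms(1) fc by (auto simp: hom_def)
  ultimately show ?thesis by (auto simp: auto_def Bij_def)
qed

context graph_group
begin

abbreviation aut_mult (infixl "\<bullet>" 70) where "\<phi> \<bullet> \<psi> \<equiv> \<phi> \<otimes>\<^bsub>AutoGroup H\<^esub> \<psi>"
abbreviation "ainv \<phi> \<equiv> inv\<^bsub>AutoGroup H\<^esub> \<phi>"
abbreviation "aone \<equiv> \<one>\<^bsub>AutoGroup H\<^esub>"

text \<open>
  Any \<open>C\<close> below is a union of components of \<open>\<Gamma> \ (lk x\<^sub>1 \<inter> lk x\<^sub>2)\<close>; the component of \<open>z\<close> is the smallest one.
\<close>

definition sil :: "'v \<Rightarrow> 'v \<Rightarrow> 'v \<Rightarrow> bool" where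
  "sil x1 x2 z \<longleftrightarrow> x1 \<in> V \<and> x2 \<in> V \<and> x1 \<noteq> x2 \<and> \<not> adj x1 x2 \<and>
    (\<exists>C\<subseteq>V. z \<in> C \<and> x1 \<notin> C \<and> x2 \<notin> C \<and> (\<forall>v\<in>C. \<not> (adj x1 v \<and> adj x2 v)) \<and>
      (\<forall>v\<in>C. \<forall>v'\<in>V. adj v v' \<longrightarrow> \<not> (adj x1 v' \<and> adj x2 v') \<longrightarrow> v' \<in> C))"

definition conn :: "'v \<Rightarrow> 'v \<Rightarrow> 'v \<Rightarrow> bool" where
  "conn u = (\<lambda>a b. a \<in> V - st u \<and> b \<in> V - st u \<and> adj a b)\<^sup>*\<^sup>*"

lemma conn_outside: "\<lbrakk>conn u v c; v \<in> V - st u\<rbrakk> \<Longrightarrow> c \<in> V - st u"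
  unfolding conn_def by (induction rule: rtranclp_induct) auto

lemma conn_step: "\<lbrakk>conn u v c; c \<in> V - st u; x \<in> V - st u; adj c x\<rbrakk> \<Longrightarrow> conn u v x"
  unfolding conn_def by (erule rtranclp.rtrancl_into_rtrancl) simp

text \<open>Otherwise let \<open>C\<close> consist of the vertices joined to \<open>v\<close> both
  outside \<open>st u\<close> and outside \<open>st w\<close>. A neighbour of \<open>C\<close> in
  the link of only one of the two, say of \<open>u\<close>, would join \<open>v\<close> to
  \<open>u\<close> outside \<open>st w\<close>. So \<open>C\<close> is closed in the sense of
  \<open>sil\<close>, and \<open>u\<close> and \<open>w\<close> form a SIL with
  \<open>v\<close>.\<close>

lemma conn_if_no_sil:
  assumes no: "\<And>x1 x2 z. \<not> sil x1 x2 z"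
    and u: "u \<in> V" "w \<in> V" "u \<noteq> w" "\<not> adj u w" and v: "v \<in> V" "v \<notin> st u" "v \<notin> st w"
  shows "conn u v w \<or> conn w v u"
proof (rule ccontr)
  assume neg: "\<not> ?thesis"
  have mem: "x \<in> st y \<longleftrightarrow> x = y \<or> adj y x" if "x \<in> V" for x y using that by (auto simp: st_def nb_def)
  define C where "C = {c. conn u v c \<and> conn w v c}"
  have C: "c \<in> V - st u" "c \<in> V - st w" if "c \<in> C" for c
    using that v conn_outside by (auto simp: C_def)
  have vC: "v \<in> C" by (simp add: C_def conn_def)
  have cl: "x \<in> C" if c: "c \<in> C" and x: "x \<in> V" "adj c x" "\<not> (adj u x \<and> adj w x)" for c x
  proof -
    have 1: "x \<notin> st a"
      if ab: "a \<in> V" "b \<in> V" "a \<noteq> b" "\<not> adj a b" "conn b v c" "c \<in> V - st a" "c \<in> V - st b" "\<not> conn b v a"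
        "\<not> (adj a x \<and> adj b x)" for a b
    proof
      assume "x \<in> st a"
      moreover have "x \<noteq> a" using ab c x mem[of c a] adj_sym by auto
      ultimately have ax: "adj a x" using mem x by auto
      then have "x \<in> V - st b" using ab x mem[of x b] by auto
      then have "conn b v x" using conn_step ab x by blast
      moreover have "a \<in> V - st b" using ab mem[of a b] adj_sym by auto
      ultimately have "conn b v a" using conn_step \<open>x \<in> V - st b\<close> adj_sym[OF ax] by blast
      then show False using ab by blast
    qed
    have "x \<notin> st u" using 1[of u w] u C[OF c] c neg x by (auto simp: C_def)
    moreover have "x \<notin> st w" using 1[of w u] u C[OF c] c neg x adj_sym by (auto simp: C_def)
    ultimately show ?thesis using c x C[OF c] conn_step by (auto simp: C_def)
  qed
  have "sil u w v" unfolding sil_def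
  proof (intro conjI exI[of _ C] ballI impI)
    show "u \<notin> C" "w \<notin> C" "C \<subseteq> V" using C by (auto simp: st_def)
    show "\<not> (adj u c \<and> adj w c)" if "c \<in> C" for c using C[OF that] mem by auto
    show "x \<in> C" if "c \<in> C" "x \<in> V" "adj c x" "\<not> (adj u x \<and> adj w x)" for c x using cl that by blast
  qed (use u vC in auto)
  then show False using no by blast
qed

text \<open>One element of \<open>G u\<close> for each component outside \<open>st u\<close>, hence
  a product of partial conjugations with the acting vertex \<open>u\<close>. Extensionality keeps
  the set of these data finite.\<close>

definition adm :: "'v \<Rightarrow> ('v \<Rightarrow> 'a) \<Rightarrow> bool" where
  "adm u a \<longleftrightarrow> a \<in> V \<rightarrow>\<^sub>E carrier (G u) \<and> (\<forall>v\<in>V. v \<in> st u \<longrightarrow> a v = \<one>\<^bsub>G u\<^esub>) \<and>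
    (\<forall>v\<in>V - st u. \<forall>v'\<in>V - st u. adj v v' \<longrightarrow> a v = a v')"

lemma adm_closed: "\<lbrakk>adm u a; v \<in> V\<rbrakk> \<Longrightarrow> a v \<in> carrier (G u)"
  by (auto simp: adm_def)

lemma adm_st: "\<lbrakk>adm u a; v \<in> V; v \<in> st u\<rbrakk> \<Longrightarrow> a v = \<one>\<^bsub>G u\<^esub>"
  by (auto simp: adm_def)

lemma finite_adm: "u \<in> V \<Longrightarrow> finite {a. adm u a}"
  by (rule finite_subset[OF _ finite_PiE[OF finite_V, of "\<lambda>_. carrier (G u)"]]) (use finite_G in \<open>auto simp: adm_def\<close>)

lemma adm_conn:
  assumes "adm u a" "conn u v v'"
  shows "a v = a v'"
  using assms(2) unfolding conn_def
  by (induction rule: rtranclp_induct) (use assms(1) in \<open>auto simp: adm_def\<close>)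

lemma adm_inv: "\<lbrakk>adm u a; u \<in> V\<rbrakk> \<Longrightarrow> adm u (\<lambda>v\<in>V. inv\<^bsub>G u\<^esub> a v)"
  using adm_closed[of u a] by (auto simp: adm_def)

definition pconj0 :: "'v \<Rightarrow> ('v \<Rightarrow> 'a) \<Rightarrow> 'h \<Rightarrow> 'h" where
  "pconj0 u a = lift H (\<lambda>v g. \<iota> u (a v) \<otimes> \<iota> v g \<otimes> inv (\<iota> u (a v)))"

definition pconj :: "'v \<Rightarrow> ('v \<Rightarrow> 'a) \<Rightarrow> 'h \<Rightarrow> 'h" where
  "pconj u a = restrict (pconj0 u a) (carrier H)"

lemma pconj0:
  assumes a: "adm u a" and u: "u \<in> V"
  shows pconj0_hom: "pconj0 u a \<in> hom H H"
    and pconj0_iota: "\<And>v g. \<lbrakk>v \<in> V; g \<in> carrier (G v)\<rbrakk>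
      \<Longrightarrow> pconj0 u a (\<iota> v g) = \<iota> u (a v) \<otimes> \<iota> v g \<otimes> inv (\<iota> u (a v))"
proof -
  have ac: "\<iota> u (a v) \<in> carrier H" if "v \<in> V" for v using adm_closed[OF a that] u by simp
  have 1: "(\<lambda>g. \<iota> u (a v) \<otimes> \<iota> v g \<otimes> inv (\<iota> u (a v))) \<in> hom (G v) H" if "v \<in> V" for v
    using that ac[OF that] by (auto intro!: homI simp: iota_mult m_assoc)
  have fix_st: "\<iota> u b \<otimes> \<iota> v g \<otimes> inv (\<iota> u b) = \<iota> v g"
    if "v \<in> V" "v \<in> st u" "g \<in> carrier (G v)" "b \<in> carrier (G u)" for v g b
    using par_st_comm[of "\<iota> v g" u b] that u by (simp add: m_assoc flip: par_st_comm)
  have com: "(k \<otimes> x \<otimes> inv k) \<otimes> (k \<otimes> y \<otimes> inv k) = (k \<otimes> y \<otimes> inv k) \<otimes> (k \<otimes> x \<otimes> inv k)"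
    if "k \<in> carrier H" "x \<in> carrier H" "y \<in> carrier H" "x \<otimes> y = y \<otimes> x" for k x y
  proof -
    have "(k \<otimes> x \<otimes> inv k) \<otimes> (k \<otimes> y \<otimes> inv k) = k \<otimes> (x \<otimes> y) \<otimes> inv k" using that(1-3) by (simp add: m_assoc)
    also have "\<dots> = (k \<otimes> y \<otimes> inv k) \<otimes> (k \<otimes> x \<otimes> inv k)" unfolding that(4) using that(1-3) by (simp add: m_assoc)
    finally show ?thesis .
  qed
  let ?f = "\<lambda>v g. \<iota> u (a v) \<otimes> \<iota> v g \<otimes> inv (\<iota> u (a v))"
  have 2: "?f v g \<otimes> ?f v' g' = ?f v' g' \<otimes> ?f v g"
    if v: "v \<in> V" "v' \<in> V" "adj v v'" "g \<in> carrier (G v)" "g' \<in> carrier (G v')" for v v' g g'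
  proof -
    \<comment> \<open>Adjacent vertices can be conjugated by a common element: either both lie
      outside \<open>st u\<close>, and then \<open>a\<close> agrees on them, or one lies in
      \<open>st u\<close> and is fixed by conjugation with every element of
      \<open>G u\<close>.\<close>
    have "\<exists>b\<in>carrier (G u). ?f v g = \<iota> u b \<otimes> \<iota> v g \<otimes> inv (\<iota> u b) \<and> ?f v' g' = \<iota> u b \<otimes> \<iota> v' g' \<otimes> inv (\<iota> u b)"
    proof (cases "v \<in> st u")
      case True
      then show ?thesis using v a adm_closed[OF a] u fix_st[of v g] by (intro bexI[of _ "a v'"]) auto
    next
      case False
      then show ?thesis
      proof (cases "v' \<in> st u")
        case True
        then show ?thesis using v a adm_closed[OF a] u fix_st[of v' g'] by (intro bexI[of _ "a v"]) auto
      next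
        case F2: False
        then have "a v = a v'" using v a False by (auto simp: adm_def)
        then show ?thesis using adm_closed[OF a] v by auto
      qed
    qed
    then obtain b where b: "b \<in> carrier (G u)" "?f v g = \<iota> u b \<otimes> \<iota> v g \<otimes> inv (\<iota> u b)"
      "?f v' g' = \<iota> u b \<otimes> \<iota> v' g' \<otimes> inv (\<iota> u b)" by blast
    show ?thesis unfolding b(2,3) by (rule com) (use b v u iota_comm in auto)
  qed
  show "pconj0 u a \<in> hom H H" unfolding pconj0_def by (rule lift_hom[OF is_group 1 2])
  show "pconj0 u a (\<iota> v g) = ?f v g" if "v \<in> V" "g \<in> carrier (G v)" for v g
    unfolding pconj0_def by (rule lift_iota[OF is_group 1 2 that])
qed

lemma pconj0_inverse:
  assumes a: "adm u a" and b: "adm u b" and u: "u \<in> V"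
    and ab: "\<And>v. v \<in> V \<Longrightarrow> a v \<otimes>\<^bsub>G u\<^esub> b v = \<one>\<^bsub>G u\<^esub>" and x: "x \<in> carrier H"
  shows "pconj0 u b (pconj0 u a x) = x"
proof -
  have c: "pconj0 u a \<in> hom H H" "pconj0 u b \<in> hom H H" using pconj0_hom a b u by auto
  interpret B: group_hom H H "pconj0 u b" using c is_group by (simp add: group_hom_def group_hom_axioms_def)
  have hc: "(\<lambda>x. pconj0 u b (pconj0 u a x)) \<in> hom H H" 
    by (auto intro!: homI simp: hom_mult[OF c(1)] hom_mult[OF c(2)] hom_in_carrier[OF c(1)] hom_in_carrier[OF c(2)])
  have hi: "(\<lambda>x. x) \<in> hom H H" by (auto intro: homI)
  show ?thesis
  proof (rule hom_ext[OF is_group hc hi _ x])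
    fix v g assume v: "v \<in> V" "g \<in> carrier (G v)"
    have fu: "pconj0 u b (\<iota> u s) = \<iota> u s" if "s \<in> carrier (G u)" for s
      using pconj0_iota[OF b u u that] adm_st[OF b u] u that by (simp add: st_def)
    have cl: "a v \<in> carrier (G u)" "b v \<in> carrier (G u)" using adm_closed a b v by auto
    have 1: "\<iota> u (a v) \<otimes> \<iota> u (b v) = \<one>" using ab[OF v(1)] cl u by (simp flip: iota_mult)
    have 2: "\<iota> u (b v) = inv (\<iota> u (a v))"
      using inv_equality[OF 1] cl u by (metis inv_inv iota_closed)
    show "pconj0 u b (pconj0 u a (\<iota> v g)) = \<iota> v g"
      using v cl u fu[OF cl(1)] pconj0_iota[OF b u v] by (simp add: pconj0_iota[OF a u v]) (simp add: 2 m_assoc)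
  qed
qed

lemma pconj_auto:
  assumes "adm u a" "u \<in> V"
  shows "pconj u a \<in> auto H"
proof -
  define b where "b = (\<lambda>v\<in>V. inv\<^bsub>G u\<^esub> a v)"
  have b: "adm u b" unfolding b_def by (rule adm_inv[OF assms])
  have m: "\<And>v. v \<in> V \<Longrightarrow> a v \<otimes>\<^bsub>G u\<^esub> b v = \<one>\<^bsub>G u\<^esub>" "\<And>v. v \<in> V \<Longrightarrow> b v \<otimes>\<^bsub>G u\<^esub> a v = \<one>\<^bsub>G u\<^esub>"
    using adm_closed[OF assms(1)] assms(2) by (auto simp: b_def)
  show ?thesis unfolding pconj_def
    by (rule autoI[of _ "pconj0 u b"])
      (use pconj0_hom[OF assms] pconj0_hom[OF b assms(2)] pconj0_inverse[OF assms(1) b assms(2) m(1)]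
        pconj0_inverse[OF b assms(1,2) m(2)] in \<open>auto simp: hom_def\<close>)
qed

lemma pconj_iota: "\<lbrakk>adm u a; u \<in> V; v \<in> V; g \<in> carrier (G v)\<rbrakk>
    \<Longrightarrow> pconj u a (\<iota> v g) = \<iota> u (a v) \<otimes> \<iota> v g \<otimes> inv (\<iota> u (a v))"
  by (simp add: pconj_def pconj0_iota)

section \<open>Conjugating automorphisms and their finite index\<close>

definition conj_auto :: "('h \<Rightarrow> 'h) set" where
  "conj_auto = {\<phi> \<in> auto H. \<forall>v\<in>V. \<forall>a\<in>carrier (G v). \<exists>k\<in>carrier H. \<phi> (\<iota> v a) = k \<otimes> \<iota> v a \<otimes> inv k}"

lemma conj_auto_endo:
  assumes "\<phi> \<in> conj_auto"
  shows "\<exists>h. conj_endo V adj G H \<iota> \<phi> h"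
  using assms by (intro conj_endoI) (auto simp: conj_auto_def auto_def)

text \<open>An automorphism sends each \<open>\<iota> v a\<close> into one of finitely many torsion
  classes. If \<open>d\<close> and \<open>\<phi>\<close> choose the same classes, then
  \<open>ainv d \<bullet> \<phi>\<close> preserves the class of every
  \<open>\<iota> v a\<close>.\<close>

lemma conj_auto_finite_index:
  "\<exists>D. finite D \<and> D \<subseteq> auto H \<and> (\<forall>\<phi>\<in>auto H. \<exists>d\<in>D. ainv d \<bullet> \<phi> \<in> conj_auto)"
proof -
  interpret A: group "AutoGroup H" by (rule AutoGroup)
  let ?S = "SIGMA v:V. carrier (G v)"
  define P where "P \<phi> v a c \<longleftrightarrow> clique_elt c \<and> (\<exists>k\<in>carrier H. \<phi> (\<iota> v a) = k \<otimes> c \<otimes> inv k)" for \<phi> v a c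
  define f where "f \<phi> = (\<lambda>(v, a)\<in>?S. SOME c. P \<phi> v a c)" for \<phi>
  have Pf: "P \<phi> v a (f \<phi> (v, a))" if A: "\<phi> \<in> auto H" "v \<in> V" "a \<in> carrier (G v)" for \<phi> v a
  proof -
    have hom: "\<phi> \<in> hom H H" using that by (simp add: auto_def)
    obtain n :: nat where n: "n > 0" "\<iota> v a [^] n = \<one>" using torsion_iota[OF A(2,3)] by (auto simp: torsion_def)
    have "\<phi> (\<iota> v a) [^] n = \<one>"
      using group_hom.hom_nat_pow[of H H \<phi> "\<iota> v a" n] hom n that hom_one[OF hom is_group is_group] is_group
      by (simp add: group_hom_def group_hom_axioms_def)
    then have "torsion (\<phi> (\<iota> v a))" using n that hom_in_carrier[OF hom] by (auto simp: torsion_def)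
    then have "\<exists>c. P \<phi> v a c" using torsion_conj_clique unfolding P_def by blast
    then show ?thesis using that by (simp add: f_def someI_ex)
  qed
  have "f ` auto H \<subseteq> ?S \<rightarrow>\<^sub>E {c. clique_elt c}"
  proof
    fix F assume "F \<in> f ` auto H"
    then obtain \<phi> where "\<phi> \<in> auto H" "F = f \<phi>" by blast
    then show "F \<in> ?S \<rightarrow>\<^sub>E {c. clique_elt c}"
      using Pf[of \<phi>] by (intro PiE_I) (auto simp: P_def, auto simp: f_def split: if_splits)
  qed
  moreover have "finite (?S \<rightarrow>\<^sub>E {c. clique_elt c})"
    by (rule finite_PiE) (use finite_V finite_G finite_clique_elts in auto)
  ultimately have "finite (f ` auto H)" by (rule finite_subset)
  then obtain D where D: "finite D" "D \<subseteq> auto H" "\<And>\<phi>. \<phi> \<in> auto H \<Longrightarrow> \<exists>d\<in>D. f d = f \<phi>"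
    using finite_image_reps by metis
  have "ainv d \<bullet> \<phi> \<in> conj_auto"
    if d: "d \<in> auto H" "\<phi> \<in> auto H" "f d = f \<phi>" for d \<phi>
  proof -
    define e where "e = ainv d"
    have e: "e \<in> auto H" using d A.inv_closed[of d] by (simp add: carrier_AutoGroup e_def)
    have eh: "e \<in> hom H H" using e by (simp add: auto_def)
    interpret E: group_hom H H e using eh is_group by (simp add: group_hom_def group_hom_axioms_def)
    have "e \<bullet> \<phi> \<in> auto H"
      using A.m_closed[of e \<phi>] e d by (simp add: carrier_AutoGroup)
    moreover have "\<exists>k\<in>carrier H. (e \<bullet> \<phi>) (\<iota> v a) = k \<otimes> \<iota> v a \<otimes> inv k"
      if v: "v \<in> V" "a \<in> carrier (G v)" for v a
    proof -
      let ?c = "f d (v, a)"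
      have c: "?c \<in> carrier H" using Pf[OF d(1) v] by (simp add: P_def clique_elt_def)
      obtain k where k: "k \<in> carrier H" "d (\<iota> v a) = k \<otimes> ?c \<otimes> inv k" using Pf[OF d(1) v] by (auto simp: P_def)
      obtain l where l: "l \<in> carrier H" "\<phi> (\<iota> v a) = l \<otimes> ?c \<otimes> inv l" using Pf[OF d(2) v] d(3) by (auto simp: P_def)
      have "\<phi> (\<iota> v a) = (l \<otimes> inv k) \<otimes> d (\<iota> v a) \<otimes> inv (l \<otimes> inv k)"
        using k l c by (simp add: inv_mult_group m_assoc)
      moreover have "d (\<iota> v a) \<in> carrier H" using k c by simp
      ultimately have "e (\<phi> (\<iota> v a)) = e (l \<otimes> inv k) \<otimes> \<iota> v a \<otimes> inv (e (l \<otimes> inv k))"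
        using AutoGroup_inv_apply(1)[OF d(1), of "\<iota> v a"] k l v by (simp add: e_def[symmetric])
      then show ?thesis using AutoGroup_apply[OF e d(2), of "\<iota> v a"] k l v
        by (intro bexI[of _ "e (l \<otimes> inv k)"]) auto
    qed
    ultimately show ?thesis by (auto simp: conj_auto_def e_def)
  qed
  then show ?thesis using D by (metis subsetD)
qed

end

context conj_endo
begin

lemma phi_inv: "x \<in> carrier H \<Longrightarrow> \<phi> (inv x) = inv (\<phi> x)"
  using group_hom.hom_inv[of H H \<phi> x] phi_hom by (simp add: group_hom_def group_hom_axioms_def)

lemma kappa_conn:
  assumes "u \<in> V" "v \<in> V - st u" "conn u v v'"
  shows "\<kappa> u (h v) = \<kappa> u (h v')"
  using assms(3) unfolding conn_def
proof (induction rule: rtranclp_induct)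
  case (step y z)
  then show ?case using kappa_adjacent[of u y z] assms(1) by (auto simp: st_def nb_def)
qed simp

lemma conj_endo_pconj:
  assumes "adm u a" "u \<in> V" "\<psi> \<in> hom H H" "\<And>x. x \<in> carrier H \<Longrightarrow> \<psi> x = \<phi> (pconj u a x)"
  shows "conj_endo V adj G H \<iota> \<psi> (\<lambda>v. \<phi> (\<iota> u (a v)) \<otimes> h v)"
proof (intro conj_endo.intro graph_group_axioms conj_endo_axioms.intro assms(3))
  fix v assume v: "v \<in> V"
  show "\<phi> (\<iota> u (a v)) \<otimes> h v \<in> carrier H" using adm_closed[OF assms(1) v] assms(2) v by simp
  fix g assume g: "g \<in> carrier (G v)"
  show "\<psi> (\<iota> v g) = \<phi> (\<iota> u (a v)) \<otimes> h v \<otimes> \<iota> v g \<otimes> inv (\<phi> (\<iota> u (a v)) \<otimes> h v)"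
    using adm_closed[OF assms(1) v] assms v g
    by (simp add: pconj_iota phi_mult phi_inv phi_iota[of v] inv_mult_group m_assoc)
qed

text \<open>The only danger is that \<open>v\<close> and \<open>w\<close> are conjugated by
  different elements of \<open>G u\<close>. Away from the stars, \<open>conn_if_no_sil\<close> then
  joins \<open>v\<close> to \<open>u\<close> outside \<open>st w\<close>, so for the wall of
  \<open>w\<close> the vertex \<open>v\<close> may be replaced by \<open>u\<close>, where the change
  is a move along the wall of \<open>u\<close> itself.\<close>

lemma pconj_preserves:
  assumes no: "\<And>x1 x2 z. \<not> sil x1 x2 z"
    and a: "adm u a" and u: "u \<in> V" and psi: "\<psi> \<in> hom H H" "\<And>x. x \<in> carrier H \<Longrightarrow> \<psi> x = \<phi> (pconj u a x)"
    and w: "w \<in> V" "w \<noteq> u" and v: "v \<in> V - st w"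
  defines "h' \<equiv> \<lambda>v. \<phi> (\<iota> u (a v)) \<otimes> h v"
  shows "\<delta> w (inv (h' w) \<otimes> h' v) = \<kappa> w (h v)"
proof -
  interpret C: conj_endo V adj G H \<iota> \<psi> h' unfolding h'_def by (rule conj_endo_pconj[OF a u psi])
  have ac: "a v \<in> carrier (G u)" if "v \<in> V" for v using adm_closed[OF a that] .
  have ast: "h' x = h x" if "x \<in> V" "x \<in> st u" for x
    using adm_st[OF a that] that u by (simp add: h'_def)
  show ?thesis
  proof (cases "adj u w")
    case True
    then have "h' w = h w" using ast w by (simp add: st_def nb_def)
    then show ?thesis using kappa_phi_adj[of u w "a v" "h v"] True u w v ac by (simp add: \<kappa>_def h'_def)
  next
    case False
    have wu: "\<not> adj w u" using False adj_sym by blast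
    have in_st: "\<delta> w (inv (h' w) \<otimes> h' x) = \<kappa> w (h x)" if x: "x \<in> V - st w" "x \<in> st u" for x
    proof -
      define k where "k = \<iota> u (inv\<^bsub>G u\<^esub> a w)"
      have k: "k \<in> carrier H" "\<phi> k = inv (\<phi> (\<iota> u (a w)))" using u w ac by (auto simp: k_def phi_inv iota_inv)
      \<comment> \<open>\<open>\<phi> k\<close> is the factor that the new \<open>h' w\<close>
        contributes in front of \<open>h x\<close>. Carried past \<open>h x\<close> it becomes an
        element of \<open>par (st x)\<close>, a path along the wall of \<open>x\<close>.\<close>
      define t where "t = inv (h x) \<otimes> \<phi> k \<otimes> h x"
      have t: "t \<in> par (st x)"
      proof (cases "x = u")
        case True
        then have "t = k" using u w ac by (simp add: t_def k_def phi_iota m_assoc)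
        then show ?thesis using True u w ac by (auto simp: k_def st_def intro!: par_iota)
      next
        case False
        then have "t \<in> par (nb x)" using phi_adj[of u x "inv\<^bsub>G u\<^esub> a w"] x u w ac by (auto simp: t_def k_def st_def nb_def)
        then show ?thesis using par_mono[of "nb x" "st x"] by (auto simp: st_def)
      qed
      have tc: "t \<in> carrier H" using k x u w ac by (simp add: t_def)
      have "inv (h' w) \<otimes> h' x = inv (h w) \<otimes> (h x \<otimes> t)"
        using ast[of x] x w u k ac by (simp add: h'_def inv_mult_group t_def m_assoc)
      moreover have "w \<noteq> x" "\<not> adj w x" using x by (auto simp: st_def nb_def)
      ultimately show ?thesis using kappa_mult_par[OF t, of w "h x"] w x by (simp add: \<kappa>_def)
    qed
    show ?thesis
    proof (cases "v \<in> st u")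
      case True
      then show ?thesis using in_st v by simp
    next
      case F: False
      have ust: "u \<in> V - st w" using u w wu by (auto simp: st_def nb_def)
      consider "conn u v w" | "conn w v u" using conn_if_no_sil[OF no u w(1) _ False, of v] v F w by auto
      then show ?thesis
      proof cases
        case 1
        then have "a v = a w" using adm_conn[OF a] by blast
        then have "inv (h' w) \<otimes> h' v = inv (h w) \<otimes> h v"
          using u w v ac[of w] by (simp add: h'_def inv_mult_group m_assoc)
        then show ?thesis by (simp add: \<kappa>_def)
      next
        case 2
        have "\<delta> w (inv (h' w) \<otimes> h' v) = \<delta> w (inv (h' w) \<otimes> h' u)"
          using C.kappa_conn[OF w(1) v 2] by (simp add: C.\<kappa>_def)
        also have "\<dots> = \<kappa> w (h u)" using in_st[of u] ust by (simp add: st_def)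
        also have "\<dots> = \<kappa> w (h v)" using kappa_conn[OF w(1) v 2] by simp
        finally show ?thesis .
      qed
    qed
  qed
qed

lemma ex_pconj_normalizing:
  assumes u: "u \<in> V"
  shows "\<exists>a. adm u a \<and> (\<forall>v\<in>V - st u. \<kappa> u (\<phi> (\<iota> u (a v)) \<otimes> h v) = \<one>\<^bsub>G u\<^esub>)"
proof -
  \<comment> \<open>By \<open>kappa_phi_same\<close> the factor
    \<open>\<phi> (\<iota> u (a v))\<close> multiplies the label by \<open>a v\<close>, which
    dictates the inverse; \<open>kappa_adjacent\<close> makes the choice constant on
    components.\<close>
  define a where "a = (\<lambda>v\<in>V. if v \<in> st u then \<one>\<^bsub>G u\<^esub> else inv\<^bsub>G u\<^esub> \<kappa> u (h v))"
  have "adm u a" unfolding adm_def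
  proof (intro conjI ballI impI)
    fix v v' assume "v \<in> V - st u" "v' \<in> V - st u" "adj v v'"
    then show "a v = a v'" using kappa_adjacent[of u v v'] u by (auto simp: a_def st_def nb_def)
  qed (use u in \<open>auto simp: a_def\<close>)
  moreover have "\<kappa> u (\<phi> (\<iota> u (a v)) \<otimes> h v) = \<one>\<^bsub>G u\<^esub>" if "v \<in> V - st u" for v
    using that u by (simp add: kappa_phi_same a_def)
  ultimately show ?thesis by blast
qed

text \<open>Which wing is called \<open>\<one>\<close> is a matter of labelling:
  \<open>h w \<otimes> \<iota> w (k w)\<close> conjugates the abelian group \<open>G w\<close> as
  \<open>h w\<close> does and gives the common wing the label \<open>\<one>\<close>.\<close>

lemma inner_if_constant:
  assumes const: "\<And>w. w \<in> V \<Longrightarrow> \<exists>k. \<forall>v\<in>V - st w. \<kappa> w (h v) = k"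
    and surj: "carrier H \<subseteq> \<phi> ` carrier H"
  shows "\<exists>y\<in>carrier H. \<forall>x\<in>carrier H. \<phi> x = y \<otimes> x \<otimes> inv y"
proof -
  have "\<exists>k\<in>carrier (G w). \<forall>v\<in>V - st w. \<kappa> w (h v) = k" if w: "w \<in> V" for w
  proof (cases "V - st w = {}")
    case True
    then show ?thesis using w by (intro bexI[of _ "\<one>\<^bsub>G w\<^esub>"]) auto
  next
    case False
    then obtain v where "v \<in> V - st w" by blast
    then show ?thesis using const[OF w] w by (intro bexI[of _ "\<kappa> w (h v)"]) auto
  qed
  then have "\<forall>w\<in>V. \<exists>k. k \<in> carrier (G w) \<and> (\<forall>v\<in>V - st w. \<kappa> w (h v) = k)" by blast
  from bchoice[OF this] obtain k where
    k: "\<And>w. w \<in> V \<Longrightarrow> k w \<in> carrier (G w)" "\<And>w v. \<lbrakk>w \<in> V; v \<in> V - st w\<rbrakk> \<Longrightarrow> \<kappa> w (h v) = k w" by blast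
  define h' where "h' v = h v \<otimes> \<iota> v (k v)" for v
  interpret C: conj_endo V adj G H \<iota> \<phi> h'
  proof (intro conj_endo.intro graph_group_axioms conj_endo_axioms.intro phi_hom)
    fix v assume v: "v \<in> V"
    show "h' v \<in> carrier H" using v k by (simp add: h'_def)
    fix a assume a: "a \<in> carrier (G v)"
    have "\<iota> v (k v) \<otimes> \<iota> v a = \<iota> v a \<otimes> \<iota> v (k v)"
      using par_st_comm[of "\<iota> v (k v)" v a] v a k by (simp add: st_def)
    then have "\<iota> v (k v) \<otimes> \<iota> v a \<otimes> inv (\<iota> v (k v)) = \<iota> v a" using v a k by (simp add: m_assoc)
    moreover have "h' v \<otimes> \<iota> v a \<otimes> inv (h' v) = h v \<otimes> (\<iota> v (k v) \<otimes> \<iota> v a \<otimes> inv (\<iota> v (k v))) \<otimes> inv (h v)"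
      using v a k(1)[OF v] by (simp add: h'_def inv_mult_group m_assoc)
    ultimately show "\<phi> (\<iota> v a) = h' v \<otimes> \<iota> v a \<otimes> inv (h' v)" using v a by (simp add: phi_iota)
  qed
  show ?thesis
  proof (rule C.inner_if_normalized[OF _ surj])
    fix u v assume uv: "u \<in> V" "v \<in> V" "u \<noteq> v" "\<not> adj u v"
    have "C.\<kappa> u (h' v) = inv\<^bsub>G u\<^esub> k u \<otimes>\<^bsub>G u\<^esub> \<kappa> u (h v \<otimes> \<iota> v (k v))"
    proof -
      have "inv (h' u) \<otimes> h' v = \<iota> u (inv\<^bsub>G u\<^esub> k u) \<otimes> (inv (h u) \<otimes> (h v \<otimes> \<iota> v (k v)))"
        using uv k(1) by (simp add: h'_def inv_mult_group m_assoc iota_inv)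
      then show ?thesis using uv k(1) by (simp add: C.\<kappa>_def \<kappa>_def delta_iota_mult)
    qed
    also have "\<kappa> u (h v \<otimes> \<iota> v (k v)) = \<kappa> u (h v)"
      using uv k(1) by (intro kappa_mult_par[of _ v]) (auto simp: st_def intro!: par_iota)
    also have "\<dots> = k u" using uv k(2)[of u v] by (auto simp: st_def nb_def)
    finally show "C.\<kappa> u (h' v) = \<one>\<^bsub>G u\<^esub>" using uv k(1) by simp
  qed
qed

end

context graph_group
begin

section \<open>Finitely many representatives of outer automorphisms\<close>

primrec pconj_prods :: "'v list \<Rightarrow> ('h \<Rightarrow> 'h) set" where
  "pconj_prods [] = {aone}"
| "pconj_prods (u # us) = (\<lambda>(\<beta>, a). \<beta> \<bullet> pconj u a) ` (pconj_prods us \<times> {a. adm u a})"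

lemma finite_pconj_prods: "set us \<subseteq> V \<Longrightarrow> finite (pconj_prods us)"
  by (induction us) (auto intro: finite_adm)

lemma pconj_prods_auto: "set us \<subseteq> V \<Longrightarrow> pconj_prods us \<subseteq> auto H"
proof (induction us)
  case Nil
  interpret A: group "AutoGroup H" by (rule AutoGroup)
  show ?case using A.one_closed by (simp add: carrier_AutoGroup)
next
  case (Cons u us)
  interpret A: group "AutoGroup H" by (rule AutoGroup)
  show ?case using Cons A.m_closed pconj_auto by (auto simp: carrier_AutoGroup)
qed

text \<open>One partial conjugation per vertex suffices, because by \<open>pconj_preserves\<close>
  the adjustment for \<open>u\<close> leaves the labels for the vertices already treated
  unchanged.\<close>

lemma pconj_prods_constant:
  assumes no: "\<And>x1 x2 z. \<not> sil x1 x2 z" and phi: "\<phi> \<in> conj_auto" and "set us \<subseteq> V"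
  shows "\<exists>\<beta>\<in>pconj_prods us. \<exists>h. conj_endo V adj G H \<iota> (\<phi> \<bullet> \<beta>) h \<and>
    (\<forall>w\<in>set us. \<exists>k. \<forall>v\<in>V - st w. \<delta> w (inv (h w) \<otimes> h v) = k)"
  using assms(3)
proof (induction us)
  case Nil
  interpret A: group "AutoGroup H" by (rule AutoGroup)
  have "\<phi> \<bullet> aone = \<phi>" using phi by (simp add: conj_auto_def carrier_AutoGroup)
  then show ?case using conj_auto_endo[OF phi] by simp
next
  case (Cons u us)
  interpret A: group "AutoGroup H" by (rule AutoGroup)
  obtain \<beta> h where b: "\<beta> \<in> pconj_prods us" "conj_endo V adj G H \<iota> (\<phi> \<bullet> \<beta>) h"
    and const: "\<And>w. w \<in> set us \<Longrightarrow> \<exists>k. \<forall>v\<in>V - st w. \<delta> w (inv (h w) \<otimes> h v) = k"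
    using Cons by auto
  interpret C: conj_endo V adj G H \<iota> "\<phi> \<bullet> \<beta>" h by (rule b)
  have u: "u \<in> V" using Cons.prems by simp
  obtain a where a: "adm u a" "\<And>v. v \<in> V - st u \<Longrightarrow> C.\<kappa> u ((\<phi> \<bullet> \<beta>) (\<iota> u (a v)) \<otimes> h v) = \<one>\<^bsub>G u\<^esub>"
    using C.ex_pconj_normalizing[OF u] by blast
  have au: "\<phi> \<in> auto H" "\<beta> \<in> auto H" "pconj u a \<in> auto H"
    using phi b pconj_prods_auto[of us] Cons.prems pconj_auto[OF a(1) u] by (auto simp: conj_auto_def)
  then have au2: "\<phi> \<bullet> \<beta> \<in> auto H" using A.m_closed[of \<phi> \<beta>] by (simp add: carrier_AutoGroup)
  define \<psi> where "\<psi> = \<phi> \<bullet> (\<beta> \<bullet> pconj u a)"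
  have psi: "\<psi> = (\<phi> \<bullet> \<beta>) \<bullet> pconj u a"
    using au by (simp add: \<psi>_def A.m_assoc carrier_AutoGroup)
  have psi_app: "\<psi> x = (\<phi> \<bullet> \<beta>) (pconj u a x)" if "x \<in> carrier H" for x
    unfolding psi using AutoGroup_apply[OF au2 au(3) that] .
  have psi_hom: "\<psi> \<in> hom H H"
    using A.m_closed[of "\<phi> \<bullet> \<beta>" "pconj u a"] au au2 by (auto simp: psi carrier_AutoGroup auto_def)
  define h' where "h' v = (\<phi> \<bullet> \<beta>) (\<iota> u (a v)) \<otimes> h v" for v
  have "conj_endo V adj G H \<iota> \<psi> h'"
    unfolding h'_def by (rule C.conj_endo_pconj[OF a(1) u psi_hom psi_app])
  moreover have "\<exists>k. \<forall>v\<in>V - st w. \<delta> w (inv (h' w) \<otimes> h' v) = k" if w: "w \<in> set (u # us)" for w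
  proof (cases "w = u")
    case True
    have "a u = \<one>\<^bsub>G u\<^esub>" using adm_st[OF a(1) u] by (simp add: st_def)
    then have "h' u = h u" using u by (simp add: h'_def)
    then show ?thesis using a(2) unfolding True by (auto simp: h'_def C.\<kappa>_def)
  next
    case False
    then have "w \<in> set us" "w \<in> V" using w Cons.prems by auto
    moreover from this have "\<delta> w (inv (h' w) \<otimes> h' v) = \<delta> w (inv (h w) \<otimes> h v)" if "v \<in> V - st w" for v
      using C.pconj_preserves[OF no a(1) u psi_hom psi_app _ False that] by (simp add: h'_def C.\<kappa>_def)
    ultimately show ?thesis using const by simp
  qed
  moreover have "\<beta> \<bullet> pconj u a \<in> pconj_prods (u # us)" using b a by auto
  ultimately show ?case unfolding \<psi>_def by blast
qed

theorem finite_Out_if_no_sil: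
  assumes no: "\<And>x1 x2 z. \<not> sil x1 x2 z"
  shows "finite (carrier (Out H))"
proof -
  interpret A: group "AutoGroup H" by (rule AutoGroup)
  interpret N: normal "Inn H" "AutoGroup H" by (rule Inn_normal[OF is_group])
  obtain us where us: "set us = V" using finite_list[OF finite_V] by blast
  let ?B = "pconj_prods us"
  have B: "finite ?B" "?B \<subseteq> auto H" using finite_pconj_prods pconj_prods_auto us by auto
  have inner: "\<exists>\<beta>\<in>?B. \<phi> \<bullet> \<beta> \<in> Inn H" if phi: "\<phi> \<in> conj_auto" for \<phi>
  proof -
    obtain \<beta> h where b: "\<beta> \<in> ?B" "conj_endo V adj G H \<iota> (\<phi> \<bullet> \<beta>) h"
      "\<And>w. w \<in> V \<Longrightarrow> \<exists>k. \<forall>v\<in>V - st w. \<delta> w (inv (h w) \<otimes> h v) = k"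
      using pconj_prods_constant[OF no phi, of us] us by auto
    let ?\<psi> = "\<phi> \<bullet> \<beta>"
    interpret C: conj_endo V adj G H \<iota> ?\<psi> h by (rule b)
    have au: "?\<psi> \<in> auto H" using A.m_closed[of \<phi> \<beta>] phi b B by (auto simp: carrier_AutoGroup conj_auto_def)
    then have "carrier H \<subseteq> ?\<psi> ` carrier H" by (auto simp: auto_def Bij_def bij_betw_def)
    then obtain y where y: "y \<in> carrier H" "\<And>x. x \<in> carrier H \<Longrightarrow> ?\<psi> x = y \<otimes> x \<otimes> inv y"
      using C.inner_if_constant b(3) unfolding C.\<kappa>_def by blast
    have "?\<psi> = (\<lambda>x\<in>carrier H. y \<otimes> x \<otimes> inv y)"
      by (rule extensionalityI[of _ "carrier H"]) (use au y in \<open>auto simp: auto_def Bij_def\<close>)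
    then have "?\<psi> \<in> Inn H" using y by (auto simp: Inn_def)
    then show ?thesis using b by blast
  qed
  obtain D where D: "finite D" "D \<subseteq> auto H"
    "\<And>\<phi>. \<phi> \<in> auto H \<Longrightarrow> \<exists>d\<in>D. ainv d \<bullet> \<phi> \<in> conj_auto"
    using conj_auto_finite_index by blast
  let ?f = "\<lambda>(d, \<beta>). Inn H #>\<^bsub>AutoGroup H\<^esub> (d \<bullet> ainv \<beta>)"
  have "carrier (Out H) \<subseteq> ?f ` (D \<times> ?B)"
  proof
    fix Y assume "Y \<in> carrier (Out H)"
    then obtain \<phi> where phi: "\<phi> \<in> auto H" "Y = Inn H #>\<^bsub>AutoGroup H\<^esub> \<phi>"
      by (auto simp: Out_def FactGroup_def RCOSETS_def carrier_AutoGroup)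
    obtain d where d: "d \<in> D" "ainv d \<bullet> \<phi> \<in> conj_auto" using D(3) phi by blast
    obtain \<beta> where b: "\<beta> \<in> ?B" "ainv d \<bullet> \<phi> \<bullet> \<beta> \<in> Inn H"
      using inner[OF d(2)] by blast
    let ?i = "ainv d \<bullet> \<phi> \<bullet> \<beta>"
    have c: "d \<in> carrier (AutoGroup H)" "\<beta> \<in> carrier (AutoGroup H)" "\<phi> \<in> carrier (AutoGroup H)"
      using d b D B phi by (auto simp: carrier_AutoGroup)
    \<comment> \<open>\<open>\<phi>\<close> is the product of \<open>d\<close>, the inner
      automorphism \<open>?i\<close> and \<open>ainv \<beta>\<close>. By normality the inner factor
      can be carried to the left of \<open>d\<close>, so the coset depends on \<open>d\<close> and
      \<open>\<beta>\<close> only.\<close>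
    have "d \<bullet> ?i \<bullet> ainv d \<in> Inn H"
      by (rule N.inv_op_closed2[OF c(1) b(2)])
    moreover have "\<phi> = (d \<bullet> ?i \<bullet> ainv d) \<bullet> (d \<bullet> ainv \<beta>)"
    proof -
      have "x \<bullet> (ainv x \<bullet> y) = y"
        "ainv x \<bullet> (x \<bullet> y) = y"
        if "x \<in> carrier (AutoGroup H)" "y \<in> carrier (AutoGroup H)" for x y
        using that by (simp_all flip: A.m_assoc)
      then show ?thesis using c by (simp add: A.m_assoc)
    qed
    ultimately have "\<phi> \<in> Inn H #>\<^bsub>AutoGroup H\<^esub> (d \<bullet> ainv \<beta>)"
      unfolding r_coset_def by blast
    then have "Y = ?f (d, \<beta>)"
      using A.repr_independence[OF _ _ N.subgroup_axioms] c phi(2) by simp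
    then show "Y \<in> ?f ` (D \<times> ?B)" using d b by blast
  qed
  then show ?thesis using finite_subset D B by blast
qed

end

section \<open>Property (T) and finite-index characters\<close>

context hilbert_space
begin

lemma hnorm_diff_sq:
  assumes "x \<in> carrier H" "y \<in> carrier H"
  shows "(hnorm H (x \<ominus> y))\<^sup>2 = (hnorm H x)\<^sup>2 + (hnorm H y)\<^sup>2 - 2 * Re (cinner H x y)"
proof -
  have "cinner H (x \<ominus> y) (x \<ominus> y) = cinner H x x + cinner H y y - cinner H x y - cnj (cinner H x y)"
    using assms cinner_commute[of x y] by (simp add: cinner_minus_left cinner_minus_right M.minus_closed)
  then have "Re (cinner H (x \<ominus> y) (x \<ominus> y)) = Re (cinner H x x) + Re (cinner H y y) - 2 * Re (cinner H x y)" by simp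
  moreover have "(hnorm H z)\<^sup>2 = Re (cinner H z z)" if "z \<in> carrier H" for z
    using cinner_nonneg[OF that] by (simp add: hnorm_def)
  ultimately show ?thesis using assms by (simp add: M.minus_closed)
qed

lemma cinner_finsum_left:
  assumes "finite I" "f \<in> I \<rightarrow> carrier H" "y \<in> carrier H"
  shows "cinner H (finsum H f I) y = (\<Sum>i\<in>I. cinner H (f i) y)"
  using assms(1,2)
  by (induction rule: finite_induct) (auto simp: cinner_zero_left cinner_add_left assms(3) M.finsum_closed Pi_def)

end

text \<open>The whole group with constant 1 is a Kazhdan pair: every translate of
  \<open>\<xi>\<close> is closer to \<open>\<xi>\<close> than \<open>hnorm H \<xi>\<close>, so its
  inner product with \<open>\<xi>\<close> has positive real part. The sum over all translates is
  therefore nonzero, and it is invariant.\<close>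

lemma property_T_finite:
  assumes "group G" "finite (carrier G)"
  shows "property_T G"
proof -
  interpret G: group G by fact
  have "kazhdan_pair TYPE('a \<Rightarrow> complex) G (carrier G) 1"
    unfolding kazhdan_pair_def
  proof (intro allI impI)
    fix H :: "('a \<Rightarrow> complex) hilbert" and \<pi>
    assume H: "hilbert_space H" and hom: "\<pi> \<in> hom G (unitary_group H)"
      and "\<exists>\<xi>\<in>carrier H. \<xi> \<noteq> \<zero>\<^bsub>H\<^esub> \<and> (\<forall>q\<in>carrier G. hnorm H (\<pi> q \<xi> \<ominus>\<^bsub>H\<^esub> \<xi>) < 1 * hnorm H \<xi>)"
    interpret hilbert_space H by (rule H)
    obtain \<xi> where \<xi>: "\<xi> \<in> carrier H" and ai: "\<And>q. q \<in> carrier G \<Longrightarrow> hnorm H (\<pi> q \<xi> \<ominus>\<^bsub>H\<^esub> \<xi>) < hnorm H \<xi>"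
      using \<open>\<exists>\<xi>\<in>_. _\<close> by auto
    have U: "\<pi> g \<in> unitary_operators H" if "g \<in> carrier G" for g
      using hom that by (auto simp: hom_def unitary_group_def)
    then have B: "\<pi> g \<in> Bij (carrier H)" if "g \<in> carrier G" for g
      using that by (simp add: unitary_operators_def)
    have cl: "\<pi> g x \<in> carrier H" if "g \<in> carrier G" "x \<in> carrier H" for g x
      using Bij_imp_funcset[OF B[OF that(1)]] that(2) by auto
    have mul: "\<pi> (g \<otimes>\<^bsub>G\<^esub> h) x = \<pi> g (\<pi> h x)"
      if "g \<in> carrier G" "h \<in> carrier G" "x \<in> carrier H" for g h x
      using hom_mult[OF hom that(1,2)] that B by (simp add: unitary_group_def BijGroup_def compose_def)
    have Uadd: "\<pi> g (x \<oplus>\<^bsub>H\<^esub> y) = \<pi> g x \<oplus>\<^bsub>H\<^esub> \<pi> g y"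
      if "g \<in> carrier G" "x \<in> carrier H" "y \<in> carrier H" for g x y
      using U[OF that(1)] that by (simp add: unitary_operators_def)
    have Uin: "cinner H (\<pi> g x) (\<pi> g y) = cinner H x y"
      if "g \<in> carrier G" "x \<in> carrier H" "y \<in> carrier H" for g x y
      using U[OF that(1)] that by (simp add: unitary_operators_def)
    have Uz: "\<pi> g \<zero>\<^bsub>H\<^esub> = \<zero>\<^bsub>H\<^esub>" if "g \<in> carrier G" for g
      using Uin[OF that M.zero_closed M.zero_closed] cl[OF that M.zero_closed]
      by (intro cinner_definite) (simp_all add: cinner_zero_left)
    have Usum: "\<pi> g (finsum H f I) = finsum H (\<lambda>i. \<pi> g (f i)) I"
      if "g \<in> carrier G" "finite I" "f \<in> I \<rightarrow> carrier H" for g I f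
      using that(2,3)
      by (induction rule: finite_induct) (use that(1) in \<open>auto simp: Uz Uadd cl M.finsum_closed Pi_def\<close>)
    define \<eta> where "\<eta> = finsum H (\<lambda>g. \<pi> g \<xi>) (carrier G)"
    have fc: "(\<lambda>g. \<pi> g \<xi>) \<in> carrier G \<rightarrow> carrier H" using cl \<xi> by auto
    have eta: "\<eta> \<in> carrier H" unfolding \<eta>_def by (rule M.finsum_closed[OF fc])
    have pos: "0 < Re (cinner H (\<pi> g \<xi>) \<xi>)" if g: "g \<in> carrier G" for g
    proof -
      have "(hnorm H (\<pi> g \<xi> \<ominus>\<^bsub>H\<^esub> \<xi>))\<^sup>2 < (hnorm H \<xi>)\<^sup>2"
        using ai[OF g] \<xi> cl[OF g \<xi>] by (intro power_strict_mono hnorm_nonneg) auto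
      moreover have "(hnorm H (\<pi> g \<xi>))\<^sup>2 = (hnorm H \<xi>)\<^sup>2" using Uin[OF g \<xi> \<xi>] by (simp add: hnorm_def)
      ultimately have "(hnorm H \<xi>)\<^sup>2 < 2 * Re (cinner H (\<pi> g \<xi>) \<xi>)"
        using hnorm_diff_sq[OF cl[OF g \<xi>] \<xi>] by simp
      then show ?thesis using zero_le_power2[of "hnorm H \<xi>"] by linarith
    qed
    have "Re (cinner H \<eta> \<xi>) = (\<Sum>g\<in>carrier G. Re (cinner H (\<pi> g \<xi>) \<xi>))"
      unfolding \<eta>_def cinner_finsum_left[OF assms(2) fc \<xi>] by simp
    moreover have "\<dots> > 0" by (rule sum_pos) (use assms(2) pos G.one_closed in auto)
    ultimately have "\<eta> \<noteq> \<zero>\<^bsub>H\<^esub>" using cinner_zero_left[OF \<xi>] by auto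
    moreover have "\<pi> h \<eta> = \<eta>" if h: "h \<in> carrier G" for h
    proof -
      have "\<pi> h \<eta> = finsum H (\<lambda>g. \<pi> (h \<otimes>\<^bsub>G\<^esub> g) \<xi>) (carrier G)"
        unfolding \<eta>_def Usum[OF h assms(2) fc] by (rule M.finsum_cong') (use h mul cl \<xi> in auto)
      also have "\<dots> = finsum H (\<lambda>g. \<pi> g \<xi>) ((\<lambda>g. h \<otimes>\<^bsub>G\<^esub> g) ` carrier G)"
        by (rule M.finsum_reindex[symmetric]) (use h cl \<xi> in \<open>auto simp: inj_on_def\<close>)
      also have "(\<lambda>g. h \<otimes>\<^bsub>G\<^esub> g) ` carrier G = carrier G" using G.surj_const_mult[OF h] .
      finally show ?thesis by (simp add: \<eta>_def)
    qed
    ultimately show "\<exists>\<eta>\<in>carrier H. \<eta> \<noteq> \<zero>\<^bsub>H\<^esub> \<and> (\<forall>g\<in>carrier G. \<pi> g \<eta> = \<eta>)" using eta by blast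
  qed
  then show ?thesis unfolding property_T_def using assms(2) by (intro exI[of _ "carrier G"] exI[of _ 1]) auto
qed

lemma cring_complex_field: "cring complex_field"
proof (rule cringI)
  show "abelian_group complex_field"
    by (rule abelian_groupI) (auto simp: complex_field_def intro: exI[of _ "- x" for x] ab_left_minus)
  show "comm_monoid complex_field"
    by (rule comm_monoidI) (auto simp: complex_field_def)
qed (auto simp: complex_field_def algebra_simps)

section \<open>Representations induced from a finite-index subgroup\<close>

locale finite_index_character = group G for G (structure) +
  fixes N :: "'a set" and \<tau> :: "'a \<Rightarrow> real"
  assumes subgroup_N: "subgroup N G"
    and finite_index: "\<exists>S. finite S \<and> S \<subseteq> carrier G \<and> (\<forall>x\<in>carrier G. \<exists>s\<in>S. inv s \<otimes> x \<in> N)"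
    and tau_mult: "\<lbrakk>m \<in> N; n \<in> N\<rbrakk> \<Longrightarrow> \<tau> (m \<otimes> n) = \<tau> m + \<tau> n"
begin

lemma N_closed [simp]: "n \<in> N \<Longrightarrow> n \<in> carrier G"
  using subgroup.mem_carrier[OF subgroup_N] .

lemma cancel [simp]:
  "\<lbrakk>x \<in> carrier G; y \<in> carrier G\<rbrakk> \<Longrightarrow> inv x \<otimes> (x \<otimes> y) = y"
  "\<lbrakk>x \<in> carrier G; y \<in> carrier G\<rbrakk> \<Longrightarrow> x \<otimes> (inv x \<otimes> y) = y"
  by (simp_all flip: m_assoc)

lemma tau_one: "\<tau> \<one> = 0"
  using tau_mult[of \<one> \<one>] subgroup.one_closed[OF subgroup_N] by simp

definition reps :: "'a set" where
  "reps = (SOME S. finite S \<and> S \<subseteq> carrier G \<and> (\<forall>x\<in>carrier G. \<exists>!s. s \<in> S \<and> inv s \<otimes> x \<in> N))"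

text \<open>The finite set given by \<open>finite_index\<close> may meet a coset several times;
  choosing one member for each coset thins it out to a transversal.\<close>

lemma reps: "finite reps" "reps \<subseteq> carrier G" "x \<in> carrier G \<Longrightarrow> \<exists>!s. s \<in> reps \<and> inv s \<otimes> x \<in> N"
proof -
  obtain S where S: "finite S" "S \<subseteq> carrier G" "\<And>x. x \<in> carrier G \<Longrightarrow> \<exists>s\<in>S. inv s \<otimes> x \<in> N"
    using finite_index by blast
  define f where "f x = (SOME s. s \<in> S \<and> inv s \<otimes> x \<in> N)" for x
  have f: "f x \<in> S \<and> inv (f x) \<otimes> x \<in> N" if "x \<in> carrier G" for x
    unfolding f_def by (rule someI_ex) (use S(3)[OF that] in blast)
  have eq: "inv s \<otimes> x \<in> N \<longleftrightarrow> inv s \<otimes> y \<in> N" if "s \<in> carrier G" "x \<in> carrier G" "y \<in> carrier G" "inv x \<otimes> y \<in> N" for s x y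
  proof
    assume "inv s \<otimes> x \<in> N"
    then have "inv s \<otimes> x \<otimes> (inv x \<otimes> y) \<in> N" using subgroup.m_closed[OF subgroup_N] that by blast
    then show "inv s \<otimes> y \<in> N" using that by (simp add: m_assoc)
  next
    assume "inv s \<otimes> y \<in> N"
    then have "inv s \<otimes> y \<otimes> inv (inv x \<otimes> y) \<in> N"
      using subgroup.m_closed[OF subgroup_N] subgroup.m_inv_closed[OF subgroup_N] that by blast
    then show "inv s \<otimes> x \<in> N" using that by (simp add: m_assoc inv_mult_group)
  qed
  have fc: "f x \<in> carrier G" if "x \<in> carrier G" for x using f[OF that] S by auto
  \<comment> \<open>Elements of the same coset have the same candidates, so \<open>SOME\<close>
    returns the same one.\<close>
  have feq: "f x = f y" if "x \<in> carrier G" "y \<in> carrier G" "inv x \<otimes> y \<in> N" for x y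
  proof -
    have "s \<in> S \<and> inv s \<otimes> x \<in> N \<longleftrightarrow> s \<in> S \<and> inv s \<otimes> y \<in> N" for s using eq[of s x y] that S(2) by blast
    then show ?thesis by (simp add: f_def)
  qed
  have "finite (f ` carrier G) \<and> f ` carrier G \<subseteq> carrier G \<and>
    (\<forall>x\<in>carrier G. \<exists>!s. s \<in> f ` carrier G \<and> inv s \<otimes> x \<in> N)"
  proof (intro conjI ballI)
    show "finite (f ` carrier G)" by (rule finite_subset[OF _ S(1)]) (use f in auto)
    show "f ` carrier G \<subseteq> carrier G" using fc by auto
    fix x assume x: "x \<in> carrier G"
    show "\<exists>!s. s \<in> f ` carrier G \<and> inv s \<otimes> x \<in> N"
    proof (rule ex1I[of _ "f x"])
      show "f x \<in> f ` carrier G \<and> inv (f x) \<otimes> x \<in> N" using f x by auto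
      fix s assume s: "s \<in> f ` carrier G \<and> inv s \<otimes> x \<in> N"
      then obtain y where y: "y \<in> carrier G" "s = f y" by blast
      have "f s = f y" using feq[of s y] f[OF y(1)] fc y by auto
      moreover have "f s = f x" using feq[of s x] s x fc y by auto
      ultimately show "s = f x" using y by simp
    qed
  qed
  then have "finite reps \<and> reps \<subseteq> carrier G \<and> (\<forall>x\<in>carrier G. \<exists>!s. s \<in> reps \<and> inv s \<otimes> x \<in> N)"
    unfolding reps_def by (rule someI)
  then show "finite reps" "reps \<subseteq> carrier G" "x \<in> carrier G \<Longrightarrow> \<exists>!s. s \<in> reps \<and> inv s \<otimes> x \<in> N" by auto
qed

definition rep :: "'a \<Rightarrow> 'a" where "rep x = (THE s. s \<in> reps \<and> inv s \<otimes> x \<in> N)"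

lemma rep: "x \<in> carrier G \<Longrightarrow> rep x \<in> reps" "x \<in> carrier G \<Longrightarrow> inv (rep x) \<otimes> x \<in> N"
  using theI'[OF reps(3), of x] by (auto simp: rep_def)

lemma rep_eqI: "\<lbrakk>x \<in> carrier G; s \<in> reps; inv s \<otimes> x \<in> N\<rbrakk> \<Longrightarrow> rep x = s"
  unfolding rep_def using reps(3)[of x] by blast

lemma reps_closed [simp]: "s \<in> reps \<Longrightarrow> s \<in> carrier G"
  using reps(2) by auto

lemma rep_self: "s \<in> reps \<Longrightarrow> rep s = s"
  using subgroup.one_closed[OF subgroup_N] by (intro rep_eqI) auto

lemma rep_mult_N: "\<lbrakk>x \<in> carrier G; n \<in> N\<rbrakk> \<Longrightarrow> rep (x \<otimes> n) = rep x"
  using rep[of x] subgroup.m_closed[OF subgroup_N, of "inv (rep x) \<otimes> x" n]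
  by (intro rep_eqI) (auto simp: m_assoc)

lemma reps_nonempty: "reps \<noteq> {}"
  using rep(1)[of \<one>] by auto

lemma rep_shift_bij:
  assumes h: "h \<in> carrier G"
  shows "bij_betw (\<lambda>s. rep (h \<otimes> s)) reps reps"
proof -
  have inj: "inj_on (\<lambda>s. rep (h \<otimes> s)) reps"
  proof (rule inj_onI)
    fix s t assume s: "s \<in> reps" and t: "t \<in> reps" and eq: "rep (h \<otimes> s) = rep (h \<otimes> t)"
    let ?r = "rep (h \<otimes> t)"
    have r: "?r \<in> carrier G" using rep(1)[of "h \<otimes> t"] h t by auto
    have "inv ?r \<otimes> (h \<otimes> s) \<in> N" "inv ?r \<otimes> (h \<otimes> t) \<in> N" using rep(2)[of "h \<otimes> s"] rep(2)[of "h \<otimes> t"] eq h s t by auto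
    then have "inv (inv ?r \<otimes> (h \<otimes> s)) \<otimes> (inv ?r \<otimes> (h \<otimes> t)) \<in> N"
      using subgroup.m_closed[OF subgroup_N] subgroup.m_inv_closed[OF subgroup_N] by blast
    moreover have "inv (inv ?r \<otimes> (h \<otimes> s)) \<otimes> (inv ?r \<otimes> (h \<otimes> t)) = inv s \<otimes> t"
      using h s t r by (simp add: inv_mult_group m_assoc)
    ultimately have "rep t = s" using s t by (intro rep_eqI) auto
    then show "s = t" using rep_self t by simp
  qed
  moreover have "(\<lambda>s. rep (h \<otimes> s)) ` reps \<subseteq> reps" using rep(1) h by auto
  ultimately show ?thesis by (simp add: bij_betw_def endo_inj_surj reps(1))
qed

context
  fixes \<theta> :: real
begin

text \<open>
  The representation induced from the character \<open>n \<mapsto> cis (\<theta> * \<tau> n)\<close> of \<open>N\<close>. Functions vanish off the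
  carrier to make them extensional.
\<close>

definition space :: "('a \<Rightarrow> complex) set" where
  "space = {F. (\<forall>x. x \<notin> carrier G \<longrightarrow> F x = 0) \<and> (\<forall>x\<in>carrier G. \<forall>n\<in>N. F (x \<otimes> n) = cis (\<theta> * \<tau> n) * F x)}"

text \<open>In effect a sum over the left cosets of \<open>N\<close>: the phases of two members of
  \<open>space\<close> cancel in the product (\<open>space_prod_rep\<close>). This makes
  translations unitary.\<close>

definition ip :: "('a \<Rightarrow> complex) \<Rightarrow> ('a \<Rightarrow> complex) \<Rightarrow> complex" where
  "ip F F' = (\<Sum>s\<in>reps. F s * cnj (F' s))"

text \<open>The vectors are functions on the group, which is the type of Hilbert spaces over which
  \<open>property_T\<close> quantifies.\<close>

definition L :: "('a \<Rightarrow> complex) hilbert" where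
  "L = \<lparr>carrier = space, monoid.mult = undefined, one = undefined, ring.zero = (\<lambda>_. 0),
    add = (\<lambda>F F' x. F x + F' x), smult = (\<lambda>c F x. c * F x), cinner = ip\<rparr>"

lemma L_simps [simp]:
  "carrier L = space" "\<zero>\<^bsub>L\<^esub> = (\<lambda>_. 0)" "F \<oplus>\<^bsub>L\<^esub> F' = (\<lambda>x. F x + F' x)"
  "c \<odot>\<^bsub>L\<^esub> F = (\<lambda>x. c * F x)" "cinner L F F' = ip F F'"
  by (simp_all add: L_def)

lemma space_out: "\<lbrakk>F \<in> space; x \<notin> carrier G\<rbrakk> \<Longrightarrow> F x = 0"
  by (simp add: space_def)

lemma space_N: "\<lbrakk>F \<in> space; x \<in> carrier G; n \<in> N\<rbrakk> \<Longrightarrow> F (x \<otimes> n) = cis (\<theta> * \<tau> n) * F x"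
  by (simp add: space_def)

lemma space_rep:
  assumes "F \<in> space" "x \<in> carrier G"
  shows "F x = cis (\<theta> * \<tau> (inv (rep x) \<otimes> x)) * F (rep x)"
  using space_N[OF assms(1), of "rep x" "inv (rep x) \<otimes> x"] rep[OF assms(2)] assms(2) by simp

lemma space_prod_rep: "\<lbrakk>F \<in> space; F' \<in> space; x \<in> carrier G\<rbrakk> \<Longrightarrow> F x * cnj (F' x) = F (rep x) * cnj (F' (rep x))"
  using space_rep[of F x] space_rep[of F' x] by (simp add: cis_mult cis_cnj mult.assoc mult.left_commute)

lemma abelian_group_L: "abelian_group L"
proof (rule abelian_groupI)
  fix F assume "F \<in> carrier L"
  then show "\<exists>F'\<in>carrier L. F' \<oplus>\<^bsub>L\<^esub> F = \<zero>\<^bsub>L\<^esub>"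
    by (intro bexI[of _ "\<lambda>x. - F x"]) (auto simp: space_def)
qed (auto simp: space_def algebra_simps)

lemma minus_L: "\<lbrakk>F \<in> space; F' \<in> space\<rbrakk> \<Longrightarrow> F \<ominus>\<^bsub>L\<^esub> F' = (\<lambda>x. F x - F' x)"
proof -
  assume F: "F \<in> space" "F' \<in> space"
  interpret L: abelian_group L by (rule abelian_group_L)
  have "(\<lambda>x. - F' x) \<in> carrier L" using F by (auto simp: space_def)
  then have "\<ominus>\<^bsub>L\<^esub> F' = (\<lambda>x. - F' x)" using F by (intro L.minus_equality) auto
  then show ?thesis by (simp add: a_minus_def)
qed

lemma hnorm_L: "hnorm L F = sqrt (\<Sum>s\<in>reps. (cmod (F s))\<^sup>2)"
  by (simp add: hnorm_def ip_def complex_norm_square[symmetric] flip: of_real_power)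

lemma cmod_le_hnorm: "\<lbrakk>F \<in> space; x \<in> carrier G\<rbrakk> \<Longrightarrow> cmod (F x) \<le> hnorm L F"
proof -
  assume F: "F \<in> space" and x: "x \<in> carrier G"
  have "(cmod (F (rep x)))\<^sup>2 \<le> (\<Sum>s\<in>reps. (cmod (F s))\<^sup>2)"
    by (rule member_le_sum) (use reps rep x in auto)
  then have "cmod (F (rep x)) \<le> hnorm L F" unfolding hnorm_L by (rule real_le_rsqrt)
  then show ?thesis using space_rep[OF F x] by (simp add: norm_mult)
qed

text \<open>For completeness, the norm bounds each value, so Cauchy sequences converge pointwise;
  the limit stays in \<open>space\<close>, and convergence at the finitely many representatives is
  convergence in norm.\<close>

lemma hilbert_space_L: "hilbert_space L"
proof -
  have mod: "module complex_field L"
    by (rule moduleI[OF cring_complex_field abelian_group_L])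
      (auto simp: complex_field_def space_def algebra_simps)
  have "hilbert_space_axioms L"
  proof
    fix x assume x: "x \<in> carrier L" "cinner L x x = 0"
    then have "hnorm L x = 0" by (simp add: hnorm_def)
    then have "cmod (x g) \<le> 0" if "g \<in> carrier G" for g using cmod_le_hnorm[of x g] x that by simp
    then show "x = \<zero>\<^bsub>L\<^esub>" using space_out[of x] x by (intro ext) (metis L_simps(1,2) norm_le_zero_iff)
  next
    fix f :: "nat \<Rightarrow> 'a \<Rightarrow> complex"
    assume f: "\<And>n. f n \<in> carrier L"
      and cau: "\<And>e. e > 0 \<Longrightarrow> \<exists>M. \<forall>m\<ge>M. \<forall>n\<ge>M. hnorm L (f m \<ominus>\<^bsub>L\<^esub> f n) < e"
    interpret L: abelian_group L by (rule abelian_group_L)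
    have "Cauchy (\<lambda>n. f n x)" if x: "x \<in> carrier G" for x
    proof (rule CauchyI)
      fix e :: real assume "e > 0"
      then obtain M where M: "\<And>m n. m \<ge> M \<Longrightarrow> n \<ge> M \<Longrightarrow> hnorm L (f m \<ominus>\<^bsub>L\<^esub> f n) < e" using cau by blast
      have "cmod (f m x - f n x) \<le> hnorm L (f m \<ominus>\<^bsub>L\<^esub> f n)" for m n
        using cmod_le_hnorm[of "f m \<ominus>\<^bsub>L\<^esub> f n" x] L.minus_closed[OF f f, of m n] x f by (simp add: minus_L)
      then show "\<exists>M. \<forall>m\<ge>M. \<forall>n\<ge>M. cmod (f m x - f n x) < e" using M by (meson le_less_trans)
    qed
    then have lim: "(\<lambda>n. f n x) \<longlonglongrightarrow> lim (\<lambda>n. f n x)" if "x \<in> carrier G" for x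
      using that Cauchy_convergent convergent_LIMSEQ_iff by blast
    define l where "l x = (if x \<in> carrier G then lim (\<lambda>n. f n x) else 0)" for x
    have fl: "(\<lambda>n. f n x) \<longlonglongrightarrow> l x" if "x \<in> carrier G" for x using lim that by (simp add: l_def)
    have l: "l \<in> space" unfolding space_def
    proof (intro CollectI conjI ballI allI impI)
      fix x n assume x: "x \<in> carrier G" and n: "n \<in> N"
      have "(\<lambda>i. f i (x \<otimes> n)) \<longlonglongrightarrow> cis (\<theta> * \<tau> n) * l x"
        using tendsto_mult_left[OF fl[OF x], of "cis (\<theta> * \<tau> n)"] space_N[OF f[simplified] x n] by simp
      then show "l (x \<otimes> n) = cis (\<theta> * \<tau> n) * l x" using fl[of "x \<otimes> n"] x n LIMSEQ_unique by auto
    qed (simp add: l_def)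
    have "(\<lambda>n. sqrt (\<Sum>s\<in>reps. (cmod (f n s - l s))\<^sup>2)) \<longlonglongrightarrow> sqrt (\<Sum>s\<in>reps. (cmod (l s - l s))\<^sup>2)"
      by (intro tendsto_intros fl) auto
    then show "\<exists>l\<in>carrier L. (\<lambda>n. hnorm L (f n \<ominus>\<^bsub>L\<^esub> l)) \<longlonglongrightarrow> 0"
      using f l by (intro bexI[of _ l]) (simp_all add: minus_L hnorm_L)
  next
    fix x assume "x \<in> carrier L"
    show "0 \<le> Re (cinner L x x)"
      by (simp add: ip_def complex_norm_square[symmetric] sum_nonneg flip: of_real_power)
  qed (auto simp: ip_def algebra_simps sum.distrib sum_distrib_left)
  then show ?thesis using mod by (simp add: hilbert_space_def)
qed

definition trans :: "'a \<Rightarrow> ('a \<Rightarrow> complex) \<Rightarrow> 'a \<Rightarrow> complex" where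
  "trans h = (\<lambda>F\<in>space. \<lambda>x. if x \<in> carrier G then F (inv h \<otimes> x) else 0)"

lemma trans_apply: "\<lbrakk>F \<in> space; x \<in> carrier G\<rbrakk> \<Longrightarrow> trans h F x = F (inv h \<otimes> x)"
  by (simp add: trans_def)

lemma trans_closed:
  assumes "h \<in> carrier G" "F \<in> space"
  shows "trans h F \<in> space"
  unfolding space_def
proof (intro CollectI conjI ballI allI impI)
  fix x n assume "x \<in> carrier G" "n \<in> N"
  then show "trans h F (x \<otimes> n) = cis (\<theta> * \<tau> n) * trans h F x"
    using space_N[OF assms(2), of "inv h \<otimes> x" n] assms by (simp add: trans_apply m_assoc)
qed (use assms in \<open>simp add: trans_def\<close>)

lemma trans_mult:
  assumes "g \<in> carrier G" "h \<in> carrier G" "F \<in> space"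
  shows "trans (g \<otimes> h) F = trans g (trans h F)"
proof
  fix x
  show "trans (g \<otimes> h) F x = trans g (trans h F) x"
    using assms trans_closed[OF assms(2,3)]
    by (auto simp: trans_def inv_mult_group m_assoc)
qed

lemma trans_one: "F \<in> space \<Longrightarrow> trans \<one> F = F"
  by (rule ext) (auto simp: trans_def space_out)

lemma ip_trans:
  assumes h: "h \<in> carrier G" and F: "F \<in> space" "F' \<in> space"
  shows "ip (trans h F) (trans h F') = ip F F'"
proof -
  have "ip (trans h F) (trans h F') = (\<Sum>s\<in>reps. F (inv h \<otimes> s) * cnj (F' (inv h \<otimes> s)))"
    unfolding ip_def by (intro sum.cong) (use F in \<open>auto simp: trans_apply\<close>)
  also have "\<dots> = (\<Sum>s\<in>reps. F (rep (inv h \<otimes> s)) * cnj (F' (rep (inv h \<otimes> s))))"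
    by (intro sum.cong refl space_prod_rep) (use h F in auto)
  also have "\<dots> = ip F F'"
    unfolding ip_def using sum.reindex_bij_betw[OF rep_shift_bij[of "inv h"], of "\<lambda>s. F s * cnj (F' s)"] h by simp
  finally show ?thesis .
qed

lemma trans_Bij:
  assumes h: "h \<in> carrier G"
  shows "trans h \<in> Bij space"
proof -
  have "bij_betw (trans h) space space"
    by (rule bij_betwI[of _ _ _ "trans (inv h)"])
      (use h trans_closed trans_mult[of "inv h" h] trans_mult[of h "inv h"] trans_one in \<open>auto simp flip: trans_mult\<close>)
  then show ?thesis by (auto simp: Bij_def trans_def)
qed

lemma trans_hom: "trans \<in> hom G (unitary_group L)"
proof (rule homI)
  fix h assume h: "h \<in> carrier G"
  have sp: "(\<lambda>x. F x + F' x) \<in> space" "(\<lambda>x. c * F x) \<in> space" if "F \<in> space" "F' \<in> space" for F F' c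
    using that by (auto simp: space_def algebra_simps)
  show "trans h \<in> carrier (unitary_group L)"
    using trans_Bij[OF h] ip_trans[OF h] sp
    by (auto simp: unitary_group_def unitary_operators_def) (auto simp: trans_def)
next
  fix g h assume g: "g \<in> carrier G" and h: "h \<in> carrier G"
  have "trans (g \<otimes> h) F = compose space (trans g) (trans h) F" for F
    using trans_mult[OF g h, of F] by (auto simp: compose_def) (simp add: trans_def)
  then show "trans (g \<otimes> h) = trans g \<otimes>\<^bsub>unitary_group L\<^esub> trans h"
    using trans_Bij g h by (auto simp: unitary_group_def BijGroup_def)
qed

text \<open>The member of \<open>space\<close> with value 1 at every representative. It is constant
  on the group for \<open>\<theta> = 0\<close>, and so it is almost invariant for small
  \<open>\<theta>\<close>.\<close>

definition unit_vec :: "'a \<Rightarrow> complex" where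
  "unit_vec x = (if x \<in> carrier G then cis (\<theta> * \<tau> (inv (rep x) \<otimes> x)) else 0)"

lemma unit_vec_space: "unit_vec \<in> space"
  unfolding space_def
proof (intro CollectI conjI ballI allI impI)
  fix x n assume x: "x \<in> carrier G" and n: "n \<in> N"
  have r: "rep x \<in> carrier G" using rep(1)[OF x] by simp
  have "inv (rep x) \<otimes> (x \<otimes> n) = (inv (rep x) \<otimes> x) \<otimes> n" using x n r by (simp add: m_assoc)
  then have "\<tau> (inv (rep x) \<otimes> (x \<otimes> n)) = \<tau> (inv (rep x) \<otimes> x) + \<tau> n" using tau_mult rep(2)[OF x] n by simp
  then show "unit_vec (x \<otimes> n) = cis (\<theta> * \<tau> n) * unit_vec x"
    using x n by (simp add: unit_vec_def rep_mult_N cis_mult distrib_left add.commute)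
qed (simp add: unit_vec_def)

lemma unit_vec_rep: "s \<in> reps \<Longrightarrow> unit_vec s = 1"
  by (simp add: unit_vec_def rep_self tau_one)

lemma hnorm_unit_vec: "hnorm L unit_vec = sqrt (card reps)"
  by (simp add: hnorm_L unit_vec_rep)

lemma unit_vec_trans:
  assumes q: "q \<in> carrier G"
    and M: "\<And>s. s \<in> reps \<Longrightarrow> \<bar>\<theta> * \<tau> (inv (rep (inv q \<otimes> s)) \<otimes> (inv q \<otimes> s))\<bar> \<le> e"
  shows "hnorm L (trans q unit_vec \<ominus>\<^bsub>L\<^esub> unit_vec) \<le> e * hnorm L unit_vec"
proof -
  have e: "e \<ge> 0" using M reps_nonempty by (metis abs_ge_zero all_not_in_conv order_trans)
  have "(cmod ((trans q unit_vec \<ominus>\<^bsub>L\<^esub> unit_vec) s))\<^sup>2 \<le> e\<^sup>2" if s: "s \<in> reps" for s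
  proof -
    let ?t = "\<theta> * \<tau> (inv (rep (inv q \<otimes> s)) \<otimes> (inv q \<otimes> s))"
    have "(trans q unit_vec \<ominus>\<^bsub>L\<^esub> unit_vec) s = cis ?t - 1"
      using s q minus_L[OF trans_closed[OF q unit_vec_space] unit_vec_space]
      by (simp add: trans_apply unit_vec_space unit_vec_rep) (simp add: unit_vec_def)
    moreover have "cmod (cis ?t - 1) \<le> \<bar>?t\<bar>"
    proof -
      have "(cmod (cis ?t - 1))\<^sup>2 = (cos ?t - 1)\<^sup>2 + (sin ?t)\<^sup>2" by (simp add: cmod_power2)
      also have "\<dots> = 2 - 2 * cos ?t" using sin_cos_squared_add[of ?t] by (simp add: power2_eq_square algebra_simps)
      also have "\<dots> = (2 * sin (?t / 2))\<^sup>2" using cos_double_sin[of "?t / 2"] by (simp add: power_mult_distrib)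
      finally have "(cmod (cis ?t - 1))\<^sup>2 = (2 * sin (?t / 2))\<^sup>2" .
      then have "cmod (cis ?t - 1) = \<bar>2 * sin (?t / 2)\<bar>" by (simp add: real_sqrt_unique flip: real_sqrt_abs)
      also have "\<dots> \<le> \<bar>?t\<bar>" using abs_sin_x_le_abs_x[of "?t / 2"] by simp
      finally show ?thesis .
    qed
    ultimately have "cmod ((trans q unit_vec \<ominus>\<^bsub>L\<^esub> unit_vec) s) \<le> e" using M[OF s] by simp
    then show ?thesis by (simp add: power_mono)
  qed
  then have "(\<Sum>s\<in>reps. (cmod ((trans q unit_vec \<ominus>\<^bsub>L\<^esub> unit_vec) s))\<^sup>2) \<le> (\<Sum>s\<in>reps. e\<^sup>2)" by (rule sum_mono)
  then have "hnorm L (trans q unit_vec \<ominus>\<^bsub>L\<^esub> unit_vec) \<le> sqrt (card reps * e\<^sup>2)"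
    unfolding hnorm_L by simp
  also have "\<dots> = e * hnorm L unit_vec" using e by (simp add: hnorm_unit_vec real_sqrt_mult)
  finally show ?thesis .
qed

end

text \<open>For small \<open>\<theta>\<close> the vector \<open>unit_vec\<close> is almost invariant
  under \<open>Q\<close>, while an invariant vector is constant on the group and has to vanish
  because the character is nontrivial at \<open>n\<close>.\<close>

theorem not_property_T:
  assumes n: "n \<in> N" "\<tau> n \<noteq> 0"
  shows "\<not> property_T G"
proof
  assume "property_T G"
  then obtain Q \<epsilon> where Q: "finite Q" "Q \<subseteq> carrier G" "\<epsilon> > 0" and T: "kazhdan_pair TYPE('a \<Rightarrow> complex) G Q \<epsilon>"
    unfolding property_T_def by blast
  define t where "t q s = \<tau> (inv (rep (inv q \<otimes> s)) \<otimes> (inv q \<otimes> s))" for q s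
  \<comment> \<open>Adding 1 keeps \<open>M\<close> positive even if all the terms vanish.\<close>
  define M where "M = 1 + (\<Sum>q\<in>Q. \<Sum>s\<in>reps. \<bar>t q s\<bar>)"
  have M1: "M \<ge> 1" by (simp add: M_def sum_nonneg)
  have M: "\<bar>t q s\<bar> \<le> M" if "q \<in> Q" "s \<in> reps" for q s
  proof -
    have "\<bar>t q s\<bar> \<le> (\<Sum>s\<in>reps. \<bar>t q s\<bar>)" by (rule member_le_sum) (use that reps in auto)
    also have "\<dots> \<le> (\<Sum>q\<in>Q. \<Sum>s\<in>reps. \<bar>t q s\<bar>)"
      by (rule member_le_sum[of q Q "\<lambda>q. \<Sum>s\<in>reps. \<bar>t q s\<bar>"]) (use that Q in \<open>auto intro: sum_nonneg\<close>)
    finally show ?thesis by (simp add: M_def)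
  qed
  \<comment> \<open>The first bound keeps the displacement of \<open>unit_vec\<close> below
    \<open>\<epsilon>\<close>. The second keeps \<open>\<theta> * \<bar>\<tau> n\<bar>\<close>
    positive and at most 1, hence below \<open>pi\<close>, so that the character differs from 1 at
    \<open>n\<close>.\<close>
  define \<theta> where "\<theta> = min (\<epsilon> / (2 * M)) (1 / \<bar>\<tau> n\<bar>)"
  have th: "\<theta> > 0" "\<theta> * M \<le> \<epsilon> / 2" "\<theta> * \<bar>\<tau> n\<bar> \<le> 1"
  proof -
    show "\<theta> > 0" using Q M1 n by (simp add: \<theta>_def)
    have "\<theta> * M \<le> (\<epsilon> / (2 * M)) * M" by (rule mult_right_mono) (use M1 in \<open>auto simp: \<theta>_def\<close>)
    then show "\<theta> * M \<le> \<epsilon> / 2" using M1 by simp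
    have "\<theta> * \<bar>\<tau> n\<bar> \<le> (1 / \<bar>\<tau> n\<bar>) * \<bar>\<tau> n\<bar>" by (rule mult_right_mono) (auto simp: \<theta>_def)
    then show "\<theta> * \<bar>\<tau> n\<bar> \<le> 1" using n by simp
  qed
  have pos: "hnorm (L \<theta>) (unit_vec \<theta>) > 0"
    using reps(1) reps_nonempty by (simp add: hnorm_unit_vec card_gt_0_iff)
  have "\<exists>\<xi>\<in>carrier (L \<theta>). \<xi> \<noteq> \<zero>\<^bsub>L \<theta>\<^esub> \<and>
    (\<forall>q\<in>Q. hnorm (L \<theta>) (trans \<theta> q \<xi> \<ominus>\<^bsub>L \<theta>\<^esub> \<xi>) < \<epsilon> * hnorm (L \<theta>) \<xi>)"
  proof (intro bexI conjI ballI)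
    show "unit_vec \<theta> \<in> carrier (L \<theta>)" using unit_vec_space by simp
    show "unit_vec \<theta> \<noteq> \<zero>\<^bsub>L \<theta>\<^esub>"
      using unit_vec_rep[of _ \<theta>] reps_nonempty by (metis L_simps(2) all_not_in_conv zero_neq_one)
    fix q assume q: "q \<in> Q"
    have "hnorm (L \<theta>) (trans \<theta> q (unit_vec \<theta>) \<ominus>\<^bsub>L \<theta>\<^esub> unit_vec \<theta>) \<le> (\<epsilon> / 2) * hnorm (L \<theta>) (unit_vec \<theta>)"
    proof (rule unit_vec_trans)
      show "q \<in> carrier G" using q Q by auto
      fix s assume s: "s \<in> reps"
      have "\<bar>\<theta> * t q s\<bar> = \<theta> * \<bar>t q s\<bar>" using th by (simp add: abs_mult)
      also have "\<dots> \<le> \<theta> * M" by (rule mult_left_mono) (use M[OF q s] th in auto)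
      also note th(2)
      finally show "\<bar>\<theta> * \<tau> (inv (rep (inv q \<otimes> s)) \<otimes> (inv q \<otimes> s))\<bar> \<le> \<epsilon> / 2" by (simp add: t_def)
    qed
    also have "\<dots> < \<epsilon> * hnorm (L \<theta>) (unit_vec \<theta>)" using pos Q by simp
    finally show "hnorm (L \<theta>) (trans \<theta> q (unit_vec \<theta>) \<ominus>\<^bsub>L \<theta>\<^esub> unit_vec \<theta>) < \<epsilon> * hnorm (L \<theta>) (unit_vec \<theta>)" .
  qed
  then obtain \<eta> where eta: "\<eta> \<in> space \<theta>" "\<eta> \<noteq> (\<lambda>_. 0)" and inva: "\<And>g. g \<in> carrier G \<Longrightarrow> trans \<theta> g \<eta> = \<eta>"
    using T[unfolded kazhdan_pair_def, rule_format, of "L \<theta>" "trans \<theta>"] hilbert_space_L trans_hom by auto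
  have const: "\<eta> g = \<eta> \<one>" if "g \<in> carrier G" for g
    using fun_cong[OF inva[OF that], of g] trans_apply[OF eta(1) that, of g] that by simp
  have "\<eta> n = cis (\<theta> * \<tau> n) * \<eta> \<one>" using space_N[OF eta(1), of \<one> n] n by simp
  then have "(cis (\<theta> * \<tau> n) - 1) * \<eta> \<one> = 0" using const[of n] n by (simp add: algebra_simps)
  moreover have "cis (\<theta> * \<tau> n) \<noteq> 1"
  proof
    assume "cis (\<theta> * \<tau> n) = 1"
    then have "sin (\<theta> * \<tau> n) = 0" by (simp add: complex_eq_iff)
    moreover have "sin (\<theta> * \<bar>\<tau> n\<bar>) > 0" using th n pi_ge_two by (intro sin_gt_zero) auto
    ultimately show False by (cases "\<tau> n \<ge> 0") auto
  qed
  ultimately have "\<eta> \<one> = 0" by simp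
  then have "\<eta> g = 0" for g using const[of g] space_out[OF eta(1), of g] by (cases "g \<in> carrier G") auto
  then show False using eta(2) by auto
qed

end

theorem not_property_T_Mod:
  assumes A: "group A" and I: "I \<lhd> A" and N: "subgroup N A" and IN: "I \<subseteq> N"
    and fin: "\<exists>S. finite S \<and> S \<subseteq> carrier A \<and> (\<forall>x\<in>carrier A. \<exists>s\<in>S. inv\<^bsub>A\<^esub> s \<otimes>\<^bsub>A\<^esub> x \<in> N)"
    and tau: "\<And>m n. \<lbrakk>m \<in> N; n \<in> N\<rbrakk> \<Longrightarrow> \<tau> (m \<otimes>\<^bsub>A\<^esub> n) = \<tau> m + \<tau> n"
    and tauI: "\<And>i. i \<in> I \<Longrightarrow> \<tau> i = (0 :: real)" and n: "n \<in> N" "\<tau> n \<noteq> 0"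
  shows "\<not> property_T (A Mod I)"
proof -
  interpret A: group A by fact
  interpret I: normal I A by fact
  interpret M: group "A Mod I" by (rule I.factorgroup_is_group)
  interpret N: subgroup N A by fact
  let ?c = "\<lambda>x. I #>\<^bsub>A\<^esub> x"
  have car: "carrier (A Mod I) = ?c ` carrier A" by (auto simp: FactGroup_def RCOSETS_def)
  have mul: "?c x \<otimes>\<^bsub>A Mod I\<^esub> ?c y = ?c (x \<otimes>\<^bsub>A\<^esub> y)" if "x \<in> carrier A" "y \<in> carrier A" for x y
    using I.rcos_sum[OF that] by (simp add: FactGroup_def)
  have chom: "group_hom A (A Mod I) ?c"
    unfolding group_hom_def group_hom_axioms_def
    using A M.is_group mul by (intro conjI homI) (auto simp: car simp del: mult_FactGroup)
  have cinv: "inv\<^bsub>A Mod I\<^esub> ?c x = ?c (inv\<^bsub>A\<^esub> x)" if "x \<in> carrier A" for x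
    using group_hom.hom_inv[OF chom that] by simp
  have mem: "y \<in> N \<and> \<tau> y = \<tau> x" if x: "x \<in> N" and y: "y \<in> ?c x" for x y
  proof -
    obtain i where i: "i \<in> I" "y = i \<otimes>\<^bsub>A\<^esub> x" using y by (auto simp: r_coset_def)
    then show ?thesis using x IN tau[of i x] tauI[of i] N.m_closed[of i x] by auto
  qed
  have self: "x \<in> ?c x" if "x \<in> carrier A" for x using A.rcos_self[OF that I.subgroup_axioms] .
  \<comment> \<open>On a coset inside \<open>N\<close> every member gives the same value, since
    \<open>\<tau>\<close> vanishes on \<open>I\<close>.\<close>
  define \<tau>' where "\<tau>' Y = \<tau> (SOME x. x \<in> Y)" for Y
  have tau': "\<tau>' (?c x) = \<tau> x" if x: "x \<in> N" for x
  proof -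
    have "(SOME y. y \<in> ?c x) \<in> ?c x" by (rule someI[of _ x]) (use self x in auto)
    then show ?thesis using mem[OF x] by (simp add: \<tau>'_def)
  qed
  interpret F: finite_index_character "A Mod I" "?c ` N" \<tau>'
  proof (intro finite_index_character.intro M.is_group finite_index_character_axioms.intro)
    show "subgroup (?c ` N) (A Mod I)"
      using group_hom.subgroup_img_is_subgroup[OF chom N] .
    obtain S where S: "finite S" "S \<subseteq> carrier A" "\<And>x. x \<in> carrier A \<Longrightarrow> \<exists>s\<in>S. inv\<^bsub>A\<^esub> s \<otimes>\<^bsub>A\<^esub> x \<in> N"
      using fin by blast
    show "\<exists>S. finite S \<and> S \<subseteq> carrier (A Mod I) \<and>
      (\<forall>x\<in>carrier (A Mod I). \<exists>s\<in>S. inv\<^bsub>A Mod I\<^esub> s \<otimes>\<^bsub>A Mod I\<^esub> x \<in> ?c ` N)"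
    proof (intro exI[of _ "?c ` S"] conjI ballI)
      fix Y assume "Y \<in> carrier (A Mod I)"
      then obtain x where x: "x \<in> carrier A" "Y = ?c x" by (auto simp: car)
      obtain s where s: "s \<in> S" "inv\<^bsub>A\<^esub> s \<otimes>\<^bsub>A\<^esub> x \<in> N" using S(3)[OF x(1)] by blast
      have "inv\<^bsub>A Mod I\<^esub> ?c s \<otimes>\<^bsub>A Mod I\<^esub> Y = ?c (inv\<^bsub>A\<^esub> s \<otimes>\<^bsub>A\<^esub> x)"
        using s S x cinv[of s] mul[of "inv\<^bsub>A\<^esub> s" x] by (auto simp del: mult_FactGroup)
      then show "\<exists>s\<in>?c ` S. inv\<^bsub>A Mod I\<^esub> s \<otimes>\<^bsub>A Mod I\<^esub> Y \<in> ?c ` N" using s by auto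
    qed (use S car in auto)
    fix Y Z assume "Y \<in> ?c ` N" "Z \<in> ?c ` N"
    then show "\<tau>' (Y \<otimes>\<^bsub>A Mod I\<^esub> Z) = \<tau>' Y + \<tau>' Z"
      by (auto simp: mul tau' tau simp del: mult_FactGroup)
  qed
  show ?thesis by (rule F.not_property_T[of "?c n"]) (use n tau' in auto)
qed

section \<open>A character in the presence of a SIL\<close>

text \<open>Deleting the syllables outside \<open>S\<close> turns each defining relation into a
  consequence of the relations over \<open>S\<close>.\<close>

lemma gp_rel_filter:
  assumes "(w, w') \<in> gp_rel V adj G" "vertex_groups V adj G" "S \<subseteq> V"
  shows "(filter (\<lambda>p. fst p \<in> S) w, filter (\<lambda>p. fst p \<in> S) w') \<in> gp_rel S adj G"
proof -
  have f: "filter (\<lambda>p. fst p \<in> S) w \<in> fp_words S G" if "w \<in> fp_words V G" for w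
    using that by (induction w) auto
  show ?thesis using assms(1)
  proof (induction rule: gp_rel.induct)
    case (trans u w x)
    then show ?case by (meson gp_rel.trans)
  next
    case (comm u v g h)
    then show ?case by (auto intro: gp_rel.comm gp_rel.refl)
  qed (auto intro: gp_rel.intros f)
qed

context graph_group
begin

lemma subgroup_par: "S \<subseteq> V \<Longrightarrow> subgroup (par S) H"
  by (rule subgroup.intro) (auto intro: par_mult par_inv dest: par_closed)

text \<open>Makes the results on conjugating endomorphisms available inside a parabolic subgroup, in
  particular in the free product of \<open>G x1\<close> and \<open>G x2\<close>.\<close>

lemma graph_group_par:
  assumes S: "S \<subseteq> V"
  shows "graph_group S adj G (H\<lparr>carrier := par S\<rparr>) \<iota>"
proof -
  let ?R = "H\<lparr>carrier := par S\<rparr>"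
  have wev: "wev ?R \<iota> w = ev w" for w by (simp add: wev_def)
  have R: "group ?R" using subgroup_imp_group[OF subgroup_par[OF S]] .
  show ?thesis
  proof (intro graph_group.intro graph_group_axioms.intro R)
    show "vertex_groups S adj G" by (rule vertex_groups.intro) (use S group_G adj_sym adj_irrefl in auto)
    show "finite S" using S finite_V finite_subset by blast
    fix v assume v: "v \<in> S"
    then have vV: "v \<in> V" using S by auto
    show "\<iota> v \<in> hom (G v) ?R" using v vV S by (auto intro!: homI simp: iota_mult)
    show "comm_group (G v)" "finite (carrier (G v))" "\<exists>g\<in>carrier (G v). g \<noteq> \<one>\<^bsub>G v\<^esub>"
      using comm_G finite_G nontrivial_G vV by auto
  next
    fix u v g h assume "u \<in> S" "v \<in> S" "adj u v" "g \<in> carrier (G u)" "h \<in> carrier (G v)"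
    then show "\<iota> u g \<otimes>\<^bsub>?R\<^esub> \<iota> v h = \<iota> v h \<otimes>\<^bsub>?R\<^esub> \<iota> u g" using S iota_comm[of u v g h] by (auto simp: subset_iff)
  next
    fix x assume "x \<in> carrier ?R"
    then obtain w where "w \<in> fp_words S G" "x = ev w" by (auto simp: par_def)
    then show "\<exists>w\<in>fp_words S G. wev ?R \<iota> w = x" using wev by auto
  next
    fix w w' assume w: "w \<in> fp_words S G" "w' \<in> fp_words S G" "wev ?R \<iota> w = wev ?R \<iota> w'"
    have "filter (\<lambda>p. fst p \<in> S) u = u" if "u \<in> fp_words S G" for u
      using that by (induction u) auto
    moreover have "(w, w') \<in> gp_rel V adj G"
      using w fp_words_mono[OF S] by (intro faithful) (auto simp: wev)
    ultimately show "(w, w') \<in> gp_rel S adj G"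
      using gp_rel_filter[OF _ vertex_groups_axioms S] w by metis
  qed
qed

lemma retr_disjoint: "\<lbrakk>y \<in> par S; S \<subseteq> V; S \<inter> T = {}\<rbrakk> \<Longrightarrow> retr T y = \<one>"
  by (induction rule: par_induct) (auto simp: retr_mult retr_iota)

lemma conj_auto_closed:
  assumes "\<phi> \<in> conj_auto"
  shows "\<phi> \<in> auto H" "\<phi> \<in> hom H H" "x \<in> carrier H \<Longrightarrow> \<phi> x \<in> carrier H"
  using assms hom_in_carrier[of \<phi> H H] by (auto simp: conj_auto_def auto_def)

lemma auto_group_hom: "\<phi> \<in> auto H \<Longrightarrow> group_hom H H \<phi>"
  using is_group by (simp add: group_hom_def group_hom_axioms_def auto_def)

lemma subgroup_conj_auto: "subgroup conj_auto (AutoGroup H)"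
proof -
  interpret A: group "AutoGroup H" by (rule AutoGroup)
  show ?thesis
  proof (rule A.subgroupI)
    show "conj_auto \<subseteq> carrier (AutoGroup H)" by (auto simp: conj_auto_def carrier_AutoGroup)
    have "aone \<in> conj_auto" using A.one_closed
      by (auto simp: conj_auto_def carrier_AutoGroup AutoGroup_one_apply intro!: bexI[of _ \<one>])
    then show "conj_auto \<noteq> {}" by auto
  next
    fix \<phi> assume phi: "\<phi> \<in> conj_auto"
    let ?i = "ainv \<phi>"
    have i: "?i \<in> auto H" using A.inv_closed[of \<phi>] conj_auto_closed[OF phi] by (simp add: carrier_AutoGroup)
    interpret I: group_hom H H ?i by (rule auto_group_hom[OF i])
    have "\<exists>k\<in>carrier H. ?i (\<iota> v a) = k \<otimes> \<iota> v a \<otimes> inv k" if va: "v \<in> V" "a \<in> carrier (G v)" for v a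
    proof -
      obtain k where k: "k \<in> carrier H" "\<phi> (\<iota> v a) = k \<otimes> \<iota> v a \<otimes> inv k" using phi va by (auto simp: conj_auto_def)
      have "\<iota> v a = inv k \<otimes> \<phi> (\<iota> v a) \<otimes> inv (inv k)" using k va by (simp add: m_assoc)
      moreover have "?i (inv k \<otimes> \<phi> (\<iota> v a) \<otimes> inv (inv k)) = ?i (inv k) \<otimes> ?i (\<phi> (\<iota> v a)) \<otimes> inv (?i (inv k))"
        using k va conj_auto_closed[OF phi] by (simp del: inv_inv)
      ultimately have "?i (\<iota> v a) = ?i (inv k) \<otimes> \<iota> v a \<otimes> inv (?i (inv k))"
        using AutoGroup_inv_apply(1)[OF conj_auto_closed(1)[OF phi], of "\<iota> v a"] va by simp
      then show ?thesis using k by (intro bexI[of _ "?i (inv k)"]) auto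
    qed
    then show "?i \<in> conj_auto" using i by (auto simp: conj_auto_def)
  next
    fix \<phi> \<psi> assume phi: "\<phi> \<in> conj_auto" and psi: "\<psi> \<in> conj_auto"
    interpret I: group_hom H H \<phi> by (rule auto_group_hom[OF conj_auto_closed(1)[OF phi]])
    have "\<exists>k\<in>carrier H. (\<phi> \<bullet> \<psi>) (\<iota> v a) = k \<otimes> \<iota> v a \<otimes> inv k"
      if va: "v \<in> V" "a \<in> carrier (G v)" for v a
    proof -
      obtain k where k: "k \<in> carrier H" "\<phi> (\<iota> v a) = k \<otimes> \<iota> v a \<otimes> inv k" using phi va by (auto simp: conj_auto_def)
      obtain l where l: "l \<in> carrier H" "\<psi> (\<iota> v a) = l \<otimes> \<iota> v a \<otimes> inv l" using psi va by (auto simp: conj_auto_def)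
      have "(\<phi> \<bullet> \<psi>) (\<iota> v a) = \<phi> (\<psi> (\<iota> v a))"
        using AutoGroup_apply conj_auto_closed(1) phi psi va by simp
      also have "\<dots> = (\<phi> l \<otimes> k) \<otimes> \<iota> v a \<otimes> inv (\<phi> l \<otimes> k)"
        using k l va by (simp add: inv_mult_group m_assoc)
      finally show ?thesis using k l by (intro bexI[of _ "\<phi> l \<otimes> k"]) auto
    qed
    moreover have "\<phi> \<bullet> \<psi> \<in> auto H"
      using A.m_closed[of \<phi> \<psi>] conj_auto_closed(1) phi psi by (simp add: carrier_AutoGroup)
    ultimately show "\<phi> \<bullet> \<psi> \<in> conj_auto" by (auto simp: conj_auto_def)
  qed
qed

end

locale graph_group_sil = graph_group V adj G H \<iota>
  for V :: "'v set" and adj and G :: "'v \<Rightarrow> ('a, 'm) monoid_scheme" and H :: "('h, 'n) monoid_scheme" (structure)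
    and \<iota> :: "'v \<Rightarrow> 'a \<Rightarrow> 'h" +
  fixes x1 x2 z :: 'v and C :: "'v set"
  assumes x1: "x1 \<in> V" and x2: "x2 \<in> V" and x12: "x1 \<noteq> x2" "\<not> adj x1 x2"
    and C: "C \<subseteq> V" "z \<in> C" "x1 \<notin> C" "x2 \<notin> C"
    and C_closed: "\<lbrakk>v \<in> C; v' \<in> V; adj v v'; \<not> (adj x1 v' \<and> adj x2 v')\<rbrakk> \<Longrightarrow> v' \<in> C"
begin

text \<open>Neither \<open>x1\<close> nor \<open>x2\<close> is in the common link, so as a neighbour
  of a vertex of \<open>C\<close> it would belong to \<open>C\<close>.\<close>

lemma C_st: "v \<in> C \<Longrightarrow> v \<notin> st x1" "v \<in> C \<Longrightarrow> v \<notin> st x2"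
proof -
  have *: "\<not> adj v x1" "\<not> adj v x2" if "v \<in> C" for v
    using C_closed[OF that x1] C_closed[OF that x2] C adj_irrefl by auto
  have "\<not> adj x1 v" "\<not> adj x2 v" if "v \<in> C" for v using *[OF that] adj_sym by blast+
  then show "v \<in> C \<Longrightarrow> v \<notin> st x1" "v \<in> C \<Longrightarrow> v \<notin> st x2"
    using C by (auto simp: st_def nb_def)
qed

abbreviation "\<Lambda> \<equiv> {x1, x2}"
abbreviation "r \<equiv> retr \<Lambda>"

lemma Lam [simp]: "\<Lambda> \<subseteq> V" using x1 x2 by simp

lemma zV: "z \<in> V" using C by auto

lemma st_z: "st z \<inter> \<Lambda> = {}"
  using C_st[OF C(2)] C adj_sym x1 x2 by (auto simp: st_def nb_def)

lemma nb_Lam: "nb x1 \<inter> \<Lambda> = {}" "nb x2 \<inter> \<Lambda> = {}"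
  using x12 adj_sym adj_irrefl by (auto simp: nb_def)

text \<open>\<open>r\<close> kills the vertex groups outside \<open>\<Lambda>\<close> together with
  all their conjugates, so \<open>r\<close> after \<open>\<phi>\<close> factors through
  \<open>r\<close>.\<close>

lemma retr_phi:
  assumes phi: "\<phi> \<in> conj_auto" and x: "x \<in> carrier H"
  shows "r (\<phi> x) = r (\<phi> (r x))"
proof -
  interpret P: group_hom H H \<phi> by (rule auto_group_hom[OF conj_auto_closed(1)[OF phi]])
  have 1: "(\<lambda>x. r (\<phi> x)) \<in> hom H H" by (auto intro!: homI simp: retr_mult)
  have 2: "(\<lambda>x. r (\<phi> (r x))) \<in> hom H H" by (auto intro!: homI simp: retr_mult)
  show ?thesis
  proof (rule hom_ext[OF is_group 1 2 _ x])
    fix v a assume va: "v \<in> V" "a \<in> carrier (G v)"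
    obtain k where k: "k \<in> carrier H" "\<phi> (\<iota> v a) = k \<otimes> \<iota> v a \<otimes> inv k" using phi va by (auto simp: conj_auto_def)
    show "r (\<phi> (\<iota> v a)) = r (\<phi> (r (\<iota> v a)))"
      using va k by (cases "v \<in> \<Lambda>") (auto simp: retr_iota retr_mult retr_inv)
  qed
qed

text \<open>Between two nonadjacent vertices the complement of a star is a single vertex, so the
  constancy in \<open>inner_if_constant\<close> is automatic: every surjective conjugating
  endomorphism of the free product is inner.\<close>

lemma retr_inner:
  assumes phi: "\<phi> \<in> conj_auto"
  shows "\<exists>y\<in>par \<Lambda>. \<forall>x\<in>carrier H. r (\<phi> x) = y \<otimes> r x \<otimes> inv y"
proof -
  let ?R = "H\<lparr>carrier := par \<Lambda>\<rparr>"
  interpret R: graph_group \<Lambda> adj G ?R \<iota> by (rule graph_group_par[OF Lam])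
  interpret P: group_hom H H \<phi> by (rule auto_group_hom[OF conj_auto_closed(1)[OF phi]])
  obtain h where h: "conj_endo V adj G H \<iota> \<phi> h" using conj_auto_endo[OF phi] by blast
  interpret E: conj_endo V adj G H \<iota> \<phi> h by (rule h)
  have rp: "r x \<in> par \<Lambda>" if "x \<in> carrier H" for x using retr_in_par[OF that Lam] .
  have pc: "x \<in> carrier H" if "x \<in> par \<Lambda>" for x using par_closed[OF Lam that] .
  have inv_R: "inv\<^bsub>?R\<^esub> x = inv x" if "x \<in> par \<Lambda>" for x
    using m_inv_consistent[OF subgroup_par[OF Lam] that] .
  interpret RE: conj_endo \<Lambda> adj G ?R \<iota> "\<lambda>x. r (\<phi> x)" "\<lambda>v. r (h v)"
  proof (intro conj_endo.intro R.graph_group_axioms conj_endo_axioms.intro)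
    show "(\<lambda>x. r (\<phi> x)) \<in> hom ?R ?R" using rp pc by (auto intro!: homI simp: retr_mult)
    fix v assume v: "v \<in> \<Lambda>"
    then have vV: "v \<in> V" using Lam by blast
    show "r (h v) \<in> carrier ?R" using rp vV by simp
    fix a assume a: "a \<in> carrier (G v)"
    show "r (\<phi> (\<iota> v a)) = r (h v) \<otimes>\<^bsub>?R\<^esub> \<iota> v a \<otimes>\<^bsub>?R\<^esub> inv\<^bsub>?R\<^esub> r (h v)"
      using v vV a rp[of "h v"] E.phi_iota[OF vV a] by (simp add: retr_mult retr_inv retr_iota inv_R)
  qed
  have "\<exists>y\<in>carrier ?R. \<forall>x\<in>carrier ?R. r (\<phi> x) = y \<otimes>\<^bsub>?R\<^esub> x \<otimes>\<^bsub>?R\<^esub> inv\<^bsub>?R\<^esub> y"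
  proof (rule RE.inner_if_constant)
    fix w assume w: "w \<in> \<Lambda>"
    have "v = (if w = x1 then x2 else x1)" if "v \<in> \<Lambda> - R.st w" for v
      using that w by (auto simp: R.st_def)
    then show "\<exists>k. \<forall>v\<in>\<Lambda> - R.st w. RE.\<kappa> w (r (h v)) = k" by metis
  next
    show "carrier ?R \<subseteq> (\<lambda>x. r (\<phi> x)) ` carrier ?R"
    proof
      fix x assume "x \<in> carrier ?R"
      then have x: "x \<in> par \<Lambda>" by simp
      have "carrier H = \<phi> ` carrier H"
        using conj_auto_closed(1)[OF phi] by (auto simp: auto_def Bij_def bij_betw_def)
      then obtain y where y: "y \<in> carrier H" "x = \<phi> y" using pc[OF x] by blast
      have "x = r (\<phi> (r y))" using retr_phi[OF phi y(1)] retr_par[OF x Lam] y by simp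
      then show "x \<in> (\<lambda>x. r (\<phi> x)) ` carrier ?R" using rp[OF y(1)] by auto
    qed
  qed
  then obtain y where y: "y \<in> par \<Lambda>" "\<And>x. x \<in> par \<Lambda> \<Longrightarrow> r (\<phi> x) = y \<otimes> x \<otimes> inv y"
    by (auto simp: inv_R)
  show ?thesis
  proof (intro bexI[of _ y] ballI)
    fix x assume x: "x \<in> carrier H"
    show "r (\<phi> x) = y \<otimes> r x \<otimes> inv y" using retr_phi[OF phi x] y(2)[OF rp[OF x]] by simp
  qed (rule y)
qed

section \<open>The homomorphism to the free product\<close>

definition inner_of :: "('h \<Rightarrow> 'h) \<Rightarrow> 'h \<Rightarrow> bool" where
  "inner_of \<phi> y \<longleftrightarrow> y \<in> par \<Lambda> \<and> (\<forall>x\<in>carrier H. r (\<phi> x) = y \<otimes> r x \<otimes> inv y)"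

definition conj_z :: "('h \<Rightarrow> 'h) \<Rightarrow> 'h \<Rightarrow> bool" where
  "conj_z \<phi> c \<longleftrightarrow> c \<in> carrier H \<and> (\<forall>g\<in>carrier (G z). \<phi> (\<iota> z g) = c \<otimes> \<iota> z g \<otimes> inv c)"

text \<open>Independent of the choices by \<open>conj_z_unique\<close> and \<open>inner_unique\<close> below.\<close>

definition offset :: "('h \<Rightarrow> 'h) \<Rightarrow> 'h" where
  "offset \<phi> = inv (r (SOME c. conj_z \<phi> c)) \<otimes> (SOME y. inner_of \<phi> y)"

lemma conj_cancel:
  assumes "x \<in> carrier H" "y \<in> carrier H" "g \<in> carrier H" "x \<otimes> g \<otimes> inv x = y \<otimes> g \<otimes> inv y"
  shows "(inv x \<otimes> y) \<otimes> g = g \<otimes> (inv x \<otimes> y)"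
proof -
  have "inv x \<otimes> (x \<otimes> g \<otimes> inv x) \<otimes> y = inv x \<otimes> (y \<otimes> g \<otimes> inv y) \<otimes> y" using assms(4) by simp
  then show ?thesis using assms(1-3) by (simp add: m_assoc)
qed

text \<open>The quotient \<open>t\<close> of two candidates centralizes both free factors. Each of
  them contains its own centralizer, and they intersect trivially.\<close>

lemma inner_unique:
  assumes "inner_of \<phi> y" "inner_of \<phi> y'"
  shows "y = y'"
proof -
  have y: "y \<in> par \<Lambda>" "y' \<in> par \<Lambda>" using assms by (auto simp: inner_of_def)
  have yc: "y \<in> carrier H" "y' \<in> carrier H" using y par_closed[OF Lam] by auto
  define t where "t = inv y \<otimes> y'"
  have tc: "t \<in> carrier H" and tp: "t \<in> par \<Lambda>" using y yc par_mult[OF Lam] par_inv[OF _ Lam] by (auto simp: t_def)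
  have ex: "\<exists>a\<in>carrier (G v). t = \<iota> v a" if v: "v \<in> \<Lambda>" for v
  proof -
    have vV: "v \<in> V" using v Lam by blast
    obtain a where a: "a \<in> carrier (G v)" "a \<noteq> \<one>\<^bsub>G v\<^esub>" using nontrivial_G vV by blast
    have "y \<otimes> \<iota> v a \<otimes> inv y = y' \<otimes> \<iota> v a \<otimes> inv y'"
    proof -
      have "y \<otimes> r (\<iota> v a) \<otimes> inv y = y' \<otimes> r (\<iota> v a) \<otimes> inv y'"
        using assms a vV unfolding inner_of_def by (metis iota_closed)
      then show ?thesis using v vV a by (simp add: retr_iota)
    qed
    then have "t \<otimes> \<iota> v a = \<iota> v a \<otimes> t" unfolding t_def using conj_cancel yc vV a by simp
    then have "t \<in> par (st v)" using centralizer tc vV a by blast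
    then obtain b s where b: "b \<in> carrier (G v)" "s \<in> par (nb v)" "t = \<iota> v b \<otimes> s" using par_st_decomp vV by blast
    have sc: "s \<in> carrier H" using par_closed[OF nb_subset b(2)] .
    have "nb v \<inter> \<Lambda> = {}" using nb_Lam v by auto
    then have "r s = \<one>" using retr_disjoint[OF b(2) nb_subset] by blast
    then have "r t = \<iota> v b" using b sc v vV by (simp add: retr_mult retr_iota)
    then show ?thesis using b retr_par[OF tp Lam] by auto
  qed
  obtain a b where ab: "a \<in> carrier (G x1)" "b \<in> carrier (G x2)" "t = \<iota> x1 a" "t = \<iota> x2 b" using ex by blast
  have "a = ab x1 t" using ab x1 by (simp add: ab_iota)
  also have "\<dots> = \<one>\<^bsub>G x1\<^esub>" using ab(4) x1 x2 x12 ab(2) by (simp add: ab_iota)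
  finally have "t = \<one>" using ab x1 by simp
  then have "y \<otimes> t = y" using yc by simp
  then show ?thesis using yc by (simp add: t_def)
qed

text \<open>\<open>c\<close> is unique up to \<open>par (st z)\<close>, on which \<open>r\<close> is
  trivial because \<open>st z\<close> avoids \<open>\<Lambda>\<close>.\<close>

lemma conj_z_unique:
  assumes "conj_z \<phi> c" "conj_z \<phi> c'"
  shows "r c = r c'"
proof -
  have c: "c \<in> carrier H" "c' \<in> carrier H" using assms by (auto simp: conj_z_def)
  obtain g where g: "g \<in> carrier (G z)" "g \<noteq> \<one>\<^bsub>G z\<^esub>" using nontrivial_G zV by blast
  have "c \<otimes> \<iota> z g \<otimes> inv c = c' \<otimes> \<iota> z g \<otimes> inv c'" using assms g by (auto simp: conj_z_def)
  then have "(inv c \<otimes> c') \<otimes> \<iota> z g = \<iota> z g \<otimes> (inv c \<otimes> c')" using conj_cancel c g zV by simp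
  then have "inv c \<otimes> c' \<in> par (st z)" using centralizer[OF _ zV g] c by simp
  then have "r (inv c \<otimes> c') = \<one>" using retr_disjoint[OF _ st_subset[OF zV] st_z] by blast
  then have "r c \<otimes> (inv (r c) \<otimes> r c') = r c" using c by (simp add: retr_mult retr_inv)
  then show ?thesis using c by simp
qed

lemma offset_eq:
  assumes "conj_z \<phi> c" "inner_of \<phi> y"
  shows "offset \<phi> = inv (r c) \<otimes> y"
proof -
  have "conj_z \<phi> (SOME c. conj_z \<phi> c)" using assms(1) by (rule someI)
  moreover have "inner_of \<phi> (SOME y. inner_of \<phi> y)" using assms(2) by (rule someI)
  ultimately show ?thesis using conj_z_unique[OF assms(1)] inner_unique[OF assms(2)] by (metis offset_def)
qed

lemma ex_conj_z: "\<phi> \<in> conj_auto \<Longrightarrow> \<exists>c. conj_z \<phi> c"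
  using uniform_conj[of \<phi> z] conj_auto_closed(2) zV unfolding conj_z_def conj_auto_def by blast

lemma ex_inner_of: "\<phi> \<in> conj_auto \<Longrightarrow> \<exists>y. inner_of \<phi> y"
  using retr_inner unfolding inner_of_def by blast

lemma offset_closed:
  assumes "\<phi> \<in> conj_auto"
  shows "offset \<phi> \<in> carrier H"
proof -
  obtain c y where cy: "conj_z \<phi> c" "inner_of \<phi> y" using ex_conj_z ex_inner_of assms by blast
  then show ?thesis using offset_eq[OF cy] par_closed[OF Lam] by (simp add: conj_z_def inner_of_def)
qed

text \<open>The conjugator of the product at \<open>z\<close> is
  \<open>\<phi> c' \<otimes> c\<close>, with the factors in the wrong order. Since \<open>r\<close>
  turns \<open>\<phi>\<close> into conjugation by \<open>y\<close>, the value
  \<open>r (\<phi> c')\<close> is \<open>y \<otimes> r c' \<otimes> inv y\<close>, and these factors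
  of \<open>y\<close> restore the order.\<close>

lemma offset_mult:
  assumes phi: "\<phi> \<in> conj_auto" and psi: "\<psi> \<in> conj_auto"
  shows "offset (\<phi> \<bullet> \<psi>) = offset \<phi> \<otimes> offset \<psi>"
proof -
  interpret P: group_hom H H \<phi> by (rule auto_group_hom[OF conj_auto_closed(1)[OF phi]])
  obtain c y where cy: "conj_z \<phi> c" "inner_of \<phi> y" using ex_conj_z ex_inner_of phi by blast
  obtain c' y' where cy': "conj_z \<psi> c'" "inner_of \<psi> y'" using ex_conj_z ex_inner_of psi by blast
  have cl: "c \<in> carrier H" "c' \<in> carrier H" "y \<in> par \<Lambda>" "y' \<in> par \<Lambda>" "y \<in> carrier H" "y' \<in> carrier H"
    using cy cy' par_closed[OF Lam] by (auto simp: conj_z_def inner_of_def)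
  have app: "(\<phi> \<bullet> \<psi>) x = \<phi> (\<psi> x)" if "x \<in> carrier H" for x
    using AutoGroup_apply conj_auto_closed(1) phi psi that by simp
  have 1: "conj_z (\<phi> \<bullet> \<psi>) (\<phi> c' \<otimes> c)"
    using cy cy' cl zV by (auto simp: conj_z_def app inv_mult_group m_assoc)
  have 2: "inner_of (\<phi> \<bullet> \<psi>) (y \<otimes> y')"
    using cy cy' cl par_mult[OF Lam] conj_auto_closed(3)[OF psi]
    by (auto simp: inner_of_def app inv_mult_group m_assoc)
  have "r (\<phi> c') = y \<otimes> r c' \<otimes> inv y" using cy(2) cl by (simp add: inner_of_def)
  then show ?thesis
    using offset_eq[OF 1 2] offset_eq[OF cy] offset_eq[OF cy'] cl by (simp add: retr_mult inv_mult_group m_assoc)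
qed

lemma Inn_conj_auto:
  assumes "\<phi> \<in> Inn H"
  shows "\<phi> \<in> conj_auto" "offset \<phi> = \<one>"
proof -
  interpret N: normal "Inn H" "AutoGroup H" by (rule Inn_normal[OF is_group])
  obtain g where g: "g \<in> carrier H" "\<phi> = (\<lambda>x\<in>carrier H. g \<otimes> x \<otimes> inv g)" using assms by (auto simp: Inn_def)
  show "\<phi> \<in> conj_auto" using g N.subset assms by (auto simp: conj_auto_def carrier_AutoGroup)
  have "conj_z \<phi> g" using g zV by (auto simp: conj_z_def)
  moreover have "inner_of \<phi> (r g)" using g retr_in_par[OF g(1) Lam] by (auto simp: inner_of_def retr_mult retr_inv)
  ultimately show "offset \<phi> = \<one>" using offset_eq g by simp
qed

definition twist :: "'v \<Rightarrow> 'a \<Rightarrow> 'v \<Rightarrow> 'a" where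
  "twist u s = (\<lambda>v\<in>V. if v \<in> C then s else \<one>\<^bsub>G u\<^esub>)"

text \<open>A vertex outside \<open>st u\<close> is not in the common link of \<open>x1\<close> and
  \<open>x2\<close>, so \<open>C\<close> is closed under adjacency outside
  \<open>st u\<close>.\<close>

lemma adm_twist:
  assumes "u \<in> \<Lambda>" "s \<in> carrier (G u)"
  shows "adm u (twist u s)"
proof -
  have u: "u \<in> V" using assms Lam by blast
  have Cu: "v \<notin> st u" if "v \<in> C" for v using C_st that assms by auto
  have cl: "v' \<in> C" if "v \<in> C" "v' \<in> V - st u" "adj v v'" for v v'
    using C_closed[of v v'] that assms by (auto simp: st_def nb_def)
  show ?thesis unfolding adm_def
  proof (intro conjI ballI impI)
    fix v v' assume v: "v \<in> V - st u" "v' \<in> V - st u" "adj v v'"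
    have "v \<in> C \<longleftrightarrow> v' \<in> C" using cl[of v v'] cl[of v' v] adj_sym[OF v(3)] v by blast
    then show "twist u s v = twist u s v'" using v by (simp add: twist_def)
  qed (use u assms(2) Cu in \<open>auto simp: twist_def\<close>)
qed

text \<open>The map conjugates \<open>G z\<close> by \<open>\<iota> u s\<close> but fixes the vertex
  groups of \<open>\<Lambda>\<close>, so here \<open>c = \<iota> u s\<close> and
  \<open>y = \<one>\<close>.\<close>

lemma pconj_twist:
  assumes "u \<in> \<Lambda>" "s \<in> carrier (G u)"
  shows "pconj u (twist u s) \<in> conj_auto" "offset (pconj u (twist u s)) = \<iota> u (inv\<^bsub>G u\<^esub> s)"
proof -
  have u: "u \<in> V" using assms Lam by blast
  note adm = adm_twist[OF assms]
  let ?p = "pconj u (twist u s)"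
  have iota: "?p (\<iota> v g) = \<iota> u (twist u s v) \<otimes> \<iota> v g \<otimes> inv (\<iota> u (twist u s v))"
    if "v \<in> V" "g \<in> carrier (G v)" for v g using pconj_iota[OF adm u that] .
  have tc: "twist u s v \<in> carrier (G u)" if "v \<in> V" for v using adm_closed[OF adm that] .
  show ca: "?p \<in> conj_auto" using pconj_auto[OF adm u] iota tc u by (auto simp: conj_auto_def intro!: bexI[of _ "\<iota> u (twist u s v)" for v])
  interpret P: group_hom H H ?p by (rule auto_group_hom[OF conj_auto_closed(1)[OF ca]])
  have "conj_z ?p (\<iota> u s)" using iota[OF zV] zV C u assms by (auto simp: conj_z_def twist_def)
  moreover have "inner_of ?p \<one>"
  proof -
    have 1: "(\<lambda>x. r (?p x)) \<in> hom H H" by (auto intro!: homI simp: retr_mult)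
    have "r (?p x) = r x" if x: "x \<in> carrier H" for x
    proof (rule hom_ext[OF is_group 1 retr_hom _ x])
      fix v g assume v: "v \<in> V" "g \<in> carrier (G v)"
      show "r (?p (\<iota> v g)) = r (\<iota> v g)"
      proof (cases "v \<in> C")
        case True
        then have "v \<notin> \<Lambda>" using C by auto
        then show ?thesis using v u tc by (simp add: iota retr_mult retr_iota retr_inv)
      next
        case False
        then show ?thesis using v u by (simp add: iota) (simp add: twist_def)
      qed
    qed
    then show ?thesis by (simp add: inner_of_def)
  qed
  ultimately have "offset ?p = inv (r (\<iota> u s)) \<otimes> \<one>" by (rule offset_eq)
  then show "offset ?p = \<iota> u (inv\<^bsub>G u\<^esub> s)" using u assms by (auto simp: retr_iota iota_inv)
qed

section \<open>A translation number on the free product\<close>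

text \<open>
  \<open>G\<^bsub>x\<^sub>1\<^esub> * G\<^bsub>x\<^sub>2\<^esub>\<close> acts on a \<open>\<int>\<close>-cover of \<open>G\<^bsub>x\<^sub>1\<^esub> \<times> G\<^bsub>x\<^sub>2\<^esub>\<close>; the action of \<open>G\<^bsub>x\<^sub>2\<^esub>\<close> is the product action conjugated
  by \<open>(p, q, n) \<mapsto> (p, q, n + ind p q)\<close>.
\<close>

definition cover :: "('a \<times> 'a \<times> int) set" where "cover = carrier (G x1) \<times> carrier (G x2) \<times> UNIV"

definition ind :: "'a \<Rightarrow> 'a \<Rightarrow> int" where
  "ind p q = (if p = \<one>\<^bsub>G x1\<^esub> \<and> q = \<one>\<^bsub>G x2\<^esub> then 1 else 0)"

definition shift :: "'v \<Rightarrow> 'a \<Rightarrow> 'a \<times> 'a \<times> int \<Rightarrow> 'a \<times> 'a \<times> int" where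
  "shift v s = (\<lambda>(p, q, n)\<in>cover. if v = x1 then (s \<otimes>\<^bsub>G x1\<^esub> p, q, n)
     else if v = x2 then (p, s \<otimes>\<^bsub>G x2\<^esub> q, n + ind p (s \<otimes>\<^bsub>G x2\<^esub> q) - ind p q) else (p, q, n))"

lemma shift_closed: "\<lbrakk>v \<in> V; s \<in> carrier (G v); x \<in> cover\<rbrakk> \<Longrightarrow> shift v s x \<in> cover"
  using x1 x2 by (auto simp: shift_def cover_def)

lemma shift_mult: "\<lbrakk>v \<in> V; s \<in> carrier (G v); t \<in> carrier (G v); x \<in> cover\<rbrakk>
    \<Longrightarrow> shift v (s \<otimes>\<^bsub>G v\<^esub> t) x = shift v s (shift v t x)"
  using x1 x2 by (auto simp: shift_def cover_def G_assoc)

lemma shift_one: "\<lbrakk>v \<in> V; x \<in> cover\<rbrakk> \<Longrightarrow> shift v \<one>\<^bsub>G v\<^esub> x = x"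
  using x1 x2 by (auto simp: shift_def cover_def)

lemma shift_Bij:
  assumes "v \<in> V" "s \<in> carrier (G v)"
  shows "shift v s \<in> Bij cover"
proof -
  have "bij_betw (shift v s) cover cover"
    by (rule bij_betwI[of _ _ _ "shift v (inv\<^bsub>G v\<^esub> s)"])
      (use assms shift_closed shift_one in \<open>auto simp flip: shift_mult\<close>)
  then show ?thesis by (auto simp: Bij_def shift_def)
qed

definition \<rho> :: "'h \<Rightarrow> 'a \<times> 'a \<times> int \<Rightarrow> 'a \<times> 'a \<times> int" where
  "\<rho> = lift (BijGroup cover) shift"

lemma rho_hom: "\<rho> \<in> hom H (BijGroup cover)"
  and rho_iota: "\<lbrakk>v \<in> V; s \<in> carrier (G v)\<rbrakk> \<Longrightarrow> \<rho> (\<iota> v s) = shift v s"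
proof -
  have K: "group (BijGroup cover)" by (rule group_BijGroup)
  have mult: "shift u s \<otimes>\<^bsub>BijGroup cover\<^esub> shift v t = compose cover (shift u s) (shift v t)"
    if "u \<in> V" "v \<in> V" "s \<in> carrier (G u)" "t \<in> carrier (G v)" for u v s t
    using shift_Bij that by (simp add: BijGroup_def)
  have 1: "shift v \<in> hom (G v) (BijGroup cover)" if v: "v \<in> V" for v
  proof (rule homI)
    fix s t assume st: "s \<in> carrier (G v)" "t \<in> carrier (G v)"
    have "shift v (s \<otimes>\<^bsub>G v\<^esub> t) x = compose cover (shift v s) (shift v t) x" for x
      using shift_mult[OF v st, of x] by (cases "x \<in> cover") (auto simp: compose_def shift_def)
    then show "shift v (s \<otimes>\<^bsub>G v\<^esub> t) = shift v s \<otimes>\<^bsub>BijGroup cover\<^esub> shift v t" using mult v st by auto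
  qed (use v shift_Bij in \<open>auto simp: BijGroup_def\<close>)
  have 2: "shift u s \<otimes>\<^bsub>BijGroup cover\<^esub> shift v t = shift v t \<otimes>\<^bsub>BijGroup cover\<^esub> shift u s"
    if uv: "u \<in> V" "v \<in> V" "adj u v" "s \<in> carrier (G u)" "t \<in> carrier (G v)" for u v s t
  proof -
    have triv: "shift w b x = x" if "w \<notin> \<Lambda>" "x \<in> cover" for w b x using that by (auto simp: shift_def)
    have "\<not> (u \<in> \<Lambda> \<and> v \<in> \<Lambda>)" using uv x12 adj_sym adj_irrefl by auto
    then consider "u \<notin> \<Lambda>" | "v \<notin> \<Lambda>" by blast
    then have "shift u s (shift v t x) = shift v t (shift u s x)" if x: "x \<in> cover" for x
    proof cases
      case 1
      then show ?thesis using triv[OF 1 x] triv[OF 1 shift_closed[OF uv(2,5) x]] by simp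
    next
      case 2
      then show ?thesis using triv[OF 2 x] triv[OF 2 shift_closed[OF uv(1,4) x]] by simp
    qed
    then have "compose cover (shift u s) (shift v t) = compose cover (shift v t) (shift u s)"
      by (auto simp: compose_def)
    then show ?thesis using mult uv by auto
  qed
  show "\<rho> \<in> hom H (BijGroup cover)" unfolding \<rho>_def by (rule lift_hom[OF K 1 2])
  show "\<rho> (\<iota> v s) = shift v s" if "v \<in> V" "s \<in> carrier (G v)"
    unfolding \<rho>_def by (rule lift_iota[OF K 1 2 that])
qed

lemma rho_mult: "\<lbrakk>g \<in> carrier H; h \<in> carrier H; x \<in> cover\<rbrakk> \<Longrightarrow> \<rho> (g \<otimes> h) x = \<rho> g (\<rho> h x)"
  using hom_mult[OF rho_hom, of g h] hom_in_carrier[OF rho_hom, of g] hom_in_carrier[OF rho_hom, of h]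
  by (simp add: BijGroup_def compose_def)

lemma rho_one: "x \<in> cover \<Longrightarrow> \<rho> \<one> x = x"
  using hom_one[OF rho_hom is_group group_BijGroup] by (simp add: BijGroup_def)

text \<open>The change of the third coordinate depends on the first two only, so the action commutes
  with translations in \<open>n\<close>. An element killed by \<open>ab x1\<close> and
  \<open>ab x2\<close> thus translates the fibre over the base point, and \<open>tau_mult\<close>
  adds up these translations.\<close>

lemma rho_form:
  "g \<in> carrier H \<Longrightarrow> \<exists>k. \<forall>p\<in>carrier (G x1). \<forall>q\<in>carrier (G x2). \<forall>n.
    \<rho> g (p, q, n) = (ab x1 g \<otimes>\<^bsub>G x1\<^esub> p, ab x2 g \<otimes>\<^bsub>G x2\<^esub> q, n + k p q)"
proof (induction rule: gen_induct)
  case one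
  then show ?case using x1 x2 by (intro exI[of _ "\<lambda>p q. 0"]) (auto simp: rho_one cover_def)
next
  case (mult v s y)
  then obtain k where k: "\<And>p q n. \<lbrakk>p \<in> carrier (G x1); q \<in> carrier (G x2)\<rbrakk> \<Longrightarrow>
    \<rho> y (p, q, n) = (ab x1 y \<otimes>\<^bsub>G x1\<^esub> p, ab x2 y \<otimes>\<^bsub>G x2\<^esub> q, n + k p q)" by blast
  define k' where "k' p q = (if v = x2 then ind (ab x1 y \<otimes>\<^bsub>G x1\<^esub> p) (s \<otimes>\<^bsub>G x2\<^esub> (ab x2 y \<otimes>\<^bsub>G x2\<^esub> q))
    - ind (ab x1 y \<otimes>\<^bsub>G x1\<^esub> p) (ab x2 y \<otimes>\<^bsub>G x2\<^esub> q) else 0) + k p q" for p q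
  have "\<rho> (\<iota> v s \<otimes> y) (p, q, n) = (ab x1 (\<iota> v s \<otimes> y) \<otimes>\<^bsub>G x1\<^esub> p, ab x2 (\<iota> v s \<otimes> y) \<otimes>\<^bsub>G x2\<^esub> q, n + k' p q)"
    if pq: "p \<in> carrier (G x1)" "q \<in> carrier (G x2)" for p q n
  proof -
    have "\<rho> (\<iota> v s \<otimes> y) (p, q, n) = shift v s (ab x1 y \<otimes>\<^bsub>G x1\<^esub> p, ab x2 y \<otimes>\<^bsub>G x2\<^esub> q, n + k p q)"
      using mult pq k[OF pq] by (simp add: rho_mult rho_iota cover_def)
    then show ?thesis
      using mult pq x1 x2 x12 by (auto simp: shift_def cover_def ab_mult ab_iota k'_def G_assoc)
  qed
  then show ?case by blast
qed

definition base :: "'a \<times> 'a \<times> int" where "base = (\<one>\<^bsub>G x1\<^esub>, \<one>\<^bsub>G x2\<^esub>, 0)"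

definition Ker :: "('h \<Rightarrow> 'h) set" where
  "Ker = {\<phi> \<in> conj_auto. ab x1 (offset \<phi>) = \<one>\<^bsub>G x1\<^esub> \<and> ab x2 (offset \<phi>) = \<one>\<^bsub>G x2\<^esub>}"

definition \<tau> :: "('h \<Rightarrow> 'h) \<Rightarrow> real" where "\<tau> \<phi> = of_int (snd (snd (\<rho> (offset \<phi>) base)))"

lemma tau_mult:
  assumes "\<phi> \<in> Ker" "\<psi> \<in> Ker"
  shows "\<tau> (\<phi> \<bullet> \<psi>) = \<tau> \<phi> + \<tau> \<psi>"
proof -
  have N: "\<phi> \<in> conj_auto" "\<psi> \<in> conj_auto" "offset \<phi> \<in> carrier H" "offset \<psi> \<in> carrier H"
    using assms offset_closed by (auto simp: Ker_def)
  have b: "base \<in> cover" using x1 x2 by (simp add: base_def cover_def)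
  have ex: "\<exists>k. \<forall>n. \<rho> (offset \<chi>) (\<one>\<^bsub>G x1\<^esub>, \<one>\<^bsub>G x2\<^esub>, n) = (\<one>\<^bsub>G x1\<^esub>, \<one>\<^bsub>G x2\<^esub>, n + k)" if "\<chi> \<in> Ker" for \<chi>
  proof -
    have c: "offset \<chi> \<in> carrier H" and ab: "ab x1 (offset \<chi>) = \<one>\<^bsub>G x1\<^esub>" "ab x2 (offset \<chi>) = \<one>\<^bsub>G x2\<^esub>"
      using that offset_closed by (auto simp: Ker_def)
    obtain k where "\<forall>p\<in>carrier (G x1). \<forall>q\<in>carrier (G x2). \<forall>n.
      \<rho> (offset \<chi>) (p, q, n) = (ab x1 (offset \<chi>) \<otimes>\<^bsub>G x1\<^esub> p, ab x2 (offset \<chi>) \<otimes>\<^bsub>G x2\<^esub> q, n + k p q)" using rho_form[OF c] by blast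
    then show ?thesis using ab x1 x2 by (intro exI[of _ "k \<one>\<^bsub>G x1\<^esub> \<one>\<^bsub>G x2\<^esub>"]) simp
  qed
  obtain k where k: "\<forall>n. \<rho> (offset \<phi>) (\<one>\<^bsub>G x1\<^esub>, \<one>\<^bsub>G x2\<^esub>, n) = (\<one>\<^bsub>G x1\<^esub>, \<one>\<^bsub>G x2\<^esub>, n + k)"
    using ex[OF assms(1)] ..
  obtain l where l: "\<forall>n. \<rho> (offset \<psi>) (\<one>\<^bsub>G x1\<^esub>, \<one>\<^bsub>G x2\<^esub>, n) = (\<one>\<^bsub>G x1\<^esub>, \<one>\<^bsub>G x2\<^esub>, n + l)"
    using ex[OF assms(2)] ..
  show ?thesis using rho_mult[OF N(3,4) b] by (simp add: \<tau>_def offset_mult N base_def k l)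
qed

lemma offset_one: "offset aone = \<one>"
proof -
  interpret N: normal "Inn H" "AutoGroup H" by (rule Inn_normal[OF is_group])
  show ?thesis using Inn_conj_auto(2)[OF subgroup.one_closed[OF N.subgroup_axioms]] .
qed

lemma offset_inv:
  assumes "\<phi> \<in> conj_auto"
  shows "offset (ainv \<phi>) = inv (offset \<phi>)"
proof -
  interpret A: group "AutoGroup H" by (rule AutoGroup)
  have i: "ainv \<phi> \<in> conj_auto" using subgroup.m_inv_closed[OF subgroup_conj_auto assms] .
  have "offset (ainv \<phi>) \<otimes> offset \<phi> = \<one>"
    using offset_mult[OF i assms] offset_one conj_auto_closed(1)[OF assms] by (simp add: carrier_AutoGroup)
  then show ?thesis using inv_equality offset_closed i assms by metis
qed

lemma subgroup_Ker: "subgroup Ker (AutoGroup H)"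
proof (rule subgroup.intro)
  interpret A: group "AutoGroup H" by (rule AutoGroup)
  note sub = subgroup_conj_auto
  show "Ker \<subseteq> carrier (AutoGroup H)" using subgroup.subset[OF sub] by (auto simp: Ker_def)
  show "\<phi> \<bullet> \<psi> \<in> Ker" if "\<phi> \<in> Ker" "\<psi> \<in> Ker" for \<phi> \<psi>
    using that x1 x2 offset_closed subgroup.m_closed[OF sub] by (auto simp: Ker_def offset_mult ab_mult)
  show "aone \<in> Ker" using subgroup.one_closed[OF sub] x1 x2 by (simp add: Ker_def offset_one)
  show "ainv \<phi> \<in> Ker" if "\<phi> \<in> Ker" for \<phi>
    using that x1 x2 offset_closed subgroup.m_inv_closed[OF sub] by (auto simp: Ker_def offset_inv ab_inv)
qed

text \<open>\<open>conj_auto\<close> has finite index, and inside it \<open>Ker\<close> is cut out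
  by a map to the finite group \<open>G x1 \<times> G x2\<close>.\<close>

lemma Ker_finite_index:
  "\<exists>S. finite S \<and> S \<subseteq> carrier (AutoGroup H) \<and>
    (\<forall>\<phi>\<in>carrier (AutoGroup H). \<exists>s\<in>S. ainv s \<bullet> \<phi> \<in> Ker)"
proof -
  interpret A: group "AutoGroup H" by (rule AutoGroup)
  obtain D where D: "finite D" "D \<subseteq> auto H"
    "\<And>\<phi>. \<phi> \<in> auto H \<Longrightarrow> \<exists>d\<in>D. ainv d \<bullet> \<phi> \<in> conj_auto"
    using conj_auto_finite_index by blast
  let ?q = "\<lambda>\<phi>. (ab x1 (offset \<phi>), ab x2 (offset \<phi>))"
  have "?q ` conj_auto \<subseteq> carrier (G x1) \<times> carrier (G x2)" using offset_closed x1 x2 by auto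
  then have "finite (?q ` conj_auto)" using finite_G x1 x2 by (meson finite_SigmaI finite_subset)
  from finite_image_reps[OF this] obtain E
    where E: "finite E" "E \<subseteq> conj_auto" "\<forall>\<phi>\<in>conj_auto. \<exists>e\<in>E. ?q e = ?q \<phi>" by (elim exE conjE)
  have ca: "\<phi> \<in> auto H" if "\<phi> \<in> conj_auto" for \<phi> using conj_auto_closed(1)[OF that] .
  show ?thesis
  proof (intro exI[of _ "(\<lambda>(d, e). d \<bullet> e) ` (D \<times> E)"] conjI ballI)
    show "finite ((\<lambda>(d, e). d \<bullet> e) ` (D \<times> E))" using D E by auto
    show "(\<lambda>(d, e). d \<bullet> e) ` (D \<times> E) \<subseteq> carrier (AutoGroup H)"
      using D E ca A.m_closed by (auto simp: carrier_AutoGroup subset_iff)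
    fix \<phi> assume phi: "\<phi> \<in> carrier (AutoGroup H)"
    then obtain d where d: "d \<in> D" "ainv d \<bullet> \<phi> \<in> conj_auto"
      using D(3) by (auto simp: carrier_AutoGroup)
    let ?c = "ainv d \<bullet> \<phi>"
    obtain e where e: "e \<in> E" "?q e = ?q ?c" using bspec[OF E(3) d(2)] by (elim bexE)
    have eca: "e \<in> conj_auto" using e E by auto
    have ie: "ainv e \<in> conj_auto" using subgroup.m_inv_closed[OF subgroup_conj_auto eca] .
    have "ainv e \<bullet> ?c \<in> Ker"
      using e offset_closed[OF d(2)] offset_closed[OF eca] x1 x2 subgroup.m_closed[OF subgroup_conj_auto ie d(2)]
      by (auto simp: Ker_def offset_mult[OF ie d(2)] offset_inv[OF eca] ab_mult ab_inv)
    moreover have "d \<in> carrier (AutoGroup H)" "e \<in> carrier (AutoGroup H)"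
      using d e D E ca by (auto simp: carrier_AutoGroup)
    then have "ainv (d \<bullet> e) \<bullet> \<phi> = ainv e \<bullet> ?c"
      using phi by (simp add: A.inv_mult_group A.m_assoc)
    ultimately show "\<exists>s\<in>(\<lambda>(d, e). d \<bullet> e) ` (D \<times> E). ainv s \<bullet> \<phi> \<in> Ker"
      using d e by (intro bexI[of _ "d \<bullet> e"]) auto
  qed
qed

text \<open>The commutator of \<open>a\<close> and \<open>b\<close> traces a square in
  \<open>G x1 \<times> G x2\<close>. Only one of its two edges in the direction of \<open>x2\<close>
  has an end at the base point, so the contributions of \<open>ind\<close> do not cancel.\<close>

lemma ex_tau_nonzero: "\<exists>\<phi>\<in>Ker. \<tau> \<phi> \<noteq> 0"
proof -
  interpret A: group "AutoGroup H" by (rule AutoGroup)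
  obtain a where a: "a \<in> carrier (G x1)" "a \<noteq> \<one>\<^bsub>G x1\<^esub>" using nontrivial_G x1 by blast
  obtain b where b: "b \<in> carrier (G x2)" "b \<noteq> \<one>\<^bsub>G x2\<^esub>" using nontrivial_G x2 by blast
  \<comment> \<open>\<open>pconj_twist\<close> returns the inverse, so the inverse is put in to give
    \<open>P u s\<close> the offset \<open>\<iota> u s\<close>.\<close>
  define P where "P u s = pconj u (twist u (inv\<^bsub>G u\<^esub> s))" for u s
  have P: "P u s \<in> conj_auto" "offset (P u s) = \<iota> u s" if "u \<in> \<Lambda>" "s \<in> carrier (G u)" for u s
    using pconj_twist[of u "inv\<^bsub>G u\<^esub> s"] that x1 x2 by (auto simp: P_def)
  let ?a' = "inv\<^bsub>G x1\<^esub> a" and ?b' = "inv\<^bsub>G x2\<^esub> b"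
  have ib: "?a' \<in> carrier (G x1)" "?b' \<in> carrier (G x2)" "?b' \<noteq> \<one>\<^bsub>G x2\<^esub>" "?a' \<noteq> \<one>\<^bsub>G x1\<^esub>"
  proof -
    show "?a' \<in> carrier (G x1)" "?b' \<in> carrier (G x2)" using a b x1 x2 by auto
    show "?b' \<noteq> \<one>\<^bsub>G x2\<^esub>" "?a' \<noteq> \<one>\<^bsub>G x1\<^esub>" using a b x1 x2 G_simps(5,6) by metis+
  qed
  define \<phi> where "\<phi> = P x1 a \<bullet> (P x2 b \<bullet> (P x1 ?a' \<bullet> P x2 ?b'))"
  note cl = subgroup.m_closed[OF subgroup_conj_auto]
  have Pc: "P x1 a \<in> conj_auto" "P x2 b \<in> conj_auto" "P x1 ?a' \<in> conj_auto" "P x2 ?b' \<in> conj_auto"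
    using P a b ib by auto
  have phi: "\<phi> \<in> conj_auto" unfolding \<phi>_def using Pc cl by blast
  have offset: "offset \<phi> = \<iota> x1 a \<otimes> (\<iota> x2 b \<otimes> (\<iota> x1 ?a' \<otimes> \<iota> x2 ?b'))"
    unfolding \<phi>_def using Pc cl P a b ib by (simp add: offset_mult)
  have "\<phi> \<in> Ker" using phi a b ib x1 x2 x12 by (simp add: Ker_def offset ab_mult ab_iota)
  moreover have "\<tau> \<phi> = -1"
  proof -
    have pcover: "(p, q, n) \<in> cover \<longleftrightarrow> p \<in> carrier (G x1) \<and> q \<in> carrier (G x2)" for p q n by (simp add: cover_def)
    have 1: "\<rho> (\<iota> x2 ?b') base = (\<one>\<^bsub>G x1\<^esub>, ?b', -1)"
      using ib x1 x2 x12 by (simp add: rho_iota base_def shift_def pcover ind_def)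
    have 2: "\<rho> (\<iota> x1 ?a') (\<one>\<^bsub>G x1\<^esub>, ?b', -1) = (?a', ?b', -1)"
      using ib x1 x2 x12 by (simp add: rho_iota shift_def pcover)
    have 3: "\<rho> (\<iota> x2 b) (?a', ?b', -1) = (?a', \<one>\<^bsub>G x2\<^esub>, -1)"
      using ib b x1 x2 x12 by (simp add: rho_iota shift_def pcover ind_def)
    have 4: "\<rho> (\<iota> x1 a) (?a', \<one>\<^bsub>G x2\<^esub>, -1) = (\<one>\<^bsub>G x1\<^esub>, \<one>\<^bsub>G x2\<^esub>, -1)"
      using ib a x1 x2 x12 by (simp add: rho_iota shift_def pcover)
    have "base \<in> cover" using x1 x2 by (simp add: base_def cover_def)
    then have "\<rho> (offset \<phi>) base = (\<one>\<^bsub>G x1\<^esub>, \<one>\<^bsub>G x2\<^esub>, -1)"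
      unfolding offset using a b ib x1 x2 by (simp add: rho_mult 1 2 3 4)
    then show ?thesis by (simp add: \<tau>_def)
  qed
  ultimately show ?thesis by (intro bexI[of _ \<phi>]) auto
qed

theorem Out_not_property_T: "\<not> property_T (Out H)"
proof -
  obtain \<phi> where "\<phi> \<in> Ker" "\<tau> \<phi> \<noteq> 0" using ex_tau_nonzero by blast
  moreover have "Inn H \<subseteq> Ker" using Inn_conj_auto x1 x2 by (auto simp: Ker_def)
  moreover have "\<tau> i = 0" if "i \<in> Inn H" for i
    using Inn_conj_auto(2)[OF that] rho_one[of base] x1 x2 by (simp add: \<tau>_def base_def cover_def)
  ultimately show ?thesis unfolding Out_def
    by (intro not_property_T_Mod[of _ _ Ker \<tau>] AutoGroup Inn_normal is_group subgroup_Ker Ker_finite_index tau_mult)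
qed

end

section \<open>Graph products and standard presentations\<close>

lemma gp_rel_append:
  assumes "(u, u') \<in> gp_rel V adj G" "(w, w') \<in> gp_rel V adj G" "vertex_groups V adj G"
  shows "(u @ w, u' @ w') \<in> gp_rel V adj G"
proof -
  interpret vertex_groups V adj G by fact
  have "(u @ w, u' @ w) \<in> gp_rel V adj G"
    using gp_rel.cong[OF assms(1), of "[]" w] gp_rel_words[OF assms(2)] by simp
  moreover have "(u' @ w, u' @ w') \<in> gp_rel V adj G"
    using gp_rel.cong[OF assms(2), of u' "[]"] gp_rel_words[OF assms(1)] by simp
  ultimately show ?thesis by (rule gp_rel.trans)
qed

text \<open>Inverses enter as elements with product \<open>\<one>\<close>, which also suits
  residues, where they arise as \<open>(-1) mod int (p v)\<close>.\<close>

lemma gp_rel_commutator: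
  assumes "vertex_groups V adj G" and uv: "u \<in> V" "v \<in> V" "adj u v"
    and g: "g \<in> carrier (G u)" "g' \<in> carrier (G u)" "g \<otimes>\<^bsub>G u\<^esub> g' = \<one>\<^bsub>G u\<^esub>"
    and h: "h \<in> carrier (G v)" "h' \<in> carrier (G v)" "h \<otimes>\<^bsub>G v\<^esub> h' = \<one>\<^bsub>G v\<^esub>"
  shows "([(u, g), (v, h), (u, g'), (v, h')], []) \<in> gp_rel V adj G"
proof -
  interpret vertex_groups V adj G by fact
  have canc: "([(w, s), (w, s')], []) \<in> gp_rel V adj G"
    if "w \<in> V" "s \<in> carrier (G w)" "s' \<in> carrier (G w)" "s \<otimes>\<^bsub>G w\<^esub> s' = \<one>\<^bsub>G w\<^esub>" for w s s'
    using gp_rel.trans[OF gp_rel.mult[of w V s G s']] gp_rel.one[of w V G] that by simp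
  have "([(u, g)] @ [(v, h), (u, g')] @ [(v, h')], [(u, g)] @ [(u, g'), (v, h)] @ [(v, h')]) \<in> gp_rel V adj G"
    by (rule gp_rel.cong[OF gp_rel.comm]) (use assms adj_sym in auto)
  moreover have "([(u, g), (u, g')] @ [(v, h), (v, h')], [] @ []) \<in> gp_rel V adj G"
    by (rule gp_rel_append[OF canc canc vertex_groups_axioms]) (use uv g h in auto)
  ultimately show ?thesis by (auto intro: gp_rel.trans)
qed

text \<open>Rewrites the letters of a free product (no two vertices adjacent) as words of a graph
  product, to prove \<open>faithful\<close> for a quotient of that free product. The two instances
  delete syllables of trivial vertex groups and reduce integer exponents modulo
  \<open>p v\<close>.\<close>

locale word_map =
  src: vertex_groups V "\<lambda>_ _. False" G + tgt: vertex_groups V' adj G'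
  for V :: "'v set" and G :: "'v \<Rightarrow> ('a, 'm) monoid_scheme"
    and V' :: "'w set" and adj and G' :: "'w \<Rightarrow> ('b, 'n) monoid_scheme" +
  fixes M :: "'v \<Rightarrow> 'a \<Rightarrow> ('w \<times> 'b) list"
  assumes M_words: "\<lbrakk>v \<in> V; g \<in> carrier (G v)\<rbrakk> \<Longrightarrow> M v g \<in> fp_words V' G'"
    and M_one: "v \<in> V \<Longrightarrow> (M v \<one>\<^bsub>G v\<^esub>, []) \<in> gp_rel V' adj G'"
    and M_mult: "\<lbrakk>v \<in> V; g \<in> carrier (G v); h \<in> carrier (G v)\<rbrakk>
      \<Longrightarrow> (M v g @ M v h, M v (g \<otimes>\<^bsub>G v\<^esub> h)) \<in> gp_rel V' adj G'"
begin

abbreviation F :: "('v \<times> 'a) list set monoid" where "F \<equiv> free_product V G"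
abbreviation cls :: "('v \<times> 'a) list \<Rightarrow> ('v \<times> 'a) list set" where "cls w \<equiv> fp_rel V G `` {w}"
abbreviation rel (infix "\<approx>" 50) where "w \<approx> w' \<equiv> (w, w') \<in> gp_rel V' adj G'"

definition Mw :: "('v \<times> 'a) list \<Rightarrow> ('w \<times> 'b) list" where
  "Mw w = concat (map (\<lambda>(v, g). M v g) w)"

lemma Mw_simps [simp]: "Mw [] = []" "Mw ((v, g) # w) = M v g @ Mw w" "Mw (u @ w) = Mw u @ Mw w"
  by (simp_all add: Mw_def)

lemma Mw_words: "w \<in> fp_words V G \<Longrightarrow> Mw w \<in> fp_words V' G'"
  by (induction w) (auto simp: M_words)

lemma Mw_refl: "w \<in> fp_words V G \<Longrightarrow> Mw w \<approx> Mw w"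
  by (intro gp_rel.refl Mw_words)

lemmas app = gp_rel_append[OF _ _ tgt.vertex_groups_axioms]

lemma Mw_rel: "(w, w') \<in> fp_rel V G \<Longrightarrow> Mw w \<approx> Mw w'"
proof (induction rule: fp_rel.induct)
  case (trans u w x)
  then show ?case by (meson gp_rel.trans)
next
  case (cong u w p q)
  then show ?case by (auto intro!: app Mw_refl)
next
  case (mult v g h)
  then show ?case using M_mult by simp
qed (auto simp: M_one intro: gp_rel.sym Mw_refl)

sublocale F: group F
  using src.group_G by (rule group_free_product)

lemma F_mult: "\<lbrakk>u \<in> fp_words V G; w \<in> fp_words V G\<rbrakk> \<Longrightarrow> cls u \<otimes>\<^bsub>F\<^esub> cls w = cls (u @ w)"
  using free_product_mult_class[of V G] src.group_G by blast

lemma F_one: "\<one>\<^bsub>F\<^esub> = cls []"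
  by (simp add: free_product_def)

lemma F_carrier: "carrier F = cls ` fp_words V G"
  by (auto simp: free_product_def quotient_def)

lemma cls_eq: "\<lbrakk>u \<in> fp_words V G; w \<in> fp_words V G; cls u = cls w\<rbrakk> \<Longrightarrow> Mw u \<approx> Mw w"
  using Mw_rel eq_equiv_class[OF _ equiv_fp_rel[of V G]] src.group_G by metis

lemma ex_inverse_word:
  assumes "w \<in> fp_words V G"
  shows "\<exists>u\<in>fp_words V G. cls u = inv\<^bsub>F\<^esub> cls w"
proof -
  have "inv\<^bsub>F\<^esub> cls w \<in> cls ` fp_words V G" using F.inv_closed[of "cls w"] assms F_carrier by simp
  then obtain u where u: "inv\<^bsub>F\<^esub> cls w = cls u" "u \<in> fp_words V G" by (rule imageE)
  show ?thesis using u(1)[symmetric] u(2) by (rule bexI)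
qed

lemma inverse_word:
  assumes "w \<in> fp_words V G" "u \<in> fp_words V G" "cls u = inv\<^bsub>F\<^esub> cls w"
  shows "Mw u @ Mw w \<approx> []" "Mw w @ Mw u \<approx> []"
proof -
  have c: "cls w \<in> carrier F" using assms F_carrier by auto
  have "cls (u @ w) = cls []" "cls (w @ u) = cls []"
    using F.l_inv[OF c] F.r_inv[OF c] F_mult[of u w] F_mult[of w u] assms F_one by auto
  then show "Mw u @ Mw w \<approx> []" "Mw w @ Mw u \<approx> []"
    using cls_eq[of "u @ w" "[]"] cls_eq[of "w @ u" "[]"] assms by auto
qed

text \<open>The kernel of the map that \<open>Mw\<close> induces from the free product to words
  modulo \<open>gp_rel\<close>.\<close>

definition K :: "('v \<times> 'a) list set set" where "K = {cls w | w. w \<in> fp_words V G \<and> Mw w \<approx> []}"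

lemma K_iff: "w \<in> fp_words V G \<Longrightarrow> cls w \<in> K \<longleftrightarrow> Mw w \<approx> []"
proof
  assume w: "w \<in> fp_words V G" and "cls w \<in> K"
  then obtain u where "u \<in> fp_words V G" "Mw u \<approx> []" "cls w = cls u" by (auto simp: K_def)
  then show "Mw w \<approx> []" using cls_eq[of w u] w gp_rel.trans by metis
qed (auto simp: K_def)

lemma subgroup_K: "subgroup K F"
proof (rule F.subgroupI)
  show "K \<subseteq> carrier F" by (auto simp: K_def F_carrier)
  show "K \<noteq> {}" using K_iff[of "[]"] gp_rel.refl[of "[]" V' G'] by auto
  fix a assume "a \<in> K"
  then obtain w where w: "w \<in> fp_words V G" "Mw w \<approx> []" "a = cls w" by (auto simp: K_def)
  obtain u where u: "u \<in> fp_words V G" "cls u = inv\<^bsub>F\<^esub> cls w" using ex_inverse_word w by blast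
  have "Mw u \<approx> Mw u @ Mw w" using app[OF Mw_refl[OF u(1)] gp_rel.sym[OF w(2)]] by simp
  then have "Mw u \<approx> []" using inverse_word(1)[OF w(1) u] gp_rel.trans by blast
  then show "inv\<^bsub>F\<^esub> a \<in> K" using K_iff[OF u(1)] u w by simp
next
  fix a b assume "a \<in> K" "b \<in> K"
  then obtain w w' where w: "w \<in> fp_words V G" "Mw w \<approx> []" "a = cls w"
    "w' \<in> fp_words V G" "Mw w' \<approx> []" "b = cls w'" by (auto simp: K_def)
  then show "a \<otimes>\<^bsub>F\<^esub> b \<in> K" using app[OF w(2,5)] K_iff[of "w @ w'"] by (simp add: F_mult)
qed

lemma normal_closure_K:
  assumes "S \<subseteq> K"
  shows "normal_closure F S \<subseteq> K"
  unfolding normal_closure_def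
proof (rule F.generate_subgroup_incl[OF _ subgroup_K], clarify)
  fix g s assume g: "g \<in> carrier F" and s: "s \<in> S"
  obtain u where u: "u \<in> fp_words V G" "g = cls u" using g F_carrier by auto
  obtain w where w: "w \<in> fp_words V G" "Mw w \<approx> []" "s = cls w" using s assms by (auto simp: K_def)
  obtain x where x: "x \<in> fp_words V G" "cls x = inv\<^bsub>F\<^esub> cls u" using ex_inverse_word u by blast
  have "Mw u @ Mw w @ Mw x \<approx> Mw u @ [] @ Mw x" by (intro app Mw_refl u w x)
  then have "Mw (u @ w @ x) \<approx> []" using inverse_word(2)[OF u(1) x] gp_rel.trans by simp
  moreover have "g \<otimes>\<^bsub>F\<^esub> s \<otimes>\<^bsub>F\<^esub> inv\<^bsub>F\<^esub> g = cls (u @ w @ x)"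
    using u w by (simp add: F_mult x flip: x(2))
  ultimately show "g \<otimes>\<^bsub>F\<^esub> s \<otimes>\<^bsub>F\<^esub> inv\<^bsub>F\<^esub> g \<in> K" using K_iff[of "u @ w @ x"] u w x by simp
qed

lemma quotient_faithful:
  assumes S: "S \<subseteq> K" and w: "w \<in> fp_words V G" "w' \<in> fp_words V G"
    and eq: "normal_closure F S #>\<^bsub>F\<^esub> cls w = normal_closure F S #>\<^bsub>F\<^esub> cls w'"
  shows "Mw w \<approx> Mw w'"
proof -
  have SF: "S \<subseteq> carrier F" using S subgroup.subset[OF subgroup_K] by blast
  interpret N: normal "normal_closure F S" F by (rule normal_normal_closure[OF F.is_group SF])
  have c: "cls w \<in> carrier F" "cls w' \<in> carrier F" using w F_carrier by auto
  have "cls w \<in> normal_closure F S #>\<^bsub>F\<^esub> cls w'"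
    using F.rcos_self[OF c(1) N.subgroup_axioms] eq by simp
  then obtain n where n: "n \<in> normal_closure F S" "cls w = n \<otimes>\<^bsub>F\<^esub> cls w'" by (auto simp: r_coset_def)
  obtain u where u: "u \<in> fp_words V G" "Mw u \<approx> []" "n = cls u" using n normal_closure_K[OF S] by (auto simp: K_def)
  have "Mw w \<approx> Mw (u @ w')" by (rule cls_eq) (use u w n in \<open>auto simp: F_mult\<close>)
  moreover have "Mw (u @ w') \<approx> Mw w'" using app[OF u(2) Mw_refl[OF w(2)]] by simp
  ultimately show ?thesis by (rule gp_rel.trans)
qed

text \<open>\<open>S \<subseteq> K\<close> says that the relators hold in the graph product, which
  gives \<open>faithful\<close>. \<open>letter\<close> says that a rewritten letter evaluates to the
  coset of the original one, which gives generation.\<close>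

lemma graph_group_quotient:
  fixes S and \<iota> :: "'w \<Rightarrow> 'b \<Rightarrow> ('v \<times> 'a) list set set"
  defines "N \<equiv> normal_closure F S"
  assumes S: "S \<subseteq> K" and V': "finite V'"
    and G': "\<And>v. v \<in> V' \<Longrightarrow> comm_group (G' v) \<and> finite (carrier (G' v)) \<and> (\<exists>g\<in>carrier (G' v). g \<noteq> \<one>\<^bsub>G' v\<^esub>)"
    and hom: "\<And>v. v \<in> V' \<Longrightarrow> \<iota> v \<in> hom (G' v) (F Mod N)"
    and comm: "\<And>u v g h. \<lbrakk>u \<in> V'; v \<in> V'; adj u v; g \<in> carrier (G' u); h \<in> carrier (G' v)\<rbrakk>
      \<Longrightarrow> \<iota> u g \<otimes>\<^bsub>F Mod N\<^esub> \<iota> v h = \<iota> v h \<otimes>\<^bsub>F Mod N\<^esub> \<iota> u g"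
    and letter: "\<And>v g. \<lbrakk>v \<in> V; g \<in> carrier (G v)\<rbrakk> \<Longrightarrow> wev (F Mod N) \<iota> (M v g) = N #>\<^bsub>F\<^esub> cls [(v, g)]"
    and surj: "\<And>w. w \<in> fp_words V' G' \<Longrightarrow> \<exists>u\<in>fp_words V G. Mw u = w"
  shows "graph_group V' adj G' (F Mod N) \<iota>"
proof -
  let ?H = "F Mod N"
  have SF: "S \<subseteq> carrier F" using S subgroup.subset[OF subgroup_K] by blast
  interpret N: normal N F unfolding N_def by (rule normal_normal_closure[OF F.is_group SF])
  interpret H: group ?H by (rule N.factorgroup_is_group)
  have ic: "\<iota> v g \<in> carrier ?H" if "v \<in> V'" "g \<in> carrier (G' v)" for v g using hom_in_carrier[OF hom] that .
  have ev: "wev ?H \<iota> (Mw w) = N #>\<^bsub>F\<^esub> cls w" if "w \<in> fp_words V G" for w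
    using that
  proof (induction w)
    case Nil
    then show ?case using F.coset_mult_one[OF N.subset] by (simp add: FactGroup_def flip: F_one)
  next
    case (Cons p w)
    obtain v g where p: "p = (v, g)" by (cases p)
    have v: "v \<in> V" "g \<in> carrier (G v)" "w \<in> fp_words V G" using Cons.prems p by auto
    have cw: "cls w \<in> carrier F" "cls [(v, g)] \<in> carrier F" using F_carrier v by auto
    have pw: "cls (p # w) = cls [(v, g)] \<otimes>\<^bsub>F\<^esub> cls w" using F_mult[of "[p]" w] v p by simp
    have "wev ?H \<iota> (Mw (p # w)) = wev ?H \<iota> (M v g) \<otimes>\<^bsub>?H\<^esub> wev ?H \<iota> (Mw w)"
      using wev_append[OF H.is_group ic M_words Mw_words] v by (simp add: p)
    then show ?case unfolding pw using letter[OF v(1,2)] Cons.IH v(3) N.rcos_sum[OF cw(2,1)]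
      by (simp add: FactGroup_def)
  qed
  show ?thesis
  proof (intro graph_group.intro tgt.vertex_groups_axioms H.is_group graph_group_axioms.intro)
    fix x assume "x \<in> carrier ?H"
    then obtain w where "w \<in> fp_words V G" "x = N #>\<^bsub>F\<^esub> cls w"
      by (auto simp: F_carrier FactGroup_def RCOSETS_def)
    then show "\<exists>w\<in>fp_words V' G'. wev ?H \<iota> w = x" using ev Mw_words by metis
  next
    fix w w' assume w: "w \<in> fp_words V' G'" "w' \<in> fp_words V' G'" "wev ?H \<iota> w = wev ?H \<iota> w'"
    obtain u where u: "u \<in> fp_words V G" "Mw u = w" using surj[OF w(1)] by blast
    obtain u' where u': "u' \<in> fp_words V G" "Mw u' = w'" using surj[OF w(2)] by blast
    have "N #>\<^bsub>F\<^esub> cls u = N #>\<^bsub>F\<^esub> cls u'" using ev[OF u(1)] ev[OF u'(1)] u u' w by simp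
    then show "w \<approx> w'" using quotient_faithful[OF S u(1) u'(1)] u u' by (simp add: N_def)
  next
    fix v assume v: "v \<in> V'"
    show "\<iota> v \<in> hom (G' v) ?H" by (rule hom[OF v])
    show "comm_group (G' v)" "finite (carrier (G' v))" "\<exists>g\<in>carrier (G' v). g \<noteq> \<one>\<^bsub>G' v\<^esub>" using G'[OF v] by auto
  qed (rule V', rule comm)
qed

end

lemma (in group) coset_comm:
  assumes N: "N \<lhd> G" and x: "x \<in> carrier G" "y \<in> carrier G" "commutator G x y \<in> N"
  shows "(N #> x) \<otimes>\<^bsub>G Mod N\<^esub> (N #> y) = (N #> y) \<otimes>\<^bsub>G Mod N\<^esub> (N #> x)"
proof -
  interpret N: normal N G by (rule N)
  have "x \<otimes> y = commutator G x y \<otimes> (y \<otimes> x)"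
    using x by (simp add: commutator_def m_assoc inv_solve_left')
  then have "x \<otimes> y \<in> N #> (y \<otimes> x)" using x(3) unfolding r_coset_def by blast
  then have "N #> (y \<otimes> x) = N #> (x \<otimes> y)"
    using repr_independence[OF _ _ N.subgroup_axioms] x by simp
  then show ?thesis using x by (simp add: FactGroup_def N.rcos_sum)
qed

lemma normal_closure_incl:
  assumes "group G" "S \<subseteq> carrier G"
  shows "S \<subseteq> normal_closure G S"
proof
  interpret group G by fact
  fix s assume s: "s \<in> S"
  then have "s = \<one>\<^bsub>G\<^esub> \<otimes>\<^bsub>G\<^esub> s \<otimes>\<^bsub>G\<^esub> inv\<^bsub>G\<^esub> \<one>\<^bsub>G\<^esub>" using assms(2) by auto
  then show "s \<in> normal_closure G S"
    unfolding normal_closure_def using s by (intro generate.incl) blast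
qed

text \<open>\<open>graph_group\<close> asks for nontrivial vertex groups, so the vertices with
  trivial group are left out and their syllables are rewritten to the empty word.\<close>

lemma graph_group_graph_product:
  fixes \<Gamma> :: "'v pair_pre_digraph" and G :: "'v \<Rightarrow> ('a, 'm) monoid_scheme"
  assumes \<Gamma>: "pair_graph \<Gamma>"
    and G: "\<And>v. v \<in> pverts \<Gamma> \<Longrightarrow> comm_group (G v) \<and> finite (carrier (G v))"
  defines "V \<equiv> {v \<in> pverts \<Gamma>. carrier (G v) \<noteq> {\<one>\<^bsub>G v\<^esub>}}"
  shows "\<exists>\<iota>. graph_group V (\<lambda>u v. u \<rightarrow>\<^bsub>\<Gamma>\<^esub> v) G (graph_product \<Gamma> G) \<iota>"
proof -
  interpret pair_graph \<Gamma> by fact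
  let ?adj = "\<lambda>u v. u \<rightarrow>\<^bsub>\<Gamma>\<^esub> v"
  have grp: "group (G v)" if "v \<in> pverts \<Gamma>" for v using G[OF that] by (simp add: comm_group_def)
  have sub: "V \<subseteq> pverts \<Gamma>" by (auto simp: V_def)
  have sym: "v \<rightarrow>\<^bsub>\<Gamma>\<^esub> u" if "u \<rightarrow>\<^bsub>\<Gamma>\<^esub> v" for u v using that arcs_symmetric by simp
  have irr: "\<not> v \<rightarrow>\<^bsub>\<Gamma>\<^esub> v" for v using no_loops' by auto
  have vg: "vertex_groups V ?adj G" by (rule vertex_groups.intro) (use grp sub sym irr in auto)
  have vg0: "vertex_groups (pverts \<Gamma>) (\<lambda>_ _. False) G" by (rule vertex_groups.intro) (use grp in auto)
  interpret T: vertex_groups V ?adj G by (rule vg)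
  have triv: "g = \<one>\<^bsub>G v\<^esub>" if "v \<in> pverts \<Gamma>" "v \<notin> V" "g \<in> carrier (G v)" for v g
    using that by (auto simp: V_def)
  interpret W: word_map "pverts \<Gamma>" G V ?adj G "\<lambda>v g. if v \<in> V then [(v, g)] else []"
    by (rule word_map.intro[OF vg0 vg word_map_axioms.intro])
      (auto intro: gp_rel.intros)
  let ?F = "free_product (pverts \<Gamma>) G" and ?i = "fp_incl (pverts \<Gamma>) G"
  define S where "S = {commutator ?F (?i u g) (?i v h) | u v g h.
    u \<rightarrow>\<^bsub>\<Gamma>\<^esub> v \<and> g \<in> carrier (G u) \<and> h \<in> carrier (G v)}"
  let ?N = "normal_closure ?F S"
  have inv_i: "inv\<^bsub>?F\<^esub> ?i v g = ?i v (inv\<^bsub>G v\<^esub> g)" if v: "v \<in> pverts \<Gamma>" "g \<in> carrier (G v)" for v g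
  proof (rule W.F.inv_equality)
    interpret Gv: group "G v" by (rule grp[OF v(1)])
    have "([(v, inv\<^bsub>G v\<^esub> g), (v, g)], []) \<in> fp_rel (pverts \<Gamma>) G"
      using fp_rel.trans[OF fp_rel.mult[of v "pverts \<Gamma>" "inv\<^bsub>G v\<^esub> g" G g]] fp_rel.one[of v "pverts \<Gamma>" G] v by simp
    then show "?i v (inv\<^bsub>G v\<^esub> g) \<otimes>\<^bsub>?F\<^esub> ?i v g = \<one>\<^bsub>?F\<^esub>"
      using v equiv_class_eq[OF equiv_fp_rel[of "pverts \<Gamma>" G]] grp
      by (simp add: fp_incl_def W.F_mult W.F_one)
  qed (use v in \<open>auto intro!: fp_incl_closed\<close>)
  have SK: "S \<subseteq> W.K"
  proof
    fix s assume "s \<in> S"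
    then obtain u v g h where s: "s = commutator ?F (?i u g) (?i v h)" and uv: "u \<rightarrow>\<^bsub>\<Gamma>\<^esub> v"
      "g \<in> carrier (G u)" "h \<in> carrier (G v)" by (auto simp: S_def)
    have V: "u \<in> pverts \<Gamma>" "v \<in> pverts \<Gamma>" using uv in_arcsD1 in_arcsD2 by auto
    let ?w = "[(u, g), (v, h), (u, inv\<^bsub>G u\<^esub> g), (v, inv\<^bsub>G v\<^esub> h)]"
    have w: "?w \<in> fp_words (pverts \<Gamma>) G" using V uv W.src.G_closed by simp
    have "s = fp_rel (pverts \<Gamma>) G `` {?w}"
      using V uv W.src.G_closed by (simp add: s commutator_def inv_i) (simp add: fp_incl_def W.F_mult)
    moreover have "(W.Mw ?w, []) \<in> gp_rel V ?adj G"
    proof (cases "u \<in> V"; cases "v \<in> V")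
      assume "u \<in> V" "v \<in> V"
      then show ?thesis using gp_rel_commutator[OF vg, of u v g "inv\<^bsub>G u\<^esub> g" h "inv\<^bsub>G v\<^esub> h"] uv by simp
    next
      assume "u \<in> V" "v \<notin> V"
      then show ?thesis using gp_rel.trans[OF gp_rel.mult[of u V g G "inv\<^bsub>G u\<^esub> g"] ] gp_rel.one[of u V G] uv by simp
    next
      assume "u \<notin> V" "v \<in> V"
      then show ?thesis using gp_rel.trans[OF gp_rel.mult[of v V h G "inv\<^bsub>G v\<^esub> h"] ] gp_rel.one[of v V G] uv by simp
    qed (auto intro: gp_rel.refl)
    ultimately show "s \<in> W.K" using W.K_iff[OF w] by simp
  qed
  then have SF: "S \<subseteq> carrier ?F" using subgroup.subset[OF W.subgroup_K] by blast
  interpret N: normal ?N ?F by (rule normal_normal_closure[OF W.F.is_group SF])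
  have ic: "?i v g \<in> carrier ?F" if "v \<in> pverts \<Gamma>" "g \<in> carrier (G v)" for v g using fp_incl_closed that .
  have incl_mult: "?i v (g \<otimes>\<^bsub>G v\<^esub> h) = ?i v g \<otimes>\<^bsub>?F\<^esub> ?i v h"
    if "v \<in> pverts \<Gamma>" "g \<in> carrier (G v)" "h \<in> carrier (G v)" for v g h
    using equiv_class_eq[OF equiv_fp_rel[of "pverts \<Gamma>" G] fp_rel.mult[where G = G, OF that]] grp that
    by (simp add: fp_incl_def W.F_mult)
  have incl_one: "?i v \<one>\<^bsub>G v\<^esub> = \<one>\<^bsub>?F\<^esub>" if "v \<in> pverts \<Gamma>" for v
    using equiv_class_eq[OF equiv_fp_rel[of "pverts \<Gamma>" G] fp_rel.one[where G = G, OF that]] grp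
    by (simp add: fp_incl_def W.F_one)
  have one: "?N #>\<^bsub>?F\<^esub> \<one>\<^bsub>?F\<^esub> = \<one>\<^bsub>?F Mod ?N\<^esub>"
    using W.F.coset_mult_one[OF N.subset] by (simp add: FactGroup_def)
  interpret H: group "?F Mod ?N" by (rule N.factorgroup_is_group)
  have cosets: "?N #>\<^bsub>?F\<^esub> x \<in> carrier (?F Mod ?N)" if "x \<in> carrier ?F" for x
    using that by (auto simp: FactGroup_def RCOSETS_def)
  have "graph_group V ?adj G (?F Mod ?N) (\<lambda>v g. ?N #>\<^bsub>?F\<^esub> ?i v g)"
  proof (rule W.graph_group_quotient[OF SK])
    show "finite V" using finite_subset[OF sub] pair_finite_verts by simp
  next
    fix v assume v: "v \<in> V"
    then have vV: "v \<in> pverts \<Gamma>" using sub by auto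
    show "comm_group (G v) \<and> finite (carrier (G v)) \<and> (\<exists>g\<in>carrier (G v). g \<noteq> \<one>\<^bsub>G v\<^esub>)"
      using G[OF vV] v T.G_closed(2)[OF v] by (auto simp: V_def)
    show "(\<lambda>g. ?N #>\<^bsub>?F\<^esub> ?i v g) \<in> hom (G v) (?F Mod ?N)"
      using vV ic cosets N.rcos_sum by (intro homI) (auto simp: incl_mult)
  next
    fix u v g h assume uv: "u \<in> V" "v \<in> V" "u \<rightarrow>\<^bsub>\<Gamma>\<^esub> v" "g \<in> carrier (G u)" "h \<in> carrier (G v)"
    have "commutator ?F (?i u g) (?i v h) \<in> S" unfolding S_def using uv by blast
    then have cm: "commutator ?F (?i u g) (?i v h) \<in> ?N" using normal_closure_incl[OF W.F.is_group SF] by blast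
    show "(?N #>\<^bsub>?F\<^esub> ?i u g) \<otimes>\<^bsub>?F Mod ?N\<^esub> (?N #>\<^bsub>?F\<^esub> ?i v h)
      = (?N #>\<^bsub>?F\<^esub> ?i v h) \<otimes>\<^bsub>?F Mod ?N\<^esub> (?N #>\<^bsub>?F\<^esub> ?i u g)"
      by (rule W.F.coset_comm[OF N.normal_axioms]) (use cm ic uv sub in auto)
  next
    fix v g assume v: "v \<in> pverts \<Gamma>" "g \<in> carrier (G v)"
    show "wev (?F Mod ?N) (\<lambda>v g. ?N #>\<^bsub>?F\<^esub> ?i v g) (if v \<in> V then [(v, g)] else [])
      = ?N #>\<^bsub>?F\<^esub> fp_rel (pverts \<Gamma>) G `` {[(v, g)]}"
    proof (cases "v \<in> V")
      case True
      then show ?thesis using H.r_one[OF cosets[OF ic[OF v]]] by (simp add: fp_incl_def del: mult_FactGroup one_FactGroup)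
    next
      case False
      then have "?i v g = \<one>\<^bsub>?F\<^esub>" using incl_one triv v by metis
      then show ?thesis using one False by (simp add: fp_incl_def del: mult_FactGroup one_FactGroup)
    qed
  next
    fix w assume w: "w \<in> fp_words V G"
    then have "w \<in> fp_words (pverts \<Gamma>) G \<and> W.Mw w = w"
      using sub by (induction w) auto
    then show "\<exists>u\<in>fp_words (pverts \<Gamma>) G. W.Mw u = w" by blast
  qed
  then show ?thesis by (auto simp: graph_product_def S_def Let_def)
qed

context graph_group
begin

lemma not_property_T_if_sil:
  assumes "sil x1 x2 z"
  shows "\<not> property_T (Out H)"
proof -
  obtain C where C: "C \<subseteq> V" "z \<in> C" "x1 \<notin> C" "x2 \<notin> C" "\<forall>v\<in>C. \<not> (adj x1 v \<and> adj x2 v)"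
    "\<forall>v\<in>C. \<forall>v'\<in>V. adj v v' \<longrightarrow> \<not> (adj x1 v' \<and> adj x2 v') \<longrightarrow> v' \<in> C"
    using assms unfolding sil_def by blast
  have V: "x1 \<in> V" "x2 \<in> V" "x1 \<noteq> x2" "\<not> adj x1 x2" using assms unfolding sil_def by blast+
  interpret graph_group_sil V adj G H \<iota> x1 x2 z C
    by (intro graph_group_sil.intro graph_group_axioms graph_group_sil_axioms.intro) (use V C in blast)+
  show ?thesis by (rule Out_not_property_T)
qed

theorem property_T_Out_iff:
  "property_T (Out H) \<longleftrightarrow> \<not> (\<exists>x1 x2 z. sil x1 x2 z)"
  "property_T (Out H) \<longleftrightarrow> finite (carrier (Out H))"
  using not_property_T_if_sil finite_Out_if_no_sil property_T_finite[OF group_Out[OF is_group]] by blast+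

end

text \<open>A component is closed under the allowed adjacencies; conversely, a closed set that
  contains \<open>z\<close> contains the component of \<open>z\<close>, which then avoids
  \<open>x1\<close> and \<open>x2\<close> as well.\<close>

lemma SIL_iff:
  fixes \<Gamma> :: "'v pair_pre_digraph"
  assumes "pair_graph \<Gamma>"
  shows "SIL \<Gamma> x1 x2 z \<longleftrightarrow> x1 \<in> pverts \<Gamma> \<and> x2 \<in> pverts \<Gamma> \<and> x1 \<noteq> x2 \<and> \<not> x1 \<rightarrow>\<^bsub>\<Gamma>\<^esub> x2 \<and>
    (\<exists>C\<subseteq>pverts \<Gamma>. z \<in> C \<and> x1 \<notin> C \<and> x2 \<notin> C \<and> (\<forall>v\<in>C. \<not> (x1 \<rightarrow>\<^bsub>\<Gamma>\<^esub> v \<and> x2 \<rightarrow>\<^bsub>\<Gamma>\<^esub> v)) \<and>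
      (\<forall>v\<in>C. \<forall>v'\<in>pverts \<Gamma>. v \<rightarrow>\<^bsub>\<Gamma>\<^esub> v' \<longrightarrow> \<not> (x1 \<rightarrow>\<^bsub>\<Gamma>\<^esub> v' \<and> x2 \<rightarrow>\<^bsub>\<Gamma>\<^esub> v') \<longrightarrow> v' \<in> C))"
    (is "_ \<longleftrightarrow> _ \<and> _ \<and> _ \<and> _ \<and> ?closed")
proof -
  interpret pair_graph \<Gamma> by fact
  define W where "W = pverts \<Gamma> - (lk \<Gamma> x1 \<inter> lk \<Gamma> x2)"
  define R where "R = with_proj \<Gamma> \<restriction> W"
  have W: "v \<in> W \<longleftrightarrow> v \<in> pverts \<Gamma> \<and> \<not> (x1 \<rightarrow>\<^bsub>\<Gamma>\<^esub> v \<and> x2 \<rightarrow>\<^bsub>\<Gamma>\<^esub> v)" for v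
    by (auto simp: W_def lk_def)
  define S where "S = {(a, b). a \<in> W \<and> b \<in> W \<and> a \<rightarrow>\<^bsub>\<Gamma>\<^esub> b}"
  have S: "arcs_ends R = S" by (auto simp: R_def S_def arcs_ends_conv image_iff)
  have reach: "u \<rightarrow>\<^sup>*\<^bsub>R\<^esub> v \<longleftrightarrow> u \<in> W \<and> (u, v) \<in> S\<^sup>*" for u v
  proof
    assume "u \<rightarrow>\<^sup>*\<^bsub>R\<^esub> v"
    then have "(u, v) \<in> rtrancl_on W S" by (simp add: reachable_def S) (simp add: R_def)
    then show "u \<in> W \<and> (u, v) \<in> S\<^sup>*" by (induction rule: rtrancl_on_induct) (auto intro: rtrancl_into_rtrancl)
  next
    assume uv: "u \<in> W \<and> (u, v) \<in> S\<^sup>*"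
    then have "(u, v) \<in> S\<^sup>*" "u \<in> W" by auto
    then have "(u, v) \<in> rtrancl_on W S"
      by (induction rule: rtrancl_induct) (auto simp: S_def intro: rtrancl_on_into_rtrancl_on)
    then show "u \<rightarrow>\<^sup>*\<^bsub>R\<^esub> v" by (simp add: reachable_def S) (simp add: R_def)
  qed
  have symS: "(v, u) \<in> S\<^sup>*" if "(u, v) \<in> S\<^sup>*" for u v
  proof -
    have "sym S" using arcs_symmetric by (auto simp: sym_def S_def)
    then show ?thesis using that sym_rtrancl symD by metis
  qed
  have SW: "v \<in> W" if "(u, v) \<in> S\<^sup>*" "u \<in> W" for u v
    using that by (induction rule: rtrancl_induct) (auto simp: S_def)
  define Q where "Q \<longleftrightarrow> ?closed"
  have "(\<exists>C\<in>pre_digraph.sccs_verts R. z \<in> C \<and> x1 \<notin> C \<and> x2 \<notin> C) \<longleftrightarrow> ?closed"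
  proof
    assume "\<exists>C\<in>pre_digraph.sccs_verts R. z \<in> C \<and> x1 \<notin> C \<and> x2 \<notin> C"
    then obtain C where C: "C \<in> pre_digraph.sccs_verts R" "z \<in> C" "x1 \<notin> C" "x2 \<notin> C" by blast
    have in_C: "\<And>u v. \<lbrakk>u \<in> C; v \<in> C\<rbrakk> \<Longrightarrow> u \<rightarrow>\<^sup>*\<^bsub>R\<^esub> v"
      and out_C: "\<And>u v. \<lbrakk>u \<in> C; v \<notin> C\<rbrakk> \<Longrightarrow> \<not> u \<rightarrow>\<^sup>*\<^bsub>R\<^esub> v \<or> \<not> v \<rightarrow>\<^sup>*\<^bsub>R\<^esub> u"
      using C(1) by (auto simp: pre_digraph.sccs_verts_def)
    have CW: "v \<in> W" if "v \<in> C" for v using in_C[OF that that] reach by blast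
    have "v' \<in> C" if v: "v \<in> C" "v' \<in> pverts \<Gamma>" "v \<rightarrow>\<^bsub>\<Gamma>\<^esub> v'" "\<not> (x1 \<rightarrow>\<^bsub>\<Gamma>\<^esub> v' \<and> x2 \<rightarrow>\<^bsub>\<Gamma>\<^esub> v')" for v v'
    proof (rule ccontr)
      assume "v' \<notin> C"
      have "(v, v') \<in> S\<^sup>*" using v CW W by (intro r_into_rtrancl) (auto simp: S_def)
      then have "v \<rightarrow>\<^sup>*\<^bsub>R\<^esub> v'" "v' \<rightarrow>\<^sup>*\<^bsub>R\<^esub> v" using reach symS v CW W by auto
      then show False using out_C[OF v(1) \<open>v' \<notin> C\<close>] by blast
    qed
    then show ?closed using C CW W by (intro exI[of _ C]) blast
  next
    assume ?closed
    then obtain C where C: "C \<subseteq> pverts \<Gamma>" "z \<in> C" "x1 \<notin> C" "x2 \<notin> C"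
      "\<And>v. v \<in> C \<Longrightarrow> \<not> (x1 \<rightarrow>\<^bsub>\<Gamma>\<^esub> v \<and> x2 \<rightarrow>\<^bsub>\<Gamma>\<^esub> v)"
      "\<And>v v'. \<lbrakk>v \<in> C; v' \<in> pverts \<Gamma>; v \<rightarrow>\<^bsub>\<Gamma>\<^esub> v'; \<not> (x1 \<rightarrow>\<^bsub>\<Gamma>\<^esub> v' \<and> x2 \<rightarrow>\<^bsub>\<Gamma>\<^esub> v')\<rbrakk> \<Longrightarrow> v' \<in> C" by blast
    have zW: "z \<in> W" using C W by auto
    let ?D = "{v. (z, v) \<in> S\<^sup>*}"
    have DC: "v \<in> C" if "(z, v) \<in> S\<^sup>*" for v
      using that by (induction rule: rtrancl_induct) (use C W in \<open>auto simp: S_def\<close>)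
    have "?D \<in> pre_digraph.sccs_verts R" unfolding pre_digraph.sccs_verts_def
    proof (intro CollectI conjI ballI allI impI)
      show "?D \<noteq> {}" by auto
      show "u \<rightarrow>\<^sup>*\<^bsub>R\<^esub> v" if "u \<in> ?D" "v \<in> ?D" for u v
        using that reach SW[OF _ zW] symS[of z u] rtrancl_trans[of u z S v] by auto
      show "\<not> u \<rightarrow>\<^sup>*\<^bsub>R\<^esub> v \<or> \<not> v \<rightarrow>\<^sup>*\<^bsub>R\<^esub> u" if "u \<in> ?D" "v \<notin> ?D" for u v
        using that reach rtrancl_trans[of z u S v] by auto
    qed
    then show "\<exists>C\<in>pre_digraph.sccs_verts R. z \<in> C \<and> x1 \<notin> C \<and> x2 \<notin> C"
    proof (rule rev_bexI)
      show "z \<in> ?D \<and> x1 \<notin> ?D \<and> x2 \<notin> ?D" using DC[of x1] DC[of x2] C(3,4) by blast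
    qed
  qed
  then have eq: "(\<exists>C\<in>pre_digraph.sccs_verts (with_proj \<Gamma> \<restriction> (pverts \<Gamma> - (lk \<Gamma> x1 \<inter> lk \<Gamma> x2))).
    z \<in> C \<and> x1 \<notin> C \<and> x2 \<notin> C) \<longleftrightarrow> Q" unfolding R_def W_def Q_def .
  have "SIL \<Gamma> x1 x2 z \<longleftrightarrow> x1 \<in> pverts \<Gamma> \<and> x2 \<in> pverts \<Gamma> \<and>
    z \<in> pverts \<Gamma> \<and> x1 \<noteq> x2 \<and> x1 \<noteq> z \<and> x2 \<noteq> z \<and> \<not> x1 \<rightarrow>\<^bsub>\<Gamma>\<^esub> x2 \<and> Q"
    by (simp only: SIL_def eq)
  moreover have "Q \<Longrightarrow> z \<in> pverts \<Gamma> \<and> x1 \<noteq> z \<and> x2 \<noteq> z" unfolding Q_def by blast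
  ultimately show ?thesis unfolding Q_def[symmetric] by argo
qed

text \<open>Letters of the free group carry integers, those of the graph product residues. The power
  relators make the coset \<open>Y v k\<close> depend on \<open>k\<close> modulo \<open>p v\<close>
  only, so that \<open>Y v\<close> is a homomorphism on residues.\<close>

lemma graph_group_standard_graph_group:
  fixes \<Gamma> :: "'v pair_pre_digraph" and p :: "'v \<Rightarrow> nat"
  assumes \<Gamma>: "pair_graph \<Gamma>" and p: "\<And>v. v \<in> pverts \<Gamma> \<Longrightarrow> p v > 1"
  shows "\<exists>\<iota>. graph_group (pverts \<Gamma>) (\<lambda>u v. u \<rightarrow>\<^bsub>\<Gamma>\<^esub> v) (\<lambda>v. integer_mod_group (p v)) (standard_graph_group \<Gamma> p) \<iota>"
proof -
  interpret pair_graph \<Gamma> by fact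
  let ?V = "pverts \<Gamma>" and ?adj = "\<lambda>u v. u \<rightarrow>\<^bsub>\<Gamma>\<^esub> v" and ?G = "\<lambda>v. integer_mod_group (p v)"
  let ?Z = "\<lambda>_ :: 'v. integer_group"
  have sym: "v \<rightarrow>\<^bsub>\<Gamma>\<^esub> u" if "u \<rightarrow>\<^bsub>\<Gamma>\<^esub> v" for u v using that arcs_symmetric by simp
  have irr: "\<not> v \<rightarrow>\<^bsub>\<Gamma>\<^esub> v" for v using no_loops' by auto
  have car: "carrier (?G v) = {0..<int (p v)}" if "v \<in> ?V" for v using p[OF that] by (simp add: carrier_integer_mod_group)
  have vg: "vertex_groups ?V ?adj ?G" by (rule vertex_groups.intro) (use sym irr in auto)
  have vg0: "vertex_groups ?V (\<lambda>_ _. False) ?Z" by (rule vertex_groups.intro) auto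
  have mod_car: "k mod int (p v) \<in> carrier (?G v)" if "v \<in> ?V" for v k using p[OF that] car[OF that] by simp
  interpret W: word_map ?V ?Z ?V ?adj ?G "\<lambda>v k. [(v, k mod int (p v))]"
  proof (rule word_map.intro[OF vg0 vg word_map_axioms.intro])
    fix v assume v: "v \<in> ?V"
    show "([(v, \<one>\<^bsub>integer_group\<^esub> mod int (p v))], []) \<in> gp_rel ?V ?adj ?G"
      using gp_rel.one[of v ?V ?G] v by simp
    fix k l
    show "([(v, k mod int (p v))] @ [(v, l mod int (p v))], [(v, (k \<otimes>\<^bsub>integer_group\<^esub> l) mod int (p v))]) \<in> gp_rel ?V ?adj ?G"
      using gp_rel.mult[of v ?V "k mod int (p v)" ?G "l mod int (p v)"] v mod_car[OF v] by (simp add: mod_add_eq)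
  qed (use mod_car in auto)
  let ?F = "free_product ?V ?Z"
  let ?c = "\<lambda>v k. W.cls [(v, k)]"
  have cc: "?c v k \<in> carrier ?F" if "v \<in> ?V" for v k using that by (simp add: W.F_carrier)
  have cmult: "?c v k \<otimes>\<^bsub>?F\<^esub> ?c v l = ?c v (k + l)" if "v \<in> ?V" for v k l
    using equiv_class_eq[OF equiv_fp_rel[of ?V ?Z] fp_rel.mult[of v ?V k ?Z l]] that by (simp add: W.F_mult)
  have czero: "?c v 0 = \<one>\<^bsub>?F\<^esub>" if "v \<in> ?V" for v
    using equiv_class_eq[OF equiv_fp_rel[of ?V ?Z] fp_rel.one[of v ?V ?Z]] that by (simp add: W.F_one)
  have cinv: "inv\<^bsub>?F\<^esub> ?c v k = ?c v (- k)" if "v \<in> ?V" for v k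
    by (rule W.F.inv_equality) (use that in \<open>simp_all add: cmult czero cc\<close>)
  have cpow: "?c v 1 [^]\<^bsub>?F\<^esub> n = ?c v (int n)" if "v \<in> ?V" for v and n :: nat
    by (induction n) (use that in \<open>simp_all add: czero cmult add.commute\<close>)
  define S where "S = {?c v 1 [^]\<^bsub>?F\<^esub> p v | v. v \<in> ?V} \<union> {commutator ?F (?c u 1) (?c v 1) | u v. u \<rightarrow>\<^bsub>\<Gamma>\<^esub> v}"
  let ?N = "normal_closure ?F S"
  have arcV: "u \<in> ?V" "v \<in> ?V" if "u \<rightarrow>\<^bsub>\<Gamma>\<^esub> v" for u v using that in_arcsD1 in_arcsD2 by auto
  have "S \<subseteq> W.K"
  proof -
    have "?c v 1 [^]\<^bsub>?F\<^esub> p v \<in> W.K" if v: "v \<in> ?V" for v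
      unfolding cpow[OF v] using gp_rel.one[of v ?V ?G] v by (subst W.K_iff) auto
    moreover have "commutator ?F (?c u 1) (?c v 1) \<in> W.K" if uv: "u \<rightarrow>\<^bsub>\<Gamma>\<^esub> v" for u v
    proof -
      have V: "u \<in> ?V" "v \<in> ?V" using arcV[OF uv] by auto
      have "commutator ?F (?c u 1) (?c v 1) = W.cls [(u, 1), (v, 1), (u, -1), (v, -1)]"
        using V by (simp add: commutator_def cinv W.F_mult)
      moreover have rel: "([(u, 1 mod int (p u)), (v, 1 mod int (p v)), (u, (-1) mod int (p u)), (v, (-1) mod int (p v))], [])
        \<in> gp_rel ?V ?adj ?G"
        by (rule gp_rel_commutator[OF vg V uv]) (use V mod_car in \<open>simp_all add: mod_add_eq\<close>)
      have "W.cls [(u, 1), (v, 1), (u, -1), (v, -1)] \<in> W.K"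
        by (subst W.K_iff) (use V rel in simp_all)
      ultimately show ?thesis by (simp only:)
    qed
    ultimately show ?thesis by (auto simp: S_def)
  qed
  note SK = this
  then have SF: "S \<subseteq> carrier ?F" using subgroup.subset[OF W.subgroup_K] by blast
  interpret N: normal ?N ?F by (rule normal_normal_closure[OF W.F.is_group SF])
  interpret H: group "?F Mod ?N" by (rule N.factorgroup_is_group)
  define Y where "Y v k = ?N #>\<^bsub>?F\<^esub> ?c v k" for v k
  have Yc: "Y v k \<in> carrier (?F Mod ?N)" if "v \<in> ?V" for v k
    using cc[OF that] by (auto simp: FactGroup_def RCOSETS_def Y_def)
  have Ymult: "Y v k \<otimes>\<^bsub>?F Mod ?N\<^esub> Y v l = Y v (k + l)" if "v \<in> ?V" for v k l
    using N.rcos_sum[OF cc[OF that] cc[OF that]] that by (simp add: Y_def cmult FactGroup_def)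
  have Yzero: "Y v 0 = \<one>\<^bsub>?F Mod ?N\<^esub>" if "v \<in> ?V" for v
    using W.F.coset_mult_one[OF N.subset] that by (simp add: FactGroup_def Y_def czero)
  have Yp: "Y v (int (p v)) = \<one>\<^bsub>?F Mod ?N\<^esub>" if v: "v \<in> ?V" for v
  proof -
    have "?c v 1 [^]\<^bsub>?F\<^esub> p v \<in> S" unfolding S_def using v by blast
    then have "?c v (int (p v)) \<in> ?N" using normal_closure_incl[OF W.F.is_group SF] cpow[OF v] by auto
    then show ?thesis using W.F.coset_join2[OF cc[OF v] N.subgroup_axioms] by (simp add: Y_def FactGroup_def)
  qed
  have Ypn: "Y v (int (p v) * int n) = \<one>\<^bsub>?F Mod ?N\<^esub>" if v: "v \<in> ?V" for v n
  proof (induction n)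
    case (Suc n)
    have "Y v (int (p v) * int (Suc n)) = Y v (int (p v)) \<otimes>\<^bsub>?F Mod ?N\<^esub> Y v (int (p v) * int n)"
      by (simp add: Ymult[OF v] distrib_left del: mult_FactGroup)
    then show ?case using Suc Yp[OF v] H.l_one[OF H.one_closed] by simp
  qed (use Yzero[OF v] in simp)
  have Ypq: "Y v (int (p v) * q) = \<one>\<^bsub>?F Mod ?N\<^esub>" if v: "v \<in> ?V" for v q
  proof (cases q rule: int_cases2)
    case (nonneg n)
    then show ?thesis using Ypn[OF v] by simp
  next
    case (nonpos n)
    have "Y v (int (p v) * int n) \<otimes>\<^bsub>?F Mod ?N\<^esub> Y v (int (p v) * q) = Y v 0"
      using Ymult[OF v, of "int (p v) * int n" "int (p v) * q"] nonpos by (simp del: mult_FactGroup)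
    then show ?thesis using Ypn[OF v, of n] Yzero[OF v] H.l_one[OF Yc[OF v]] by metis
  qed
  have Ymod: "Y v (k mod int (p v)) = Y v k" if v: "v \<in> ?V" for v k
  proof -
    have "Y v k = Y v (k mod int (p v)) \<otimes>\<^bsub>?F Mod ?N\<^esub> Y v (int (p v) * (k div int (p v)))"
      by (simp add: Ymult[OF v] del: mult_FactGroup)
    then show ?thesis using Ypq[OF v] H.r_one[OF Yc[OF v]] by metis
  qed
  \<comment> \<open>The relators only make the generators commute. This extends commutation to
    powers on one side and is applied twice below, once for each vertex.\<close>
  have Ycomm1: "Y v (int n) \<otimes>\<^bsub>?F Mod ?N\<^esub> b = b \<otimes>\<^bsub>?F Mod ?N\<^esub> Y v (int n)"
    if v: "v \<in> ?V" and b: "b \<in> carrier (?F Mod ?N)" "Y v 1 \<otimes>\<^bsub>?F Mod ?N\<^esub> b = b \<otimes>\<^bsub>?F Mod ?N\<^esub> Y v 1" for v n b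
  proof (induction n)
    case 0
    then show ?case using Yzero[OF v] H.l_one[OF b(1)] H.r_one[OF b(1)] by simp
  next
    case (Suc n)
    have e: "Y v (int (Suc n)) = Y v (int n) \<otimes>\<^bsub>?F Mod ?N\<^esub> Y v 1"
      by (simp add: Ymult[OF v] add.commute del: mult_FactGroup)
    show ?case unfolding e
      using H.m_assoc[OF Yc[OF v] Yc[OF v] b(1)] H.m_assoc[OF Yc[OF v] b(1) Yc[OF v]] H.m_assoc[OF b(1) Yc[OF v] Yc[OF v]] b(2) Suc
      by metis
  qed
  have "graph_group ?V ?adj ?G (?F Mod ?N) Y"
  proof (rule W.graph_group_quotient[OF SK pair_finite_verts])
    fix v assume v: "v \<in> ?V"
    have "1 \<in> carrier (?G v)" using p[OF v] car[OF v] by simp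
    then have "\<exists>g\<in>carrier (?G v). g \<noteq> \<one>\<^bsub>?G v\<^esub>" by (rule rev_bexI) simp
    moreover have "finite (carrier (?G v))" unfolding car[OF v] by (rule finite_atLeastLessThan_int)
    ultimately show "comm_group (?G v) \<and> finite (carrier (?G v)) \<and> (\<exists>g\<in>carrier (?G v). g \<noteq> \<one>\<^bsub>?G v\<^esub>)"
      using abelian_integer_mod_group by blast
    show "Y v \<in> hom (?G v) (?F Mod ?N)"
      using v by (intro homI) (simp_all add: Yc Ymod Ymult del: mult_FactGroup)
  next
    fix u v k l assume uv: "u \<in> ?V" "v \<in> ?V" "u \<rightarrow>\<^bsub>\<Gamma>\<^esub> v" and kl: "k \<in> carrier (?G u)" "l \<in> carrier (?G v)"
    have "commutator ?F (?c u 1) (?c v 1) \<in> S" unfolding S_def using uv by blast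
    then have cm: "commutator ?F (?c u 1) (?c v 1) \<in> ?N" using normal_closure_incl[OF W.F.is_group SF] by blast
    have 1: "Y u 1 \<otimes>\<^bsub>?F Mod ?N\<^esub> Y v 1 = Y v 1 \<otimes>\<^bsub>?F Mod ?N\<^esub> Y u 1"
      unfolding Y_def by (rule W.F.coset_comm[OF N.normal_axioms cc[OF uv(1)] cc[OF uv(2)] cm])
    have k: "k = int (nat k)" "l = int (nat l)" using kl car[OF uv(1)] car[OF uv(2)] by auto
    have "Y v (int (nat l)) \<otimes>\<^bsub>?F Mod ?N\<^esub> Y u 1 = Y u 1 \<otimes>\<^bsub>?F Mod ?N\<^esub> Y v (int (nat l))"
      by (rule Ycomm1[OF uv(2) Yc[OF uv(1)] 1[symmetric]])
    from Ycomm1[OF uv(1) Yc[OF uv(2)] this[symmetric], of "nat k"]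
    show "Y u k \<otimes>\<^bsub>?F Mod ?N\<^esub> Y v l = Y v l \<otimes>\<^bsub>?F Mod ?N\<^esub> Y u k" using k by simp
  next
    fix v and k :: int assume v: "v \<in> ?V" "k \<in> carrier (?Z v)"
    show "wev (?F Mod ?N) Y [(v, k mod int (p v))] = ?N #>\<^bsub>?F\<^esub> ?c v k"
      using H.r_one[OF Yc[OF v(1)], of k] Ymod[OF v(1)] by (simp del: mult_FactGroup one_FactGroup) (simp add: Y_def)
  next
    fix w assume w: "w \<in> fp_words ?V ?G"
    then have "w \<in> fp_words ?V ?Z \<and> W.Mw w = w" by (induction w) (auto simp: car)
    then show "\<exists>u\<in>fp_words ?V ?Z. W.Mw u = w" by blast
  qed
  moreover have "standard_graph_group \<Gamma> p = ?F Mod ?N"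
    by (simp add: standard_graph_group_def presented_group_def free_group_on_def free_gen_def fp_incl_def S_def Let_def)
  ultimately show ?thesis by auto
qed

theorem corollary3:
  fixes \<Gamma> :: "'v pair_pre_digraph"
    and G :: "'v \<Rightarrow> ('a, 'm) monoid_scheme"
    and p :: "'v \<Rightarrow> nat"
  assumes "pair_graph \<Gamma>"
  shows "((\<forall>v\<in>pverts \<Gamma>. comm_group (G v) \<and> finite (carrier (G v))) \<longrightarrow>
           (property_T (Out (graph_product \<Gamma> G)) \<longleftrightarrow>
             finite (carrier (Out (graph_product \<Gamma> G))))) \<and>
         ((\<forall>v\<in>pverts \<Gamma>. primepow (p v)) \<longrightarrow>
           (property_T (Out (standard_graph_group \<Gamma> p)) \<longleftrightarrow>
             \<not> (\<exists>x1 x2 z. SIL \<Gamma> x1 x2 z)))"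
proof (intro conjI impI)
  assume "\<forall>v\<in>pverts \<Gamma>. comm_group (G v) \<and> finite (carrier (G v))"
  \<comment> \<open>The claim does not mention the graph, so it may be proved with the vertices of
    trivial group left out.\<close>
  then obtain V \<iota> where "graph_group V (\<lambda>u v. u \<rightarrow>\<^bsub>\<Gamma>\<^esub> v) G (graph_product \<Gamma> G) \<iota>"
    using graph_group_graph_product[OF assms, of G] by blast
  then show "property_T (Out (graph_product \<Gamma> G)) \<longleftrightarrow> finite (carrier (Out (graph_product \<Gamma> G)))"
    by (rule graph_group.property_T_Out_iff(2))
next
  assume "\<forall>v\<in>pverts \<Gamma>. primepow (p v)"
  \<comment> \<open>A prime power exceeds 1, so all vertex groups are nontrivial and the SILs are
    those of the full graph.\<close>
  then have "p v > 1" if "v \<in> pverts \<Gamma>" for v using that primepow_gt_Suc_0 by auto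
  then obtain \<iota> where "graph_group (pverts \<Gamma>) (\<lambda>u v. u \<rightarrow>\<^bsub>\<Gamma>\<^esub> v) (\<lambda>v. integer_mod_group (p v)) (standard_graph_group \<Gamma> p) \<iota>"
    using graph_group_standard_graph_group[OF assms] by blast
  then interpret graph_group "pverts \<Gamma>" "\<lambda>u v. u \<rightarrow>\<^bsub>\<Gamma>\<^esub> v" "\<lambda>v. integer_mod_group (p v)" "standard_graph_group \<Gamma> p" \<iota> .
  show "property_T (Out (standard_graph_group \<Gamma> p)) \<longleftrightarrow> \<not> (\<exists>x1 x2 z. SIL \<Gamma> x1 x2 z)"
    unfolding property_T_Out_iff(1) sil_def SIL_iff[OF assms] ..
qed

end
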